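(* Let $k$ be an algebraically closed field of characteristic two. A smooth cubic surface over $k$ is Frobenius split unless it is "triangle-free", that is, unless each and every collection of coplanar lines on it meet at one point. In particular, the only smooth cubic surface over $k$ that is not Frobenius split (up to projective change of coordinates) is the Fermat cubic defined by $x^3+y^3+z^3+w^3$.
   Context: A cubic surface is the subscheme of $\mathbb P^3$ cut out by a single homogeneous polynomial of degree 3. A scheme $X$ over a field of characteristic $p>0$ is Frobenius split if the map of sheaves $\mathcal O_X\to F_*\mathcal O_X$ induced by the Frobenius morphism $F:X\to X$ (the identity on the underlying space, the $p$-th power map on functions) splits. A triangle is a set of three coplanar lines on the surface that do not meet at a point. *)

theory Defs
  imports
    "HOL-Analysis.Analysis"
    "HOL-Algebra.Ring"
    "HOL-Library.Poly_Mapping"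
    "HOL-Computational_Algebra.Polynomial"
begin

section \<open>The polynomial ring in four variables\<close>

text \<open>
  The four homogeneous coordinates are indexed by the four-element type \<open>4\<close>, which
  is also the index type of the coordinate space \<open>'k ^ 4\<close>.
\<close>

type_synonym 'k poly4 = "(4 \<Rightarrow>\<^sub>0 nat) \<Rightarrow>\<^sub>0 'k"

definition mdegree :: "(4 \<Rightarrow>\<^sub>0 nat) \<Rightarrow> nat" where
  "mdegree m = (\<Sum>i\<in>UNIV. Poly_Mapping.lookup m i)"

text \<open>The zero polynomial is homogeneous of every degree.\<close>

definition homogeneous :: "nat \<Rightarrow> 'k::zero poly4 \<Rightarrow> bool" where
  "homogeneous d f \<longleftrightarrow> (\<forall>m\<in>Poly_Mapping.keys f. mdegree m = d)"

definition hom_component :: "nat \<Rightarrow> 'k::comm_monoid_add poly4 \<Rightarrow> 'k poly4" where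
  "hom_component d f =
     (\<Sum>m | m \<in> Poly_Mapping.keys f \<and> mdegree m = d.
        Poly_Mapping.single m (Poly_Mapping.lookup f m))"

definition Const :: "'k::zero \<Rightarrow> 'k poly4" where
  "Const c = Poly_Mapping.single 0 c"

definition Var :: "4 \<Rightarrow> 'k::zero_neq_one poly4" where
  "Var i = Poly_Mapping.single (Poly_Mapping.single i 1) 1"

text \<open>Apply \<open>h\<close> to the coefficients of \<open>f\<close> and substitute \<open>x i\<close> for the \<open>i\<close>-th variable.\<close>

definition subst4 :: "('k::zero \<Rightarrow> 'r::comm_semiring_1) \<Rightarrow> (4 \<Rightarrow> 'r) \<Rightarrow> 'k poly4 \<Rightarrow> 'r" where
  "subst4 h x f =
     (\<Sum>m\<in>Poly_Mapping.keys f.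
        h (Poly_Mapping.lookup f m) * (\<Prod>i\<in>UNIV. x i ^ Poly_Mapping.lookup m i))"

definition eval4 :: "'k::comm_semiring_1 poly4 \<Rightarrow> 'k ^ 4 \<Rightarrow> 'k" where
  "eval4 f v = subst4 (\<lambda>c. c) (\<lambda>i. v $ i) f"

text \<open>
  If \<open>x\<^sub>i\<close> does not divide the monomial \<open>m\<close>, the subtraction of exponents truncates, but
  then the coefficient is zero.
\<close>

definition deriv4 :: "4 \<Rightarrow> 'k::comm_semiring_1 poly4 \<Rightarrow> 'k poly4" where
  "deriv4 i f =
     (\<Sum>m\<in>Poly_Mapping.keys f.
        Poly_Mapping.single (m - Poly_Mapping.single i 1)
          (of_nat (Poly_Mapping.lookup m i) * Poly_Mapping.lookup f m))"


section \<open>Smooth cubic surfaces, their lines, and projective equivalence\<close>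

text \<open>
  The surface is the subscheme of projective 3-space cut out by \<open>F\<close>. Smoothness is the
  Jacobian criterion at the \<open>k\<close>-points, appropriate because \<open>k\<close> will be algebraically closed.
\<close>

definition smooth_cubic_surface :: "'k::field poly4 \<Rightarrow> bool" where
  "smooth_cubic_surface F \<longleftrightarrow>
     F \<noteq> 0 \<and> homogeneous 3 F \<and>
     (\<forall>v. v \<noteq> 0 \<and> eval4 F v = 0 \<longrightarrow> (\<exists>i. eval4 (deriv4 i F) v \<noteq> 0))"

text \<open>
  Points, lines and planes of projective 3-space are the linear subspaces of \<open>'k ^ 4\<close> of
  dimension 1, 2 and 3; a point is given by a nonzero vector spanning it.
\<close>

definition lines_on :: "'k::field poly4 \<Rightarrow> ('k ^ 4) set set" where
  "lines_on F = {L. vec.subspace L \<and> vec.dim L = 2 \<and> (\<forall>v\<in>L. eval4 F v = 0)}"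

definition triangle_free :: "'k::field poly4 \<Rightarrow> bool" where
  "triangle_free F \<longleftrightarrow>
     (\<forall>H \<L>. vec.subspace H \<and> vec.dim H = 3 \<and> \<L> \<subseteq> lines_on F \<and> (\<forall>L\<in>\<L>. L \<subseteq> H) \<longrightarrow>
        (\<exists>v. v \<noteq> 0 \<and> (\<forall>L\<in>\<L>. v \<in> L)))"

text \<open>
  The scalar \<open>c\<close> is there because equations that differ by a unit cut out the same surface.
\<close>

definition projectively_equivalent :: "'k::field poly4 \<Rightarrow> 'k poly4 \<Rightarrow> bool" where
  "projectively_equivalent F G \<longleftrightarrow>
     (\<exists>(A :: 'k ^ 4 ^ 4) c. invertible A \<and> c \<noteq> 0 \<and>
        subst4 Const (\<lambda>i. \<Sum>j\<in>UNIV. Const (A $ i $ j) * Var j) F = Const c * G)"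

definition fermat_cubic :: "'k::field poly4" where
  "fermat_cubic = (\<Sum>i\<in>UNIV. Var i ^ 3)"


section \<open>The scheme cut out by a homogeneous polynomial\<close>

text \<open>
  \<open>Proj k[x\<^sub>0,\<dots>,x\<^sub>3]/(F)\<close>. A homogeneous prime ideal of the quotient is represented by its
  preimage, a homogeneous prime ideal of the polynomial ring that contains \<open>F\<close>.
\<close>

definition homogeneous_prime :: "'k::field poly4 set \<Rightarrow> bool" where
  "homogeneous_prime P \<longleftrightarrow>
     0 \<in> P \<and> 1 \<notin> P \<and>
     (\<forall>f\<in>P. \<forall>g\<in>P. f + g \<in> P) \<and>
     (\<forall>f. \<forall>g\<in>P. f * g \<in> P) \<and>
     (\<forall>f g. f * g \<in> P \<longrightarrow> f \<in> P \<or> g \<in> P) \<and>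
     (\<forall>f\<in>P. \<forall>d. hom_component d f \<in> P)"

definition proj_points :: "'k::field poly4 \<Rightarrow> 'k poly4 set set" where
  "proj_points F = {P. homogeneous_prime P \<and> F \<in> P \<and> (\<exists>i. Var i \<notin> P)}"

definition proj_open :: "'k::field poly4 \<Rightarrow> 'k poly4 set set \<Rightarrow> bool" where
  "proj_open F U \<longleftrightarrow>
     (\<exists>G. (\<forall>g\<in>G. \<exists>d. homogeneous d g) \<and> U = {P \<in> proj_points F. \<not> G \<subseteq> P})"

definition proj_topology :: "'k::field poly4 \<Rightarrow> 'k poly4 set topology" where
  "proj_topology F = topology (proj_open F)"

lemma homogeneous_mult:
  fixes f g :: "'k::field poly4"
  assumes "homogeneous d f" "homogeneous e g"
  shows "homogeneous (d + e) (f * g)"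
  unfolding homogeneous_def
proof
  fix m assume "m \<in> Poly_Mapping.keys (f * g)"
  then obtain a b where "m = a + b" "a \<in> Poly_Mapping.keys f" "b \<in> Poly_Mapping.keys g"
    using keys_mult[of f g] by blast
  with assms show "mdegree m = d + e"
    by (simp add: homogeneous_def mdegree_def lookup_add sum.distrib)
qed

lemma istopology_proj_open: "istopology (proj_open F)"
  unfolding istopology_def
proof (intro conjI allI impI)
  fix S T assume "proj_open F S" "proj_open F T"
  then obtain G H where G: "\<forall>g\<in>G. \<exists>d. homogeneous d g" "S = {P \<in> proj_points F. \<not> G \<subseteq> P}"
    and H: "\<forall>h\<in>H. \<exists>d. homogeneous d h" "T = {P \<in> proj_points F. \<not> H \<subseteq> P}"
    unfolding proj_open_def by auto
  let ?K = "{g * h | g h. g \<in> G \<and> h \<in> H}"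
  have "\<forall>k\<in>?K. \<exists>d. homogeneous d k"
    using G(1) H(1) homogeneous_mult by blast
  moreover have "S \<inter> T = {P \<in> proj_points F. \<not> ?K \<subseteq> P}"
  proof -
    have iff: "\<not> ?K \<subseteq> P \<longleftrightarrow> \<not> G \<subseteq> P \<and> \<not> H \<subseteq> P" if "P \<in> proj_points F" for P
    proof -
      have P: "homogeneous_prime P"
        using that by (simp add: proj_points_def)
      have *: "g * h \<in> P \<longleftrightarrow> g \<in> P \<or> h \<in> P" for g h
      proof
        assume "g * h \<in> P"
        with P show "g \<in> P \<or> h \<in> P" by (simp add: homogeneous_prime_def)
      next
        have mult: "f * x \<in> P" if "x \<in> P" for f x
          using P that by (simp add: homogeneous_prime_def)
        assume "g \<in> P \<or> h \<in> P"
        then show "g * h \<in> P"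
        proof
          assume "g \<in> P"
          from mult[OF this, of h] show ?thesis by (simp only: mult.commute)
        next
          assume "h \<in> P"
          from mult[OF this] show ?thesis .
        qed
      qed
      show ?thesis
      proof
        assume "\<not> ?K \<subseteq> P"
        then obtain g h where "g \<in> G" "h \<in> H" "g * h \<notin> P" by auto
        with * show "\<not> G \<subseteq> P \<and> \<not> H \<subseteq> P" by auto
      next
        assume "\<not> G \<subseteq> P \<and> \<not> H \<subseteq> P"
        then obtain g h where "g \<in> G" "h \<in> H" "g \<notin> P" "h \<notin> P" by auto
        then have "g * h \<in> ?K" "g * h \<notin> P" using * by auto
        then show "\<not> ?K \<subseteq> P" by (meson subsetD)
      qed
    qed
    have "{P \<in> proj_points F. \<not> G \<subseteq> P \<and> \<not> H \<subseteq> P} = {P \<in> proj_points F. \<not> ?K \<subseteq> P}"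
      by (rule Collect_cong, rule conj_cong, rule refl, rule iff[symmetric])
    moreover have "S \<inter> T = {P \<in> proj_points F. \<not> G \<subseteq> P \<and> \<not> H \<subseteq> P}"
      unfolding G(2) H(2) by auto
    ultimately show ?thesis by simp
  qed
  ultimately show "proj_open F (S \<inter> T)" unfolding proj_open_def by blast
next
  fix K assume "\<forall>S\<in>K. proj_open F S"
  then have "\<forall>S\<in>K. \<exists>G. (\<forall>g\<in>G. \<exists>d. homogeneous d g) \<and> S = {P \<in> proj_points F. \<not> G \<subseteq> P}"
    unfolding proj_open_def .
  from bchoice[OF this] obtain G
    where G: "\<forall>S\<in>K. (\<forall>g\<in>G S. \<exists>d. homogeneous d g) \<and> S = {P \<in> proj_points F. \<not> G S \<subseteq> P}" ..
  have hom: "\<forall>g\<in>G S. \<exists>d. homogeneous d g" if "S \<in> K" for S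
    by (rule bspec[OF G that, THEN conjunct1])
  have S: "S = {P \<in> proj_points F. \<not> G S \<subseteq> P}" if "S \<in> K" for S
    by (rule bspec[OF G that, THEN conjunct2])
  have "\<Union>K = (\<Union>S\<in>K. S)"
    by simp
  also have "\<dots> = (\<Union>S\<in>K. {P \<in> proj_points F. \<not> G S \<subseteq> P})"
    by (rule SUP_cong[OF refl S])
  also have "\<dots> = {P \<in> proj_points F. \<not> \<Union>(G ` K) \<subseteq> P}"
    by auto
  finally have "\<Union>K = {P \<in> proj_points F. \<not> \<Union>(G ` K) \<subseteq> P}" .
  moreover have "\<forall>g\<in>\<Union>(G ` K). \<exists>d. homogeneous d g"
    using hom by blast
  ultimately show "proj_open F (\<Union>K)"
    unfolding proj_open_def by (intro exI[of _ "\<Union>(G ` K)"] conjI)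
qed

lemma openin_proj_topology: "openin (proj_topology F) = proj_open F"
  by (simp add: proj_topology_def istopology_proj_open)

text \<open>
  The local ring at \<open>P\<close> is the degree zero part of the localization of \<open>k[x\<^sub>0,\<dots>,x\<^sub>3]/(F)\<close>
  at the homogeneous elements outside \<open>P\<close>. Its elements are classes of pairs (numerator,
  denominator); \<open>fraction F P a b\<close> is the class of \<open>a / b\<close>.
\<close>

definition is_fraction :: "'k::field poly4 set \<Rightarrow> 'k poly4 \<Rightarrow> 'k poly4 \<Rightarrow> bool" where
  "is_fraction P a b \<longleftrightarrow> b \<notin> P \<and> (\<exists>d. homogeneous d a \<and> homogeneous d b)"

type_synonym 'k germ = "('k poly4 \<times> 'k poly4) set"

definition fraction ::
    "'k::field poly4 \<Rightarrow> 'k poly4 set \<Rightarrow> 'k poly4 \<Rightarrow> 'k poly4 \<Rightarrow> 'k germ" where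
  "fraction F P a b =
     {(a', b'). is_fraction P a' b' \<and>
        (\<exists>s d. homogeneous d s \<and> s \<notin> P \<and> F dvd s * (a * b' - a' * b))}"

definition germ_add ::
    "'k::field poly4 \<Rightarrow> 'k poly4 set \<Rightarrow> 'k germ \<Rightarrow> 'k germ \<Rightarrow> 'k germ" where
  "germ_add F P s t = (\<Union>(a, b)\<in>s. \<Union>(c, d)\<in>t. fraction F P (a * d + c * b) (b * d))"

definition germ_mult ::
    "'k::field poly4 \<Rightarrow> 'k poly4 set \<Rightarrow> 'k germ \<Rightarrow> 'k germ \<Rightarrow> 'k germ" where
  "germ_mult F P s t = (\<Union>(a, b)\<in>s. \<Union>(c, d)\<in>t. fraction F P (a * c) (b * d))"

text \<open>
  Sections over \<open>U\<close> are families of elements of the local rings at the points of \<open>U\<close>,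
  locally given by a single fraction. They are extensional functions, so that restriction
  of sections is \<^const>\<open>restrict\<close>.
\<close>

type_synonym 'k sect = "'k poly4 set \<Rightarrow> 'k germ"

definition sections :: "'k::field poly4 \<Rightarrow> 'k poly4 set set \<Rightarrow> 'k sect set" where
  "sections F U =
     {s \<in> extensional U. \<forall>P\<in>U. \<exists>V a b. openin (proj_topology F) V \<and> P \<in> V \<and> V \<subseteq> U \<and>
        (\<forall>Q\<in>V. is_fraction Q a b \<and> s Q = fraction F Q a b)}"

definition structure_sheaf :: "'k::field poly4 \<Rightarrow> 'k poly4 set set \<Rightarrow> 'k sect ring" where
  "structure_sheaf F U =
     \<lparr> carrier = sections F U,
       mult = (\<lambda>s t. \<lambda>P\<in>U. germ_mult F P (s P) (t P)),
       one = (\<lambda>P\<in>U. fraction F P 1 1),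
       zero = (\<lambda>P\<in>U. fraction F P 0 1),
       add = (\<lambda>s t. \<lambda>P\<in>U. germ_add F P (s P) (t P)) \<rparr>"


section \<open>Frobenius splitting\<close>

text \<open>
  For a space \<open>X\<close> with a sheaf of rings \<open>O\<close> of characteristic \<open>p\<close> and restriction maps
  \<open>res U V : O(U) \<rightarrow> O(V)\<close>: the \<open>p\<close>-th power map from \<open>O\<close> to \<open>F\<^sub>*O\<close> has a left inverse \<open>\<phi>\<close>
  that is a morphism of sheaves of \<open>O\<close>-modules. On \<open>F\<^sub>*O\<close>, whose sections over \<open>U\<close> are again
  \<open>O(U)\<close>, a section \<open>a\<close> of \<open>O\<close> acts as multiplication by its \<open>p\<close>-th power.
\<close>

definition frobenius_split ::
    "nat \<Rightarrow> 'x topology \<Rightarrow> ('x set \<Rightarrow> 's ring) \<Rightarrow> ('x set \<Rightarrow> 'x set \<Rightarrow> 's \<Rightarrow> 's) \<Rightarrow> bool" where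
  "frobenius_split p X \<O> res \<longleftrightarrow>
     (\<exists>\<phi> :: 'x set \<Rightarrow> 's \<Rightarrow> 's.
        (\<forall>U. openin X U \<longrightarrow>
           \<phi> U \<in> carrier (\<O> U) \<rightarrow> carrier (\<O> U) \<and>
           (\<forall>a\<in>carrier (\<O> U). \<forall>b\<in>carrier (\<O> U).
              \<phi> U (a \<oplus>\<^bsub>\<O> U\<^esub> b) = \<phi> U a \<oplus>\<^bsub>\<O> U\<^esub> \<phi> U b \<and>
              \<phi> U ((a [^]\<^bsub>\<O> U\<^esub> p) \<otimes>\<^bsub>\<O> U\<^esub> b) = a \<otimes>\<^bsub>\<O> U\<^esub> \<phi> U b) \<and>
           (\<forall>a\<in>carrier (\<O> U). \<phi> U (a [^]\<^bsub>\<O> U\<^esub> p) = a)) \<and>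
        (\<forall>U V. openin X U \<longrightarrow> openin X V \<longrightarrow> V \<subseteq> U \<longrightarrow>
           (\<forall>a\<in>carrier (\<O> U). \<phi> V (res U V a) = res U V (\<phi> U a))))"

definition frobenius_split_surface :: "'k::field poly4 \<Rightarrow> bool" where
  "frobenius_split_surface F \<longleftrightarrow>
     frobenius_split CHAR('k) (proj_topology F) (structure_sheaf F) (\<lambda>U V s. restrict s V)"

end

theory Submission
  imports Defs "HOL-Computational_Algebra.Formal_Laurent_Series"
begin

text \<open>
  Let \<open>q\<close> be the vector of coefficients of the four squarefree monomials of the cubic form \<open>F\<close>. In
  characteristic two the full polarisation of \<open>F\<close> is the alternating trilinear form
  \<open>(x, y, z) \<mapsto> det(q, x, y, z)\<close>, so \<open>q\<close> is attached to the surface independently of coordinates, and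
  \<open>q = 0\<close> is Fedder's condition \<open>F \<in> (x\<^sub>1\<^sup>2, \<dots>, x\<^sub>4\<^sup>2)\<close>. Not being split, having no
  triangle and being equivalent to the Fermat cubic all amount to \<open>q = 0\<close>.

  If \<open>q \<noteq> 0\<close>, a multiple of \<open>g \<mapsto> Tr(F x\<^sub>i g)\<close> induces a splitting; if \<open>F = \<Sum>\<^sub>i x\<^sub>i\<^sup>2 L\<^sub>i\<close>, applying a splitting
  to \<open>L\<^sub>i F = 0\<close> yields \<open>F = 0\<close>. If \<open>q = 0\<close>, three non-concurrent lines in a plane would force \<open>F\<close> to
  vanish on the plane, because its restriction is a multiple of \<open>xyz\<close> and has no such term; and \<open>F\<close> is a
  nondegenerate Hermitian form, which Lang's theorem brings to Fermat form. If \<open>q \<noteq> 0\<close>, the surface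
  contains a line avoiding \<open>q\<close>; among the planes through it, one that avoids \<open>q\<close> has a degenerate
  residual conic, which gives a triangle.

  The existence of a line and Lang's theorem are both obtained by solving the equations over
  \<open>k[[t]]\<close> along a pencil starting at an explicit solution, and specialising at \<open>t = 1\<close> by a place of
  \<open>k((t))\<close>, which exists by Chevalley's extension theorem.
\<close>

text \<open>In characteristic two the gradient of the form at \<open>x\<close> is additive in
  \<open>x\<close> after squaring, up to a cross term controlled by \<open>q\<close>. A quadratic
  form without cross terms is then the square of a linear form, so it has a zero on every line;
  whenever an argument would break down, such a zero produces a point where the gradient vanishes,
  against smoothness. The solution at t = 0 is chosen with invertible linearised equations, so it
  lifts to k[[t]] by mere iteration. A power series has no value at t = 1, and a place extending
  evaluation on k[t] gives one only where the solution is integral. Homogeneous coordinates become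
  integral by scaling, which settles lines; a matrix may not be scaled, so its integrality has to
  come from the equation. The trace lowers degrees by four before halving them, and four is the
  degree of F times a variable. In the converse direction a splitting acts only on local sections;
  two variables that form a regular sequence with F are what turns it into a map between spaces of
  forms.\<close>

no_notation fps_nth (infixl \<open>$\<close> 75)

section \<open>Polynomials in four variables\<close>

lemma poly_mapping_sum_single:
  fixes f :: "'m \<Rightarrow>\<^sub>0 'a::comm_monoid_add"
  shows "f = (\<Sum>m\<in>Poly_Mapping.keys f. Poly_Mapping.single m (Poly_Mapping.lookup f m))"
proof (rule poly_mapping_eqI)
  fix k
  have "Poly_Mapping.lookup (\<Sum>m\<in>Poly_Mapping.keys f. Poly_Mapping.single m (Poly_Mapping.lookup f m)) k
     = (\<Sum>m\<in>Poly_Mapping.keys f. if m = k then Poly_Mapping.lookup f k else 0)"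
    by (auto simp: lookup_sum lookup_single when_def intro!: sum.cong)
  also have "\<dots> = Poly_Mapping.lookup f k"
    by (simp add: in_keys_iff)
  finally show "Poly_Mapping.lookup f k =
    Poly_Mapping.lookup (\<Sum>m\<in>Poly_Mapping.keys f. Poly_Mapping.single m (Poly_Mapping.lookup f m)) k" by simp
qed

lemma poly_mapping_single_induct [case_names zero single add]:
  fixes f :: "'m \<Rightarrow>\<^sub>0 'a::comm_monoid_add"
  assumes "P 0" "\<And>m c. P (Poly_Mapping.single m c)" "\<And>f g. P f \<Longrightarrow> P g \<Longrightarrow> P (f + g)"
  shows "P f"
proof -
  have "P (\<Sum>m\<in>A. Poly_Mapping.single m (Poly_Mapping.lookup f m))" if "finite A" for A
    using that by (induction A) (auto intro: assms)
  then show ?thesis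
    using poly_mapping_sum_single[of f] finite_keys[of f] by metis
qed

text \<open>The coefficient maps need only be additive: evaluation, differentiation and the trace,
  which takes square roots of coefficients, all have this form.\<close>

definition additive_ext :: "('m \<Rightarrow> 'a \<Rightarrow> 'r) \<Rightarrow> ('m \<Rightarrow>\<^sub>0 'a::comm_monoid_add) \<Rightarrow> 'r::comm_monoid_add" where
  "additive_ext \<psi> f = (\<Sum>m\<in>Poly_Mapping.keys f. \<psi> m (Poly_Mapping.lookup f m))"

lemma additive_ext_0 [simp]: "additive_ext \<psi> 0 = 0"
  by (simp add: additive_ext_def)

lemma additive_ext_single:
  assumes "\<And>m. \<psi> m 0 = 0"
  shows "additive_ext \<psi> (Poly_Mapping.single m c) = \<psi> m c"
  by (simp add: additive_ext_def assms)

lemma additive_ext_superset: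
  assumes "\<And>m. \<psi> m 0 = 0" "finite A" "Poly_Mapping.keys f \<subseteq> A"
  shows "additive_ext \<psi> f = (\<Sum>m\<in>A. \<psi> m (Poly_Mapping.lookup f m))"
  unfolding additive_ext_def
  by (rule sum.mono_neutral_left) (use assms in \<open>auto simp: in_keys_iff\<close>)

lemma additive_ext_add:
  assumes "\<And>m. \<psi> m 0 = 0" "\<And>m a b. \<psi> m (a + b) = \<psi> m a + \<psi> m b"
  shows "additive_ext \<psi> (f + g) = additive_ext \<psi> f + additive_ext \<psi> g"
proof -
  let ?A = "Poly_Mapping.keys f \<union> Poly_Mapping.keys g"
  have "additive_ext \<psi> h = (\<Sum>m\<in>?A. \<psi> m (Poly_Mapping.lookup h m))" if "Poly_Mapping.keys h \<subseteq> ?A" for h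
    by (rule additive_ext_superset) (use assms that in auto)
  then show ?thesis
    using keys_add[of f g] by (simp add: lookup_add assms sum.distrib)
qed

lemma mdegree_add: "mdegree (m + n) = mdegree m + mdegree n"
  by (simp add: mdegree_def lookup_add sum.distrib)

lemma mdegree_single: "mdegree (Poly_Mapping.single i n) = n"
  by (simp add: mdegree_def lookup_single when_def)

lemma homogeneous_0 [simp]: "homogeneous d 0"
  by (simp add: homogeneous_def)

lemma homogeneous_single: "mdegree m = d \<Longrightarrow> homogeneous d (Poly_Mapping.single m c)"
  by (auto simp: homogeneous_def)

lemma homogeneous_1: "homogeneous 0 (1 :: 'k::field poly4)"
  by (simp add: homogeneous_def mdegree_def)

lemma homogeneous_add: "homogeneous d f \<Longrightarrow> homogeneous d g \<Longrightarrow> homogeneous d (f + g)"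
  using keys_add[of f g] by (auto simp: homogeneous_def)

lemma homogeneous_uminus: "homogeneous d (f :: 'k::field poly4) \<Longrightarrow> homogeneous d (- f)"
  by (simp add: homogeneous_def)

lemma homogeneous_diff: "homogeneous d (f :: 'k::field poly4) \<Longrightarrow> homogeneous d g \<Longrightarrow> homogeneous d (f - g)"
  using homogeneous_add[OF _ homogeneous_uminus] by (metis diff_conv_add_uminus)

lemma homogeneous_sum: "(\<And>i. i \<in> A \<Longrightarrow> homogeneous d (f i)) \<Longrightarrow> homogeneous d (\<Sum>i\<in>A. f i)"
  by (induction A rule: infinite_finite_induct) (auto intro: homogeneous_add)

lemma homogeneous_power: "homogeneous d (f :: 'k::field poly4) \<Longrightarrow> homogeneous (n * d) (f ^ n)"
  by (induction n) (auto intro: homogeneous_1 homogeneous_mult)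

lemma homogeneous_Var: "homogeneous 1 (Var i :: 'k::field poly4)"
  by (simp add: Var_def homogeneous_def mdegree_single)

lemma homogeneous_Var_power: "homogeneous n (Var i ^ n :: 'k::field poly4)"
  using homogeneous_power[OF homogeneous_Var, of n i] by simp

lemma homogeneous_Const: "homogeneous 0 (Const c)"
  by (auto simp: Const_def homogeneous_def mdegree_def)

lemma homogeneous_Const_mult: "homogeneous d (f :: 'k::field poly4) \<Longrightarrow> homogeneous d (Const c * f)"
  using homogeneous_mult[OF homogeneous_Const] by fastforce

lemma lookup_hom_component:
  "Poly_Mapping.lookup (hom_component d f) m = (if mdegree m = d then Poly_Mapping.lookup f m else 0)"
proof -
  have "Poly_Mapping.lookup (hom_component d f) m =
      (\<Sum>n | n \<in> Poly_Mapping.keys f \<and> mdegree n = d. if n = m then Poly_Mapping.lookup f m else 0)"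
    unfolding hom_component_def
    by (auto simp: lookup_sum lookup_single when_def intro!: sum.cong)
  also have "\<dots> = (if mdegree m = d then Poly_Mapping.lookup f m else 0)"
    by (simp add: in_keys_iff)
  finally show ?thesis .
qed

lemma hom_component_0 [simp]: "hom_component d 0 = 0"
  by (simp add: hom_component_def)

lemma hom_component_add: "hom_component d (f + g) = hom_component d f + hom_component d g"
  by (rule poly_mapping_eqI) (simp add: lookup_hom_component lookup_add)

lemma hom_component_sum: "hom_component d (\<Sum>i\<in>A. f i) = (\<Sum>i\<in>A. hom_component d (f i))"
  by (induction A rule: infinite_finite_induct) (auto simp: hom_component_add)

lemma homogeneous_hom_component: "homogeneous d (hom_component d f)"
  by (auto simp: homogeneous_def in_keys_iff lookup_hom_component split: if_splits)

lemma hom_component_homogeneous: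
  "homogeneous e f \<Longrightarrow> hom_component d f = (if d = e then f else 0)"
  by (rule poly_mapping_eqI) (auto simp: homogeneous_def in_keys_iff lookup_hom_component)

lemma hom_component_mult_homogeneous:
  fixes f g :: "'k::field poly4"
  assumes g: "homogeneous e g"
  shows "hom_component n (f * g) = (if e \<le> n then hom_component (n - e) f * g else 0)"
proof (induction f rule: poly_mapping_single_induct)
  case (single m c)
  have m: "homogeneous (mdegree m) (Poly_Mapping.single m c)"
    by (rule homogeneous_single) simp
  show ?case
    using hom_component_homogeneous[OF m] hom_component_homogeneous[OF homogeneous_mult[OF m g]] by auto
qed (auto simp: hom_component_add distrib_right)

lemma hom_component_mult:
  fixes f g :: "'k::field poly4"
  shows "hom_component n (f * g) = (\<Sum>a\<le>n. hom_component a f * hom_component (n - a) g)"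
proof (induction g rule: poly_mapping_single_induct)
  case (single m c)
  have m: "homogeneous (mdegree m) (Poly_Mapping.single m c)"
    by (rule homogeneous_single) simp
  let ?e = "mdegree m" and ?s = "Poly_Mapping.single m c"
  have "(\<Sum>a\<le>n. hom_component a f * hom_component (n - a) ?s) =
      (\<Sum>a\<le>n. if a = n - ?e then (if ?e \<le> n then hom_component (n - ?e) f * ?s else 0) else 0)"
    by (rule sum.cong) (auto simp: hom_component_homogeneous[OF m])
  then show ?case
    by (simp add: hom_component_mult_homogeneous[OF m])
qed (auto simp: hom_component_add distrib_left sum.distrib)

lemma hom_component_finite: "finite {d. hom_component d f \<noteq> 0}"
proof (rule finite_subset)
  show "{d. hom_component d f \<noteq> 0} \<subseteq> mdegree ` Poly_Mapping.keys f"
  proof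
    fix d assume "d \<in> {d. hom_component d f \<noteq> 0}"
    then obtain m where "Poly_Mapping.lookup (hom_component d f) m \<noteq> 0"
      by (metis (mono_tags) lookup_zero mem_Collect_eq poly_mapping_eqI)
    then show "d \<in> mdegree ` Poly_Mapping.keys f"
      by (auto simp: lookup_hom_component in_keys_iff split: if_splits)
  qed
qed simp

lemma sum_hom_component:
  assumes "finite A" "{d. hom_component d f \<noteq> 0} \<subseteq> A"
  shows "(\<Sum>d\<in>A. hom_component d f) = f"
proof (rule poly_mapping_eqI)
  fix m
  have "Poly_Mapping.lookup f m = 0" if "mdegree m \<notin> A"
  proof -
    have "hom_component (mdegree m) f = 0"
      using assms(2) that by auto
    then show ?thesis
      using lookup_hom_component[of "mdegree m" f m] by simp
  qed
  then show "Poly_Mapping.lookup (\<Sum>d\<in>A. hom_component d f) m = Poly_Mapping.lookup f m"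
    using assms(1) by (auto simp: lookup_sum lookup_hom_component)
qed

text \<open>This turns congruences modulo the cubic between linear or quadratic forms into
  equalities.\<close>

lemma dvd_homogeneous_degree:
  fixes F g :: "'k::field poly4"
  assumes "homogeneous d F" "homogeneous e g" "F dvd g" "e < d"
  shows "g = 0"
proof -
  obtain k where "g = k * F"
    using assms(3) by (metis dvdE mult.commute)
  then show ?thesis
    using hom_component_mult_homogeneous[OF assms(1), of e k] hom_component_homogeneous[OF assms(2), of e] assms(4)
    by simp
qed

subsection \<open>Substitution\<close>

locale coefficient_hom =
  fixes h :: "'k::comm_semiring_1 \<Rightarrow> 'r::comm_semiring_1"
  assumes h_0: "h 0 = 0" and h_1: "h 1 = 1"
    and h_add: "h (a + b) = h a + h b" and h_mult: "h (a * b) = h a * h b"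
begin

lemma subst4_additive_ext:
  "subst4 h x f = additive_ext (\<lambda>m c. h c * (\<Prod>i\<in>UNIV. x i ^ Poly_Mapping.lookup m i)) f"
  by (simp add: subst4_def additive_ext_def)

lemma subst4_0 [simp]: "subst4 h x 0 = 0"
  by (simp add: subst4_def)

lemma subst4_add: "subst4 h x (f + g) = subst4 h x f + subst4 h x g"
  unfolding subst4_additive_ext by (rule additive_ext_add) (auto simp: h_0 h_add distrib_right)

lemma subst4_single:
  "subst4 h x (Poly_Mapping.single m c) = h c * (\<Prod>i\<in>UNIV. x i ^ Poly_Mapping.lookup m i)"
  unfolding subst4_additive_ext by (rule additive_ext_single) (simp add: h_0)

lemma subst4_sum: "subst4 h x (\<Sum>i\<in>A. f i) = (\<Sum>i\<in>A. subst4 h x (f i))"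
  by (induction A rule: infinite_finite_induct) (auto simp: subst4_add)

lemma subst4_mult: "subst4 h x (f * g) = subst4 h x f * subst4 h x g"
proof (induction f rule: poly_mapping_single_induct)
  case (single m c)
  show ?case
  proof (induction g rule: poly_mapping_single_induct)
    case (single n d)
    show ?case
      by (simp add: mult_single subst4_single lookup_add power_add prod.distrib h_mult ac_simps)
  qed (auto simp: subst4_add distrib_left)
qed (auto simp: subst4_add distrib_right)

lemma subst4_1 [simp]: "subst4 h x 1 = 1"
  using subst4_single[of x 0 1] by (simp add: h_1)

lemma subst4_power: "subst4 h x (f ^ n) = subst4 h x f ^ n"
  by (induction n) (auto simp: subst4_mult)

lemma subst4_Const [simp]: "subst4 h x (Const c) = h c"
  by (simp add: Const_def subst4_single)

lemma subst4_Var [simp]: "subst4 h x (Var i) = x i"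
proof -
  have "x j ^ Poly_Mapping.lookup (Poly_Mapping.single i (1::nat)) j = (if j = i then x i else 1)" for j
    by (auto simp: lookup_single when_def)
  then show ?thesis
    by (simp add: Var_def subst4_single h_1)
qed

end

lemma coefficient_hom_Const: "coefficient_hom (Const :: 'k::field \<Rightarrow> 'k poly4)"
  by standard (simp_all add: Const_def single_add mult_single)

lemma coefficient_hom_id: "coefficient_hom (\<lambda>c. c)"
  by standard simp_all

section \<open>Extension of places\<close>

text \<open>A ring homomorphism from a subring of one field to another field is given by its graph.\<close>

definition partial_hom :: "('a::field \<times> 'b::field) set \<Rightarrow> bool" where
  "partial_hom G \<longleftrightarrow> (1, 1) \<in> G \<and>
     (\<forall>a b c d. (a, b) \<in> G \<and> (c, d) \<in> G \<longrightarrow> (a - c, b - d) \<in> G \<and> (a * c, b * d) \<in> G) \<and>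
     (\<forall>y. (0, y) \<in> G \<longrightarrow> y = 0)"

context
  fixes G :: "('a::field \<times> 'b::field) set"
  assumes G: "partial_hom G"
begin

lemma partial_hom_1: "(1, 1) \<in> G"
  and partial_hom_diff: "(a, b) \<in> G \<Longrightarrow> (c, d) \<in> G \<Longrightarrow> (a - c, b - d) \<in> G"
  and partial_hom_mult: "(a, b) \<in> G \<Longrightarrow> (c, d) \<in> G \<Longrightarrow> (a * c, b * d) \<in> G"
  and partial_hom_zero: "(0, y) \<in> G \<Longrightarrow> y = 0"
  using G unfolding partial_hom_def by blast+

lemma partial_hom_0: "(0, 0) \<in> G"
  using partial_hom_diff[OF partial_hom_1 partial_hom_1] by simp

lemma partial_hom_uminus: "(a, b) \<in> G \<Longrightarrow> (- a, - b) \<in> G"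
  using partial_hom_diff[OF partial_hom_0, of a b] by simp

lemma partial_hom_add: "(a, b) \<in> G \<Longrightarrow> (c, d) \<in> G \<Longrightarrow> (a + c, b + d) \<in> G"
  using partial_hom_diff[OF _ partial_hom_uminus, of a b c d] by simp

lemma partial_hom_unique: "(a, b) \<in> G \<Longrightarrow> (a, c) \<in> G \<Longrightarrow> b = c"
  using partial_hom_diff[of a b a c] partial_hom_zero[of "b - c"] by simp

lemma partial_hom_power: "(a, b) \<in> G \<Longrightarrow> (a ^ n, b ^ n) \<in> G"
  by (induction n) (auto intro: partial_hom_1 partial_hom_mult)

lemma partial_hom_sum:
  "(\<And>i. i \<in> A \<Longrightarrow> (f i, g i) \<in> G) \<Longrightarrow> ((\<Sum>i\<in>A. f i), (\<Sum>i\<in>A. g i)) \<in> G"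
  by (induction A rule: infinite_finite_induct) (auto intro: partial_hom_0 partial_hom_add)

text \<open>\<open>Q\<close> is the reduction of \<open>P\<close>, that is, the homomorphism with
  graph \<open>G\<close> applied to each coefficient.\<close>

definition poly_pair :: "'a poly \<Rightarrow> 'b poly \<Rightarrow> bool" where
  "poly_pair P Q \<longleftrightarrow> (\<forall>n. (coeff P n, coeff Q n) \<in> G)"

lemma poly_pair_const: "(a, b) \<in> G \<Longrightarrow> poly_pair [:a:] [:b:]"
  by (auto simp: poly_pair_def coeff_pCons partial_hom_0 split: nat.splits)

lemma poly_pair_monom: "(a, b) \<in> G \<Longrightarrow> poly_pair (monom a n) (monom b n)"
  by (auto simp: poly_pair_def partial_hom_0)

lemma poly_pair_diff: "poly_pair P Q \<Longrightarrow> poly_pair R S \<Longrightarrow> poly_pair (P - R) (Q - S)"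
  by (auto simp: poly_pair_def intro: partial_hom_diff)

lemma poly_pair_mult: "poly_pair P Q \<Longrightarrow> poly_pair R S \<Longrightarrow> poly_pair (P * R) (Q * S)"
  by (auto simp: poly_pair_def coeff_mult intro!: partial_hom_sum partial_hom_mult)

definition adjoin :: "'a \<Rightarrow> 'b \<Rightarrow> ('a \<times> 'b) set" where
  "adjoin x y = {(poly P x, poly Q y) | P Q. poly_pair P Q}"

lemma adjoin_superset: "G \<subseteq> adjoin x y"
proof
  fix z assume "z \<in> G"
  then have "poly_pair [:fst z:] [:snd z:]"
    by (auto intro: poly_pair_const)
  then show "z \<in> adjoin x y"
    unfolding adjoin_def by (intro CollectI exI[of _ "[:fst z:]"] exI[of _ "[:snd z:]"]) auto
qed

lemma adjoin_generator: "(x, y) \<in> adjoin x y"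
  unfolding adjoin_def
  using poly_pair_monom[OF partial_hom_1, of 1]
  by (intro CollectI exI[of _ "monom 1 1"]) (auto simp: poly_monom)

text \<open>Differences and products are compatible by construction; the hypothesis is what makes
  the value at \<open>y\<close> depend on the value at \<open>x\<close> and not on the chosen
  polynomial.\<close>

lemma partial_hom_adjoin:
  assumes "\<And>P Q. poly_pair P Q \<Longrightarrow> poly P x = 0 \<Longrightarrow> poly Q y = 0"
  shows "partial_hom (adjoin x y)"
  unfolding partial_hom_def
proof (intro conjI allI impI)
  show "(1, 1) \<in> adjoin x y"
    using adjoin_superset partial_hom_1 by blast
next
  fix a b c d assume "(a, b) \<in> adjoin x y \<and> (c, d) \<in> adjoin x y"
  then obtain P Q R S where *: "a = poly P x" "b = poly Q y" "c = poly R x" "d = poly S y"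
    "poly_pair P Q" "poly_pair R S"
    by (auto simp: adjoin_def)
  show "(a - c, b - d) \<in> adjoin x y"
    unfolding adjoin_def
    by (intro CollectI exI[of _ "P - R"] exI[of _ "Q - S"]) (use * in \<open>auto intro: poly_pair_diff\<close>)
  show "(a * c, b * d) \<in> adjoin x y"
    unfolding adjoin_def
    by (intro CollectI exI[of _ "P * R"] exI[of _ "Q * S"]) (use * in \<open>auto intro: poly_pair_mult\<close>)
next
  fix z assume "(0, z) \<in> adjoin x y"
  then show "z = 0"
    using assms by (auto simp: adjoin_def)
qed

end

lemma poly_eq_sum_atMost:
  fixes p :: "'a::comm_ring_1 poly"
  assumes "degree p \<le> n"
  shows "poly p x = (\<Sum>i\<le>n. coeff p i * x ^ i)"
proof -
  have "(\<Sum>i\<le>degree p. coeff p i * x ^ i) = (\<Sum>i\<le>n. coeff p i * x ^ i)"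
    by (rule sum.mono_neutral_left) (use assms in \<open>auto simp: coeff_eq_0 not_le\<close>)
  then show ?thesis
    by (simp add: poly_altdef)
qed

context
  fixes G :: "('a::field \<times> 'b::alg_closed_field) set"
  assumes G: "partial_hom G"
    and maximal: "\<And>H. partial_hom H \<Longrightarrow> G \<subseteq> H \<Longrightarrow> H = G"
begin

lemma maximal_adjoin:
  assumes "\<And>P Q. poly_pair G P Q \<Longrightarrow> poly P x = 0 \<Longrightarrow> poly Q y = 0"
  shows "(x, y) \<in> G"
proof -
  have "partial_hom (adjoin G x y)"
    by (rule partial_hom_adjoin[OF G]) (rule assms)
  from maximal[OF this adjoin_superset[OF G]] show ?thesis
    using adjoin_generator[OF G, of x y] by simp
qed

text \<open>The domain of a maximal homomorphism is a local ring. A relation P(1/a) = 0 multiplied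
  by a^n is a relation inside the ring, and its image is b^n * Q(1/b) = 0.\<close>

lemma maximal_inverse:
  assumes ab: "(a, b) \<in> G" "b \<noteq> 0"
  shows "(1 / a, 1 / b) \<in> G"
proof (rule maximal_adjoin)
  fix P Q assume PQ: "poly_pair G P Q" and P: "poly P (1 / a) = 0"
  have a: "a \<noteq> 0"
    using ab partial_hom_zero[OF G] by blast
  define n where "n = max (degree P) (degree Q)"
  have reverse: "(\<Sum>i\<le>n. coeff R i * c ^ (n - i)) = c ^ n * poly R (1 / c)"
    if "c \<noteq> 0" "degree R \<le> n" for c :: "'c::field" and R
    unfolding poly_eq_sum_atMost[OF that(2)] sum_distrib_left
    by (rule sum.cong) (use that(1) in \<open>auto simp: power_diff power_divide field_simps\<close>)
  have "((\<Sum>i\<le>n. coeff P i * a ^ (n - i)), (\<Sum>i\<le>n. coeff Q i * b ^ (n - i))) \<in> G"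
    by (intro partial_hom_sum[OF G] partial_hom_mult[OF G] partial_hom_power[OF G] ab)
      (use PQ in \<open>auto simp: poly_pair_def[OF G]\<close>)
  then have "b ^ n * poly Q (1 / b) = 0"
    using partial_hom_zero[OF G] P reverse[of a P] reverse[of b Q] a ab(2)
    by (fastforce simp: n_def)
  then show "poly Q (1 / b) = 0"
    using ab(2) by simp
qed

text \<open>If every relation of \<open>x\<close> reduces to zero, \<open>x\<close> can be sent to
  0. Otherwise take a nonzero reduction of least degree: \<open>no_unit\<close> keeps it from being
  constant, so it has a root \<open>y\<close>, and its leading coefficient is invertible by
  \<open>maximal_inverse\<close>, so division with remainder shows that all other reductions vanish
  at \<open>y\<close> too.\<close>

lemma maximal_total_step:
  assumes no_unit: "\<And>P c. poly_pair G P [:c:] \<Longrightarrow> poly P x = 0 \<Longrightarrow> c = 0"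
  shows "\<exists>y. (x, y) \<in> G"
proof (cases "\<exists>P Q. poly_pair G P Q \<and> poly P x = 0 \<and> Q \<noteq> 0")
  case False
  have "(x, 0) \<in> G"
  proof (rule maximal_adjoin)
    fix P Q assume "poly_pair G P Q" "poly P x = 0"
    with False have "Q = 0" by blast
    then show "poly Q 0 = 0" by simp
  qed
  then show ?thesis ..
next
  case True
  define R where "R n \<longleftrightarrow> (\<exists>P Q. poly_pair G P Q \<and> poly P x = 0 \<and> Q \<noteq> 0 \<and> degree Q = n)" for n
  from True have "\<exists>n. R n" by (auto simp: R_def)
  then have "R (LEAST n. R n)" by (rule LeastI_ex)
  then obtain P0 Q0 where PQ0: "poly_pair G P0 Q0" "poly P0 x = 0" "Q0 \<noteq> 0"
    and deg: "degree Q0 = (LEAST n. R n)"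
    unfolding R_def by blast
  have least: "degree Q0 \<le> degree Q" if "poly_pair G P Q" "poly P x = 0" "Q \<noteq> 0" for P Q
    unfolding deg using that by (intro Least_le) (auto simp: R_def)
  have "degree Q0 > 0"
  proof (rule ccontr)
    assume "\<not> degree Q0 > 0"
    then obtain c where "Q0 = [:c:]"
      by (metis degree_eq_zeroE gr0I)
    with no_unit PQ0 show False by auto
  qed
  then obtain y where y: "poly Q0 y = 0"
    using alg_closed_imp_poly_has_root by blast
  let ?n = "degree Q0"
  have inv: "(1 / coeff P0 ?n, 1 / coeff Q0 ?n) \<in> G"
    by (rule maximal_inverse) (use PQ0 in \<open>auto simp: poly_pair_def[OF G]\<close>)
  have "poly Q y = 0" if "poly_pair G P Q" "poly P x = 0" for P Q
    using that
  proof (induction "degree Q" arbitrary: P Q rule: less_induct)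
    case less
    show ?case
    proof (cases "Q = 0")
      case False
      then have le: "?n \<le> degree Q"
        using least less.prems by blast
      let ?m = "degree Q"
      define a where "a = coeff P ?m * (1 / coeff P0 ?n)"
      define b where "b = coeff Q ?m * (1 / coeff Q0 ?n)"
      have ab: "(a, b) \<in> G"
        unfolding a_def b_def
        by (intro partial_hom_mult[OF G] inv) (use less.prems in \<open>auto simp: poly_pair_def[OF G]\<close>)
      define P' where "P' = P - monom a (?m - ?n) * P0"
      define Q' where "Q' = Q - monom b (?m - ?n) * Q0"
      have pair: "poly_pair G P' Q'"
        unfolding P'_def Q'_def
        by (intro poly_pair_diff[OF G] poly_pair_mult[OF G] poly_pair_monom[OF G] ab less.prems PQ0)
      have P': "poly P' x = 0"
        using less.prems PQ0 by (simp add: P'_def)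
      have Q': "poly Q' y = poly Q y"
        using y by (simp add: Q'_def)
      have "poly Q' y = 0"
      proof (cases "Q' = 0")
        case False
        have "b \<noteq> 0"
          using \<open>Q \<noteq> 0\<close> PQ0(3) by (simp add: b_def)
        then have "degree (monom b (?m - ?n) * Q0) = ?m"
          using PQ0(3) le by (simp add: degree_mult_eq degree_monom_eq monom_eq_0_iff)
        moreover have "coeff (monom b (?m - ?n) * Q0) ?m = coeff Q ?m"
          using le PQ0(3) by (simp add: coeff_monom_mult b_def)
        ultimately have "degree Q' \<le> ?m" "coeff Q' ?m = 0"
          unfolding Q'_def by (auto intro: degree_diff_le)
        then have "degree Q' < ?m"
          using False by (metis le_neq_implies_less leading_coeff_0_iff)
        then show ?thesis
          using less.hyps pair P' by blast
      qed simp
      with Q' show ?thesis by simp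
    qed simp
  qed
  then have "(x, y) \<in> G"
    by (rule maximal_adjoin)
  then show ?thesis ..
qed

text \<open>The elimination step of Chevalley's theorem. Reversing \<open>R\<close> gives a relation
  of \<open>x\<close> whose leading coefficient lies over \<open>d\<close> and is invertible. The
  leading coefficient of \<open>P\<close> lies over zero, because \<open>P\<close> has positive
  degree and reduces to a constant; so subtracting a multiple of the reversed \<open>R\<close>
  lowers the degree of \<open>P\<close> without changing its reduction.\<close>

lemma no_unit_relation:
  assumes "x \<noteq> 0"
    and P: "poly_pair G P [:c:]" "poly P x = 0" "c \<noteq> 0"
    and R: "poly_pair G R [:d:]" "poly R (1 / x) = 0" "d \<noteq> 0"
    and le: "degree R \<le> degree P"
  shows "\<exists>P'. poly_pair G P' [:c:] \<and> poly P' x = 0 \<and> degree P' < degree P"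
proof -
  let ?m = "degree P" and ?n = "degree R"
  have not_const: "degree S > 0" if "poly_pair G S [:e:]" "poly S z = 0" "e \<noteq> 0" for S e z
  proof (rule ccontr)
    assume "\<not> degree S > 0"
    then obtain s where "S = [:s:]" by (metis degree_eq_zeroE gr0I)
    moreover have "(coeff S 0, e) \<in> G"
      using that(1) by (auto simp: poly_pair_def[OF G] dest: spec[of _ 0])
    ultimately show False
      using that(2,3) partial_hom_zero[OF G] by auto
  qed
  have m: "?m > 0" and n: "?n > 0"
    using not_const P R by blast+
  have r0: "(coeff R 0, d) \<in> G"
    using R(1) by (auto simp: poly_pair_def[OF G] dest: spec[of _ 0])
  then have "coeff R 0 \<noteq> 0"
    using R(3) partial_hom_zero[OF G] by metis
  then have refl: "degree (reflect_poly R) = ?n" "coeff (reflect_poly R) ?n = coeff R 0"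
    by (auto simp: degree_reflect_poly_eq coeff_reflect_poly)
  have "poly (reflect_poly R) x = x ^ ?n * poly R (inverse x)"
    using \<open>x \<noteq> 0\<close> by (rule poly_reflect_poly_nz)
  then have root: "poly (reflect_poly R) x = 0"
    using R(2) by (simp add: inverse_eq_divide)
  have rr: "poly_pair G (reflect_poly R) (monom d ?n)"
    unfolding poly_pair_def[OF G]
  proof
    fix i
    show "(coeff (reflect_poly R) i, coeff (monom d ?n) i) \<in> G"
      using R(1)[unfolded poly_pair_def[OF G], rule_format, of "?n - i"] partial_hom_0[OF G] r0
      by (cases "i = ?n") (auto simp: coeff_reflect_poly coeff_pCons split: nat.splits)
  qed
  define a where "a = coeff P ?m * (1 / coeff R 0)"
  have "(coeff P ?m, 0) \<in> G"
    using P(1)[unfolded poly_pair_def[OF G], rule_format, of ?m] m by (auto simp: coeff_pCons split: nat.splits)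
  from partial_hom_mult[OF G this maximal_inverse[OF r0 R(3)]]
  have a: "(a, 0) \<in> G" by (simp add: a_def)
  define P' where "P' = P - monom a (?m - ?n) * reflect_poly R"
  have "poly_pair G P' ([:c:] - monom 0 (?m - ?n) * monom d ?n)"
    unfolding P'_def
    by (intro poly_pair_diff[OF G] poly_pair_mult[OF G] poly_pair_monom[OF G] a P rr)
  then have pair: "poly_pair G P' [:c:]" by simp
  have "degree (monom a (?m - ?n) * reflect_poly R) \<le> ?m"
    using degree_mult_le[of "monom a (?m - ?n)" "reflect_poly R"] degree_monom_le[of a "?m - ?n"] refl le
    by linarith
  then have "degree P' \<le> ?m"
    unfolding P'_def by (intro degree_diff_le) auto
  moreover have "coeff P' ?m = 0"
    using le refl(2) \<open>coeff R 0 \<noteq> 0\<close> by (simp add: P'_def coeff_monom_mult a_def)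
  ultimately have "degree P' < ?m"
    using m by (metis degree_0 le_neq_implies_less leading_coeff_0_iff)
  moreover have "poly P' x = 0"
    using P root by (simp add: P'_def)
  ultimately show ?thesis
    using pair by blast
qed

lemma maximal_total: "(\<exists>y. (x, y) \<in> G) \<or> (x \<noteq> 0 \<and> (1 / x, 0) \<in> G)"
proof (cases "x = 0")
  case True
  then show ?thesis using partial_hom_0[OF G] by blast
next
  case x: False
  \<comment> \<open>Infinite descent on the sum of the degrees of the two relations.\<close>
  have no_both: False
    if "poly_pair G P [:c:]" "poly P x = 0" "c \<noteq> 0"
       "poly_pair G R [:d:]" "poly R (1 / x) = 0" "d \<noteq> 0" for P R c d
    using that
  proof (induction "degree P + degree R" arbitrary: P R rule: less_induct)
    case less
    show ?case
    proof (cases "degree R \<le> degree P")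
      case True
      from no_unit_relation[OF x less.prems True] obtain P'
        where P': "poly_pair G P' [:c:]" "poly P' x = 0" "degree P' < degree P" by blast
      show ?thesis
        by (rule less.hyps[OF _ P'(1,2) less.prems(3-6)]) (use P'(3) in simp)
    next
      case False
      have "\<exists>R'. poly_pair G R' [:d:] \<and> poly R' (1 / x) = 0 \<and> degree R' < degree R"
        by (rule no_unit_relation[where R = P]) (use x less.prems False in auto)
      then obtain R'
        where R': "poly_pair G R' [:d:]" "poly R' (1 / x) = 0" "degree R' < degree R" by blast
      show ?thesis
        by (rule less.hyps[OF _ less.prems(1-3) R'(1,2) less.prems(6)]) (use R'(3) in simp)
    qed
  qed
  consider y where "(x, y) \<in> G" | y where "(1 / x, y) \<in> G"
    using maximal_total_step[of x] maximal_total_step[of "1 / x"] no_both by metis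
  then show ?thesis
  proof cases
    case (2 y)
    then show ?thesis
      using maximal_inverse[OF 2] x by (cases "y = 0") auto
  qed auto
qed

end

lemma place_extension:
  fixes G0 :: "('a::field \<times> 'b::alg_closed_field) set"
  assumes G0: "partial_hom G0"
  obtains G where "partial_hom G" "G0 \<subseteq> G" "\<And>x. (\<exists>y. (x, y) \<in> G) \<or> (x \<noteq> 0 \<and> (1 / x, 0) \<in> G)"
proof -
  let ?A = "{G. partial_hom G \<and> G0 \<subseteq> G}"
  have "\<exists>M\<in>?A. \<forall>X\<in>?A. M \<subseteq> X \<longrightarrow> X = M"
  proof (rule subset_Zorn_nonempty)
    show "?A \<noteq> {}" using G0 by auto
  next
    fix C assume C: "C \<noteq> {}" "subset.chain ?A C"
    have two: "\<exists>G\<in>C. p \<in> G \<and> q \<in> G" if "p \<in> \<Union>C" "q \<in> \<Union>C" for p q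
    proof -
      from that obtain G H where GH: "G \<in> C" "H \<in> C" "p \<in> G" "q \<in> H" by blast
      then have "G \<subseteq> H \<or> H \<subseteq> G"
        using C(2) unfolding subset.chain_def by blast
      with GH show ?thesis by blast
    qed
    have C': "partial_hom G" "G0 \<subseteq> G" if "G \<in> C" for G
      using that C(2) unfolding subset.chain_def by blast+
    have "partial_hom (\<Union>C)"
      unfolding partial_hom_def
    proof (intro conjI allI impI)
      show "(1, 1) \<in> \<Union>C"
        using C(1) C' partial_hom_1 by blast
    next
      fix a b c d assume "(a, b) \<in> \<Union>C \<and> (c, d) \<in> \<Union>C"
      then obtain G where "G \<in> C" and ab: "(a, b) \<in> G" and cd: "(c, d) \<in> G"
        using two[of "(a, b)" "(c, d)"] by blast
      with C' have G: "partial_hom G" by blast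
      show "(a - c, b - d) \<in> \<Union>C" "(a * c, b * d) \<in> \<Union>C"
        using \<open>G \<in> C\<close> partial_hom_diff[OF G ab cd] partial_hom_mult[OF G ab cd] by auto
    next
      fix y assume "(0, y) \<in> \<Union>C"
      then show "y = 0" using C' partial_hom_zero by blast
    qed
    then show "\<Union>C \<in> ?A"
      using C(1) C' by blast
  qed
  then obtain M where M: "partial_hom M" "G0 \<subseteq> M" and max: "\<And>X. partial_hom X \<Longrightarrow> M \<subseteq> X \<Longrightarrow> X = M"
    by auto
  from that[OF M maximal_total[OF M(1) max]] show thesis by blast
qed

locale place =
  fixes B :: "'a::field set" and g :: "'a \<Rightarrow> 'b::field"
  assumes one: "1 \<in> B" "g 1 = 1"
    and diff: "\<And>x y. x \<in> B \<Longrightarrow> y \<in> B \<Longrightarrow> x - y \<in> B" "\<And>x y. x \<in> B \<Longrightarrow> y \<in> B \<Longrightarrow> g (x - y) = g x - g y"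
    and mult: "\<And>x y. x \<in> B \<Longrightarrow> y \<in> B \<Longrightarrow> x * y \<in> B" "\<And>x y. x \<in> B \<Longrightarrow> y \<in> B \<Longrightarrow> g (x * y) = g x * g y"
    and total: "\<And>x. x \<notin> B \<Longrightarrow> 1 / x \<in> B" "\<And>x. x \<notin> B \<Longrightarrow> g (1 / x) = 0"
begin

lemma zero: "0 \<in> B" "g 0 = 0"
  using diff[OF one(1) one(1)] by simp_all

lemma uminus: assumes "x \<in> B" shows "- x \<in> B" "g (- x) = - g x"
  using diff[OF zero(1) assms] zero(2) by simp_all

lemma add:
  assumes "x \<in> B" "y \<in> B" shows "x + y \<in> B" "g (x + y) = g x + g y"
  using diff[OF assms(1) uminus(1)[OF assms(2)]] uminus(2)[OF assms(2)] by simp_all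

lemma power: assumes "x \<in> B" shows "x ^ n \<in> B" "g (x ^ n) = g x ^ n"
  by (induction n) (use assms one mult in simp_all)

lemma sum:
  "(\<And>i. i \<in> A \<Longrightarrow> f i \<in> B) \<Longrightarrow> (\<Sum>i\<in>A. f i) \<in> B"
  "(\<And>i. i \<in> A \<Longrightarrow> f i \<in> B) \<Longrightarrow> g (\<Sum>i\<in>A. f i) = (\<Sum>i\<in>A. g (f i))"
  by (induction A rule: infinite_finite_induct) (use zero add in simp_all)

text \<open>Divisibility in a valuation ring is total, so some member divides all others. Dividing a
  nonzero vector by such a component makes it integral with a component 1, so its reduction is a
  nonzero vector.\<close>

lemma dominant:
  assumes "finite A" "A \<subseteq> - {0}" "A \<noteq> {}"
  shows "\<exists>s\<in>A. \<forall>r\<in>A. r / s \<in> B"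
  using assms(1,3,2)
proof (induction rule: finite_ne_induct)
  case (singleton x)
  then show ?case using one by simp
next
  case (insert x A)
  then obtain s where s: "s \<in> A" "\<forall>r\<in>A. r / s \<in> B" by auto
  have x: "x \<noteq> 0" "s \<noteq> 0" using insert.prems s by auto
  show ?case
  proof (cases "x / s \<in> B")
    case True
    then show ?thesis using s by auto
  next
    case False
    then have "s / x \<in> B" using total(1)[OF False] by simp
    moreover have "r / x \<in> B" if "r \<in> A" for r
      using mult(1)[of "r / s" "s / x"] s(2) that \<open>s / x \<in> B\<close> x by simp
    ultimately show ?thesis using x one by auto
  qed
qed

lemma dominant_component:
  fixes v :: "'a ^ 'i"
  assumes "v \<noteq> 0"
  obtains i where "v $ i \<noteq> 0" "\<And>j. v $ j / v $ i \<in> B"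
proof -
  let ?A = "range (($) v) - {0}"
  have "?A \<noteq> {}"
    using assms by (auto simp: vec_eq_iff)
  then obtain s where s: "s \<in> ?A" "\<forall>r\<in>?A. r / s \<in> B"
    using dominant[of ?A] by auto
  then obtain i where i: "s = v $ i" by auto
  have "v $ j / v $ i \<in> B" for j
    using s i zero by (cases "v $ j = 0") auto
  with s i that show thesis by auto
qed

end

text \<open>Evaluation at 1 makes sense on k[t] but not on k[[t]]; a place of k((t)) that extends it
  is the replacement.\<close>

lemma fls_place_exists:
  obtains B :: "'k::alg_closed_field fls set" and g where "place B g"
    "\<And>c. fls_const c \<in> B" "\<And>c. g (fls_const c) = c" "fls_X \<in> B" "g fls_X = 1"
proof -
  define G0 :: "('k fls \<times> 'k) set" where "G0 = range (\<lambda>p. (fps_to_fls (fps_of_poly p), poly p 1))"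
  have G0I: "(fps_to_fls (fps_of_poly p), poly p 1) \<in> G0" for p
    by (auto simp: G0_def)
  have "partial_hom G0"
    unfolding partial_hom_def
  proof (intro conjI allI impI)
    show "(1, 1) \<in> G0" using G0I[of 1] by simp
  next
    fix a b c d assume "(a, b) \<in> G0 \<and> (c, d) \<in> G0"
    then obtain p q where "a = fps_to_fls (fps_of_poly p)" "b = poly p 1"
      "c = fps_to_fls (fps_of_poly q)" "d = poly q 1"
      by (auto simp: G0_def)
    then show "(a - c, b - d) \<in> G0" "(a * c, b * d) \<in> G0"
      using G0I[of "p - q"] G0I[of "p * q"]
      by (simp_all add: fps_of_poly_diff fps_of_poly_mult fls_times_fps_to_fls)
  next
    fix y assume "(0, y) \<in> G0"
    then show "y = 0" by (auto simp: G0_def)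
  qed
  then obtain G where G: "partial_hom G" "G0 \<subseteq> G"
    and total: "\<And>x. (\<exists>y. (x, y) \<in> G) \<or> (x \<noteq> 0 \<and> (1 / x, 0) \<in> G)"
    using place_extension by blast
  define g where "g x = (THE y. (x, y) \<in> G)" for x
  have g: "g x = y" if "(x, y) \<in> G" for x y
    unfolding g_def using that partial_hom_unique[OF G(1)] by blast
  define B where "B = {x. \<exists>y. (x, y) \<in> G}"
  have B: "(x, g x) \<in> G" if "x \<in> B" for x
    using that g by (auto simp: B_def)
  have BI: "x \<in> B" "g x = y" if "(x, y) \<in> G" for x y
    using that g by (auto simp: B_def)
  show thesis
  proof (rule that)
    show "place B g"
    proof
      show "1 \<in> B" "g 1 = 1" using BI[OF partial_hom_1[OF G(1)]] by auto
      fix x y assume "x \<in> B" "y \<in> B"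
      then have xy: "(x, g x) \<in> G" "(y, g y) \<in> G" using B by auto
      show "x - y \<in> B" "g (x - y) = g x - g y" "x * y \<in> B" "g (x * y) = g x * g y"
        using BI[OF partial_hom_diff[OF G(1) xy]] BI[OF partial_hom_mult[OF G(1) xy]] by auto
    next
      fix x assume "x \<notin> B"
      then have "(1 / x, 0) \<in> G" using total[of x] by (auto simp: B_def)
      then show "1 / x \<in> B" "g (1 / x) = 0" using BI by auto
    qed
    have "(fls_const c, c) \<in> G" for c
    proof -
      have "(fps_to_fls (fps_of_poly [:c:]), poly [:c:] 1) \<in> G"
        using G0I[of "[:c:]"] G(2) by blast
      then show ?thesis by (simp add: fps_of_poly_const)
    qed
    then show "fls_const c \<in> B" "g (fls_const c) = c" for c
      using BI by auto
    have "(fps_to_fls (fps_of_poly [:0, 1:]), poly [:0, 1:] 1) \<in> G"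
      using G0I[of "[:0, 1:]"] G(2) by blast
    then have "(fls_X, 1) \<in> G"
      by (simp add: fps_of_poly_pCons)
    then show "fls_X \<in> B" "g fls_X = 1"
      using BI by auto
  qed
qed

section \<open>Fixed points of contractions of power series, and congruences\<close>

lemma fps_X_power_dvd_iff:
  fixes f :: "'a::comm_ring_1 fps"
  shows "fps_X ^ n dvd f \<longleftrightarrow> (\<forall>j<n. fps_nth f j = 0)"
proof
  assume "fps_X ^ n dvd f"
  then show "\<forall>j<n. fps_nth f j = 0"
    by (auto simp: fps_X_power_mult_nth)
next
  assume "\<forall>j<n. fps_nth f j = 0"
  then have "f = fps_X ^ n * fps_shift n f"
    by (intro fps_ext) (auto simp: fps_X_power_mult_nth)
  then show "fps_X ^ n dvd f" by (metis dvd_triv_left)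
qed

text \<open>Banach's fixed point theorem for the topology of powers of \<open>fps_X\<close>: each
  application of the map gains one order of agreement. It takes the place of Hensel's lemma.\<close>

lemma fps_contraction_fixpoint:
  fixes \<Phi> :: "('i \<Rightarrow> 'a::comm_ring_1 fps) \<Rightarrow> 'i \<Rightarrow> 'a fps"
  assumes contr: "\<And>n X Y i. (\<And>j. fps_X ^ n dvd X j - Y j) \<Longrightarrow> fps_X ^ Suc n dvd \<Phi> X i - \<Phi> Y i"
  obtains X where "\<Phi> X = X"
proof -
  define Z where "Z n = (\<Phi> ^^ n) (\<lambda>_. 0)" for n
  have Z: "fps_X ^ n dvd Z (n + m) i - Z n i" for n m i
  proof (induction n arbitrary: i)
    case (Suc n)
    then show ?case
      using contr[of n "Z (n + m)" "Z n"] by (simp add: Z_def)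
  qed simp
  \<comment> \<open>From iterate n + 1 onwards the coefficient at n no longer changes, so it is read
    off there.\<close>
  define X where "X i = Abs_fps (\<lambda>n. fps_nth (Z (Suc n) i) n)" for i
  have XZ: "fps_X ^ n dvd X i - Z n i" for n i
    unfolding fps_X_power_dvd_iff
  proof (intro allI impI)
    fix j assume "j < n"
    then have "fps_X ^ Suc j dvd Z n i - Z (Suc j) i"
      using Z[of "Suc j" "n - Suc j" i] by simp
    then show "fps_nth (X i - Z n i) j = 0"
      unfolding fps_X_power_dvd_iff by (auto simp: X_def)
  qed
  have "\<Phi> X i = X i" for i
  proof -
    have "fps_X ^ Suc n dvd \<Phi> X i - X i" for n
    proof -
      have "fps_X ^ Suc n dvd \<Phi> X i - Z (Suc n) i"
        using contr[of n X "Z n"] XZ by (simp add: Z_def)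
      from dvd_diff[OF this XZ[of "Suc n" i]] show ?thesis by simp
    qed
    then have "fps_nth (\<Phi> X i - X i) n = 0" for n
      unfolding fps_X_power_dvd_iff by blast
    then show ?thesis
      by (simp add: fps_eq_iff)
  qed
  with that show thesis by blast
qed

lemma dvd_diff_mult:
  fixes c :: "'a::comm_ring_1"
  assumes "c dvd a - a'" "c dvd b - b'"
  shows "c dvd a * b - a' * b'"
proof -
  have "a * b - a' * b' = (a - a') * b + a' * (b - b')"
    by (simp add: algebra_simps)
  then show ?thesis using assms by auto
qed

lemma dvd_diff_add:
  fixes c :: "'a::comm_ring_1"
  assumes "c dvd a - a'" "c dvd b - b'"
  shows "c dvd (a + b) - (a' + b')"
  using dvd_add[OF assms] by (simp add: algebra_simps)

lemma dvd_diff_power: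
  fixes c :: "'a::comm_ring_1"
  shows "c dvd a - a' \<Longrightarrow> c dvd a ^ n - a' ^ n"
  by (induction n) (auto intro: dvd_diff_mult)

lemma dvd_diff_sum:
  fixes c :: "'a::comm_ring_1"
  shows "(\<And>i. i \<in> A \<Longrightarrow> c dvd f i - f' i) \<Longrightarrow> c dvd (\<Sum>i\<in>A. f i) - (\<Sum>i\<in>A. f' i)"
  by (induction A rule: infinite_finite_induct) (auto intro: dvd_diff_add)

lemma dvd_diff_refl: "c dvd a - (a::'a::comm_ring_1)"
  by simp

lemmas dvd_diff_intros = dvd_diff_mult dvd_diff_add dvd_diff_power dvd_diff_sum dvd_diff_refl

section \<open>Cubic forms in characteristic two\<close>

text \<open>
  A quaternary cubic form is given by the coefficients of \<open>x\<^sub>i\<^sup>2 x\<^sub>j\<close> (the matrix \<open>a\<close>) and those of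
  the four squarefree monomials (\<open>q $ i\<close> belongs to the monomial without \<open>x\<^sub>i\<close>).
\<close>

definition cub :: "'a::comm_ring_1 ^ 4 ^ 4 \<Rightarrow> 'a ^ 4 \<Rightarrow> 'a ^ 4 \<Rightarrow> 'a" where
  "cub a q x = (\<Sum>i\<in>UNIV. \<Sum>j\<in>UNIV. a $ i $ j * (x $ i)\<^sup>2 * x $ j)
     + (q $ 1 * (x $ 2 * x $ 3 * x $ 4) + q $ 2 * (x $ 1 * x $ 3 * x $ 4)
      + q $ 3 * (x $ 1 * x $ 2 * x $ 4) + q $ 4 * (x $ 1 * x $ 2 * x $ 3))"

text \<open>The derivative of the cubic form at \<open>x\<close> in the direction \<open>y\<close>,
  with the terms that carry a factor 2 left out.\<close>

definition pol :: "'a::comm_ring_1 ^ 4 ^ 4 \<Rightarrow> 'a ^ 4 \<Rightarrow> 'a ^ 4 \<Rightarrow> 'a ^ 4 \<Rightarrow> 'a" where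
  "pol a q x y = (\<Sum>i\<in>UNIV. \<Sum>j\<in>UNIV. a $ i $ j * (x $ i)\<^sup>2 * y $ j)
     + (q $ 1 * (y $ 2 * x $ 3 * x $ 4 + x $ 2 * y $ 3 * x $ 4 + x $ 2 * x $ 3 * y $ 4)
      + q $ 2 * (y $ 1 * x $ 3 * x $ 4 + x $ 1 * y $ 3 * x $ 4 + x $ 1 * x $ 3 * y $ 4)
      + q $ 3 * (y $ 1 * x $ 2 * x $ 4 + x $ 1 * y $ 2 * x $ 4 + x $ 1 * x $ 2 * y $ 4)
      + q $ 4 * (y $ 1 * x $ 2 * x $ 3 + x $ 1 * y $ 2 * x $ 3 + x $ 1 * x $ 2 * y $ 3))"

text \<open>Permanents replace the 3 by 3 minors, with which they agree when 2 = 0, so that no signs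
  have to be tracked.\<close>

definition perm3 :: "4 \<Rightarrow> 4 \<Rightarrow> 4 \<Rightarrow> 'a::comm_ring_1 ^ 4 \<Rightarrow> 'a ^ 4 \<Rightarrow> 'a ^ 4 \<Rightarrow> 'a" where
  "perm3 i j k x y z = x $ i * (y $ j * z $ k + y $ k * z $ j)
     + x $ j * (y $ i * z $ k + y $ k * z $ i) + x $ k * (y $ i * z $ j + y $ j * z $ i)"

definition tri :: "'a::comm_ring_1 ^ 4 \<Rightarrow> 'a ^ 4 \<Rightarrow> 'a ^ 4 \<Rightarrow> 'a ^ 4 \<Rightarrow> 'a" where
  "tri q x y z = q $ 1 * perm3 2 3 4 x y z + q $ 2 * perm3 1 3 4 x y z
     + q $ 3 * perm3 1 2 4 x y z + q $ 4 * perm3 1 2 3 x y z"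

lemma cub_scale: "cub a q (c *s x) = c ^ 3 * cub a q x"
  by (simp add: cub_def sum_distrib_left distrib_left power_mult_distrib power2_eq_square power3_eq_cube ac_simps)

lemma pol_scale_right: "pol a q x (c *s y) = c * pol a q x y"
  by (simp add: pol_def sum_distrib_left distrib_left ac_simps)

lemma pol_scale_left: "pol a q (c *s x) y = c\<^sup>2 * pol a q x y"
  by (simp add: pol_def sum_distrib_left distrib_left power2_eq_square ac_simps)

lemma pol_add_right: "pol a q x (y + z) = pol a q x y + pol a q x z"
  by (simp add: pol_def sum.distrib algebra_simps)

lemma tri_swap: "tri q x y z = tri q y x z" "tri q x y z = tri q x z y"
  by (simp_all add: tri_def perm3_def algebra_simps)

lemma tri_add: "tri q (x + y) z w = tri q x z w + tri q y z w"
  by (simp add: tri_def perm3_def algebra_simps)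

lemma tri_scale: "tri q (c *s x) y z = c * tri q x y z"
  by (simp add: tri_def perm3_def algebra_simps)

lemma tri_add2: "tri q z (x + y) w = tri q z x w + tri q z y w"
  by (simp add: tri_def perm3_def algebra_simps)

lemma tri_scale2: "tri q y (c *s x) z = c * tri q y x z"
  by (simp add: tri_def perm3_def algebra_simps)

lemma tri_add3: "tri q z w (x + y) = tri q z w x + tri q z w y"
  by (simp add: tri_def perm3_def algebra_simps)

lemma tri_scale3: "tri q y z (c *s x) = c * tri q y z x"
  by (simp add: tri_def perm3_def algebra_simps)

lemma tri_axis: "tri q (axis 2 1) (axis 3 1) (axis 4 1) = q $ 1" "tri q (axis 1 1) (axis 3 1) (axis 4 1) = q $ 2"
  "tri q (axis 1 1) (axis 2 1) (axis 4 1) = q $ 3" "tri q (axis 1 1) (axis 2 1) (axis 3 1) = q $ 4"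
  by (simp_all add: tri_def perm3_def axis_def)

lemma tri_eq_0D:
  assumes "\<And>x y z. tri q x y z = 0"
  shows "q = 0"
  using assms tri_axis[of q] by (simp add: vec_eq_iff forall_4)

context
  assumes two: "(2::'a::comm_ring_1) = 0"
begin

lemma two_add_self: "(x::'a) + x = 0"
  using two by (metis mult_2 mult_zero_left)

lemma two_power2_add: "((x::'a) + y)\<^sup>2 = x\<^sup>2 + y\<^sup>2"
  using two by (simp add: power2_sum)

lemma cub_add: "cub a q (x + y) = cub a q x + cub a q y + pol a q x y + pol a q (y::'a^4) x"
  by (simp add: cub_def pol_def two_power2_add sum.distrib algebra_simps)

lemma pol_add_left: "pol a q (x + y) (z::'a^4) = pol a q x z + pol a q y z + tri q x y z"
  by (simp add: pol_def tri_def perm3_def two_power2_add sum.distrib algebra_simps)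

lemma pol_self: "pol a q x x = cub a q (x::'a^4)"
proof -
  have three: "y + y + y = (y::'a)" for y by (simp add: two_add_self)
  show ?thesis
    unfolding cub_def pol_def by (simp add: three two ac_simps)
qed

lemma tri_self: "tri q x x (z::'a^4) = 0"
proof -
  have "perm3 i j k x x z = 0" for i j k
  proof -
    have "perm3 i j k x x z = 2 * (x $ i * x $ j * z $ k + x $ i * x $ k * z $ j + x $ j * x $ k * z $ i)"
      by (simp add: perm3_def algebra_simps)
    then show ?thesis by (simp add: two)
  qed
  then show ?thesis by (simp add: tri_def)
qed

lemma tri_self2: "tri q z x (x::'a^4) = 0" "tri q x z x = 0"
  using tri_self[of q x z] tri_swap by metis+

text \<open>A determinant with \<open>q\<close> in two columns; so \<open>q\<close> lies in the
  radical of the trilinear form.\<close>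

lemma tri_coefficients: "tri q q x (y::'a^4) = 0"
proof -
  have "tri q q x y = 2 * (q $ 1 * q $ 2 * (x $ 3 * y $ 4 + x $ 4 * y $ 3) + q $ 1 * q $ 3 * (x $ 2 * y $ 4 + x $ 4 * y $ 2)
    + q $ 1 * q $ 4 * (x $ 2 * y $ 3 + x $ 3 * y $ 2) + q $ 2 * q $ 3 * (x $ 1 * y $ 4 + x $ 4 * y $ 1)
    + q $ 2 * q $ 4 * (x $ 1 * y $ 3 + x $ 3 * y $ 1) + q $ 3 * q $ 4 * (x $ 1 * y $ 2 + x $ 2 * y $ 1))"
    by (simp add: tri_def perm3_def algebra_simps)
  then show ?thesis by (simp add: two)
qed

end

subsection \<open>The coefficients of a homogeneous cubic polynomial\<close>

definition square_monomial :: "4 \<Rightarrow> 4 \<Rightarrow> 4 \<Rightarrow>\<^sub>0 nat" where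
  "square_monomial i j = Poly_Mapping.single i 2 + Poly_Mapping.single j 1"

definition squarefree_monomial :: "4 \<Rightarrow> 4 \<Rightarrow>\<^sub>0 nat" where
  "squarefree_monomial i = (\<Sum>j\<in>UNIV - {i}. Poly_Mapping.single j 1)"

lemma lookup_square_monomial:
  "Poly_Mapping.lookup (square_monomial i j) k = (if k = i then 2 else 0) + (if k = j then 1 else 0)"
  by (auto simp: square_monomial_def lookup_add lookup_single when_def)

lemma lookup_squarefree_monomial:
  "Poly_Mapping.lookup (squarefree_monomial i) k = (if k = i then 0 else 1)"
  by (simp add: squarefree_monomial_def lookup_sum lookup_single when_def)

lemma degree_3_monomial:
  assumes "mdegree m = 3"
  shows "(\<exists>i j. m = square_monomial i j) \<or> (\<exists>i. m = squarefree_monomial i)"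
proof (cases "\<exists>i. Poly_Mapping.lookup m i \<ge> 2")
  case True
  then obtain i where i: "Poly_Mapping.lookup m i \<ge> 2" ..
  have split: "Poly_Mapping.lookup m i + (\<Sum>k\<in>UNIV - {i}. Poly_Mapping.lookup m k) = 3"
    using assms by (simp add: mdegree_def sum.remove[of UNIV i])
  consider "Poly_Mapping.lookup m i = 3" "(\<Sum>k\<in>UNIV - {i}. Poly_Mapping.lookup m k) = 0"
    | "Poly_Mapping.lookup m i = 2" "(\<Sum>k\<in>UNIV - {i}. Poly_Mapping.lookup m k) = 1"
    using i split by linarith
  then show ?thesis
  proof cases
    case 1
    then have "m = square_monomial i i"
      by (intro poly_mapping_eqI) (auto simp: lookup_square_monomial)
    then show ?thesis by blast
  next
    case 2
    then obtain j where j: "j \<in> UNIV - {i}" "Poly_Mapping.lookup m j = 1"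
      "\<forall>k\<in>UNIV - {i}. j \<noteq> k \<longrightarrow> Poly_Mapping.lookup m k = 0"
      unfolding sum_eq_1_iff[OF finite] by (elim bexE conjE)
    have "m = square_monomial i j"
    proof (rule poly_mapping_eqI)
      fix k
      consider "k = i" | "k = j" | "k \<in> UNIV - {i}" "j \<noteq> k" by blast
      then show "Poly_Mapping.lookup m k = Poly_Mapping.lookup (square_monomial i j) k"
      proof cases
        case 3
        with j(3) have "Poly_Mapping.lookup m k = 0" by blast
        with 3 show ?thesis by (simp add: lookup_square_monomial)
      qed (use 2(1) j(1,2) in \<open>simp_all add: lookup_square_monomial\<close>)
    qed
    then show ?thesis by blast
  qed
next
  case False
  then have le: "Poly_Mapping.lookup m k \<le> 1" for k
    by (metis One_nat_def Suc_1 not_less_eq_eq)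
  \<comment> \<open>Four variables and degree three: exactly one variable is missing.\<close>
  have "(\<Sum>k\<in>UNIV. 1 - Poly_Mapping.lookup m k) + (\<Sum>k\<in>UNIV. Poly_Mapping.lookup m k) = (\<Sum>k\<in>(UNIV::4 set). 1)"
    unfolding sum.distrib[symmetric] using le by (intro sum.cong) auto
  then have "(\<Sum>k\<in>UNIV. 1 - Poly_Mapping.lookup m k) = 1"
    using assms by (simp add: mdegree_def)
  then obtain i where i: "1 - Poly_Mapping.lookup m i = 1" "\<forall>k. k \<noteq> i \<longrightarrow> 1 - Poly_Mapping.lookup m k = 0"
    using sum_eq_1_iff[of UNIV "\<lambda>k. 1 - Poly_Mapping.lookup m k"] by auto
  have "m = squarefree_monomial i"
  proof (rule poly_mapping_eqI)
    fix k
    show "Poly_Mapping.lookup m k = Poly_Mapping.lookup (squarefree_monomial i) k"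
      using i le[of k] by (cases "k = i") (auto simp: lookup_squarefree_monomial intro: le_antisym)
  qed
  then show ?thesis by blast
qed

lemma square_monomial_inject: "square_monomial i j = square_monomial k l \<longleftrightarrow> i = k \<and> j = l"
proof
  assume eq: "square_monomial i j = square_monomial k l"
  have "\<And>r. (if r = i then 2 else 0) + (if r = j then 1 else 0) = (if r = k then 2 else 0) + (if r = l then 1 else (0::nat))"
    using eq lookup_square_monomial by metis
  from this[of i] this[of j] this[of k] this[of l] show "i = k \<and> j = l"
    by (auto split: if_splits)
qed simp

lemma squarefree_monomial_inject: "squarefree_monomial i = squarefree_monomial k \<longleftrightarrow> i = k"
  using lookup_squarefree_monomial by (metis zero_neq_one)

lemma square_monomial_neq_squarefree: "square_monomial i j \<noteq> squarefree_monomial k"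
proof
  assume "square_monomial i j = squarefree_monomial k"
  then show False
    using lookup_square_monomial[of i j i] lookup_squarefree_monomial[of k i] by (auto split: if_splits)
qed

definition square_coeffs :: "'k::zero poly4 \<Rightarrow> 'k ^ 4 ^ 4" where
  "square_coeffs F = (\<chi> i j. Poly_Mapping.lookup F (square_monomial i j))"

definition squarefree_coeffs :: "'k::zero poly4 \<Rightarrow> 'k ^ 4" where
  "squarefree_coeffs F = (\<chi> i. Poly_Mapping.lookup F (squarefree_monomial i))"

lemma homogeneous_3_sum_singles:
  fixes F :: "'k::comm_monoid_add poly4"
  assumes "homogeneous 3 F"
  shows "F = (\<Sum>i\<in>UNIV. \<Sum>j\<in>UNIV. Poly_Mapping.single (square_monomial i j) (square_coeffs F $ i $ j))
    + (\<Sum>i\<in>UNIV. Poly_Mapping.single (squarefree_monomial i) (squarefree_coeffs F $ i))"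
proof -
  let ?s = "\<lambda>m. Poly_Mapping.single m (Poly_Mapping.lookup F m)"
  let ?A = "range (\<lambda>(i, j). square_monomial i j)" and ?B = "range squarefree_monomial"
  have "Poly_Mapping.keys F \<subseteq> ?A \<union> ?B"
    using assms degree_3_monomial by (fastforce simp: homogeneous_def)
  then have "(\<Sum>m\<in>Poly_Mapping.keys F. ?s m) = (\<Sum>m\<in>?A \<union> ?B. ?s m)"
    by (intro sum.mono_neutral_left) (auto simp: in_keys_iff)
  also have "\<dots> = (\<Sum>m\<in>?A. ?s m) + (\<Sum>m\<in>?B. ?s m)"
    by (rule sum.union_disjoint) (use square_monomial_neq_squarefree in auto)
  also have "(\<Sum>m\<in>?A. ?s m) = (\<Sum>(i, j)\<in>UNIV. ?s (square_monomial i j))"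
    by (subst sum.reindex) (auto simp: inj_on_def square_monomial_inject case_prod_unfold)
  also have "\<dots> = (\<Sum>i\<in>UNIV. \<Sum>j\<in>UNIV. ?s (square_monomial i j))"
    by (simp add: sum.cartesian_product)
  also have "(\<Sum>m\<in>?B. ?s m) = (\<Sum>i\<in>UNIV. ?s (squarefree_monomial i))"
    by (subst sum.reindex) (auto simp: inj_on_def squarefree_monomial_inject)
  finally show ?thesis
    using poly_mapping_sum_single[of F] by (simp add: square_coeffs_def squarefree_coeffs_def)
qed

lemma prod_4: "(\<Prod>i\<in>UNIV. f i) = f 1 * f 2 * f 3 * f (4::4)"
  unfolding UNIV_4 by (simp add: ac_simps)

lemma prod_square_monomial:
  "(\<Prod>k\<in>UNIV. x k ^ Poly_Mapping.lookup (square_monomial i j) k) = x i ^ 2 * (x j :: 'a::comm_semiring_1)"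
proof -
  have "(\<Prod>k\<in>UNIV. x k ^ Poly_Mapping.lookup (square_monomial i j) k)
      = (\<Prod>k\<in>UNIV. (if k = i then x i ^ 2 else 1) * (if k = j then x j else 1))"
    by (rule prod.cong) (auto simp: lookup_square_monomial power2_eq_square power3_eq_cube ac_simps)
  then show ?thesis by (simp add: prod.distrib)
qed

lemma (in coefficient_hom) subst4_cubic:
  fixes x :: "4 \<Rightarrow> 'r"
  assumes "homogeneous 3 F"
  shows "subst4 h x F = (\<Sum>i\<in>UNIV. \<Sum>j\<in>UNIV. h (square_coeffs F $ i $ j) * (x i)\<^sup>2 * x j)
     + (h (squarefree_coeffs F $ 1) * (x 2 * x 3 * x 4) + h (squarefree_coeffs F $ 2) * (x 1 * x 3 * x 4)
      + h (squarefree_coeffs F $ 3) * (x 1 * x 2 * x 4) + h (squarefree_coeffs F $ 4) * (x 1 * x 2 * x 3))"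
proof -
  have "(\<Sum>i\<in>UNIV. subst4 h x (Poly_Mapping.single (squarefree_monomial i) (squarefree_coeffs F $ i)))
    = h (squarefree_coeffs F $ 1) * (x 2 * x 3 * x 4) + h (squarefree_coeffs F $ 2) * (x 1 * x 3 * x 4)
      + h (squarefree_coeffs F $ 3) * (x 1 * x 2 * x 4) + h (squarefree_coeffs F $ 4) * (x 1 * x 2 * x 3)"
    by (simp add: sum_4 subst4_single prod_4 lookup_squarefree_monomial)
  then show ?thesis
    by (subst homogeneous_3_sum_singles[OF assms])
      (simp add: subst4_add subst4_sum subst4_single prod_square_monomial ac_simps)
qed

lemma eval4_cubic:
  fixes F :: "'k::comm_ring_1 poly4"
  assumes "homogeneous 3 F"
  shows "eval4 F v = cub (square_coeffs F) (squarefree_coeffs F) v"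
  unfolding eval4_def cub_def using coefficient_hom.subst4_cubic[OF coefficient_hom_id assms] by simp

lemma deriv4_additive_ext:
  "deriv4 i f = additive_ext (\<lambda>m c. Poly_Mapping.single (m - Poly_Mapping.single i 1) (of_nat (Poly_Mapping.lookup m i) * c)) f"
  by (simp add: deriv4_def additive_ext_def)

lemma deriv4_add: "deriv4 i (f + g) = deriv4 i f + deriv4 i g"
  unfolding deriv4_additive_ext by (rule additive_ext_add) (auto simp: distrib_left single_add)

lemma deriv4_single:
  "deriv4 i (Poly_Mapping.single m c) = Poly_Mapping.single (m - Poly_Mapping.single i 1) (of_nat (Poly_Mapping.lookup m i) * c)"
  unfolding deriv4_additive_ext by (rule additive_ext_single) auto

lemma deriv4_sum: "deriv4 i (\<Sum>j\<in>A. f j) = (\<Sum>j\<in>A. deriv4 i (f j))"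
  by (induction A rule: infinite_finite_induct) (auto simp: deriv4_add deriv4_def[of _ 0])

lemma eval4_deriv4_cubic:
  fixes F :: "'k::comm_ring_1 poly4"
  assumes two: "(2::'k) = 0" and F: "homogeneous 3 F"
  shows "eval4 (deriv4 l F) v = pol (square_coeffs F) (squarefree_coeffs F) v (axis l 1)"
proof -
  interpret coefficient_hom "\<lambda>c::'k. c" by (rule coefficient_hom_id)
  let ?x = "\<lambda>i. v $ i"
  have s: "subst4 (\<lambda>c. c) ?x (deriv4 l (Poly_Mapping.single (square_monomial i j) c))
      = (if j = l then c * (v $ i)\<^sup>2 else 0)" for i j c
  proof -
    \<comment> \<open>Differentiating the square gives a factor 2, so only the linear factor
      contributes, also for i = j, where the exponent 3 counts as 1.\<close>
    have coeff: "of_nat (Poly_Mapping.lookup (square_monomial i j) l) = (if j = l then 1 else (0::'k))"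
      unfolding lookup_square_monomial of_nat_add if_distrib[of of_nat] of_nat_numeral of_nat_0 of_nat_1 two
      by simp
    have "square_monomial i l - Poly_Mapping.single l 1 = Poly_Mapping.single i 2"
      by (simp add: square_monomial_def)
    moreover have "(\<Prod>k\<in>UNIV. ?x k ^ Poly_Mapping.lookup (Poly_Mapping.single i 2) k) = (v $ i)\<^sup>2"
    proof -
      have "(\<Prod>k\<in>UNIV. ?x k ^ Poly_Mapping.lookup (Poly_Mapping.single i 2) k) = (\<Prod>k\<in>UNIV. if k = i then (v $ i)\<^sup>2 else 1)"
        by (rule prod.cong) (auto simp: lookup_single when_def)
      then show ?thesis by simp
    qed
    ultimately show ?thesis
      by (auto simp: deriv4_single coeff subst4_single)
  qed
  have f: "subst4 (\<lambda>c. c) ?x (deriv4 l (Poly_Mapping.single (squarefree_monomial i) c))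
      = (if i = l then 0 else c * (\<Prod>k\<in>UNIV. if k = i \<or> k = l then 1 else v $ k))" for i c
  proof -
    have "(\<Prod>k\<in>UNIV. ?x k ^ Poly_Mapping.lookup (squarefree_monomial i - Poly_Mapping.single l 1) k)
      = (\<Prod>k\<in>UNIV. if k = i \<or> k = l then 1 else v $ k)"
      by (rule prod.cong) (auto simp: lookup_minus lookup_squarefree_monomial lookup_single when_def)
    then show ?thesis
      by (simp add: deriv4_single subst4_single lookup_squarefree_monomial)
  qed
  have axis: "(\<Sum>j\<in>UNIV. b j * axis l 1 $ j) = b l" for b :: "4 \<Rightarrow> 'k"
    by (simp add: axis_def if_distrib cong: if_cong)
  have "subst4 (\<lambda>c. c) ?x (deriv4 l F)
    = (\<Sum>i\<in>UNIV. square_coeffs F $ i $ l * (v $ i)\<^sup>2)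
      + (\<Sum>i\<in>UNIV. subst4 (\<lambda>c. c) ?x (deriv4 l (Poly_Mapping.single (squarefree_monomial i) (squarefree_coeffs F $ i))))"
    by (subst homogeneous_3_sum_singles[OF F])
      (simp add: deriv4_add deriv4_sum subst4_add subst4_sum s)
  also have "(\<Sum>i\<in>UNIV. subst4 (\<lambda>c. c) ?x (deriv4 l (Poly_Mapping.single (squarefree_monomial i) (squarefree_coeffs F $ i))))
     = pol 0 (squarefree_coeffs F) v (axis l 1)"
    unfolding f using exhaust_4[of l]
    by (elim disjE) (simp_all add: pol_def sum_4 prod_4 axis_def)
  finally show ?thesis
    by (simp add: eval4_def pol_def axis)
qed

text \<open>Euler's identity, with 3 = 1, puts every point with vanishing gradient on the surface;
  so the Jacobian criterion forbids such points everywhere.\<close>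

lemma smooth_cubic_pol_nonzero:
  fixes F :: "'k::field poly4"
  assumes two: "(2::'k) = 0" and F: "smooth_cubic_surface F" and v: "v \<noteq> 0"
  shows "\<exists>w. pol (square_coeffs F) (squarefree_coeffs F) v w \<noteq> 0"
proof (rule ccontr)
  assume none: "\<not> ?thesis"
  have hom: "homogeneous 3 F" using F by (simp add: smooth_cubic_surface_def)
  have "eval4 F v = 0"
    using none pol_self[OF two, of "square_coeffs F" "squarefree_coeffs F" v] by (simp add: eval4_cubic[OF hom])
  then show False
    using F v none by (auto simp: smooth_cubic_surface_def eval4_deriv4_cubic[OF two hom])
qed

subsection \<open>Linear independence in four-space\<close>

definition indep2 :: "'k::field ^ 4 \<Rightarrow> 'k ^ 4 \<Rightarrow> bool" where
  "indep2 u v \<longleftrightarrow> (\<forall>x y. x *s u + y *s v = 0 \<longrightarrow> x = 0 \<and> y = 0)"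

definition indep3 :: "'k::field ^ 4 \<Rightarrow> 'k ^ 4 \<Rightarrow> 'k ^ 4 \<Rightarrow> bool" where
  "indep3 u v z \<longleftrightarrow> (\<forall>x y s. x *s u + y *s v + s *s z = 0 \<longrightarrow> x = 0 \<and> y = 0 \<and> s = 0)"

definition indep4 :: "'k::field ^ 4 \<Rightarrow> 'k ^ 4 \<Rightarrow> 'k ^ 4 \<Rightarrow> 'k ^ 4 \<Rightarrow> bool" where
  "indep4 u v z w \<longleftrightarrow>
     (\<forall>x y s r. x *s u + y *s v + s *s z + r *s w = 0 \<longrightarrow> x = 0 \<and> y = 0 \<and> s = 0 \<and> r = 0)"

lemma span2: "p \<in> vec.span {u, v} \<longleftrightarrow> (\<exists>x y. p = x *s u + y *s v)"
  by (auto simp: vec.span_breakdown_eq algebra_simps)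

lemma span3: "p \<in> vec.span {u, v, z} \<longleftrightarrow> (\<exists>x y s. p = x *s u + y *s v + s *s z)"
  by (auto simp: vec.span_breakdown_eq algebra_simps)

lemma vec_eq_scale_sum:
  fixes p w :: "'k::field ^ 4"
  assumes "p + r *s w = 0" "r \<noteq> 0"
  shows "w = (- (1 / r)) *s p"
proof -
  have "r *s w = - p" using assms(1) by (simp add: add_eq_0_iff)
  then have "(1 / r) *s (r *s w) = (1 / r) *s (- p)" by simp
  then show ?thesis using assms(2) by (simp add: vector_smult_assoc)
qed

lemma indep_extend:
  fixes p w :: "'k::field ^ 4"
  assumes "p + r *s w = 0" "w \<notin> vec.span S" "p \<in> vec.span S"
  shows "r = 0"
  using assms vec_eq_scale_sum[OF assms(1)] vec.span_scale by metis

lemma dim_indep2: assumes "indep2 u v" shows "vec.dim (vec.span {u, v}) = 2"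
proof -
  have "v \<noteq> 0" "u \<notin> vec.span {v}"
  proof -
    show "v \<noteq> 0" using assms[unfolded indep2_def, rule_format, of 0 1] by auto
    show "u \<notin> vec.span {v}"
    proof
      assume "u \<in> vec.span {v}"
      then obtain k where "u = k *s v" by (auto simp: vec.span_singleton)
      then show False using assms[unfolded indep2_def, rule_format, of 1 "- k"] by auto
    qed
  qed
  then have "vec.independent {u, v}"
    by (intro vec.independent_insertI) (auto simp: vec.independent_empty)
  moreover have "card {u, v} = 2"
    using \<open>u \<notin> vec.span {v}\<close> vec.span_base[of v "{v}"] by (cases "u = v") auto
  ultimately show ?thesis
    using vec.dim_span_eq_card_independent by metis
qed

lemma indep3_rotate: "indep3 u v z \<Longrightarrow> indep3 v z u"
  unfolding indep3_def
proof (intro allI impI)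
  fix x y s assume *: "\<forall>x y s. x *s u + y *s v + s *s z = 0 \<longrightarrow> x = 0 \<and> y = 0 \<and> s = 0" "x *s v + y *s z + s *s u = 0"
  have "s *s u + x *s v + y *s z = x *s v + y *s z + s *s u" by (simp only: ac_simps)
  with *(1)[rule_format, of s x y] *(2) show "x = 0 \<and> y = 0 \<and> s = 0" by simp
qed

lemma indep4_swap: "indep4 u v z w \<Longrightarrow> indep4 u v w z"
  unfolding indep4_def
proof (intro allI impI)
  fix x y s r
  assume *: "\<forall>x y s r. x *s u + y *s v + s *s z + r *s w = 0 \<longrightarrow> x = 0 \<and> y = 0 \<and> s = 0 \<and> r = 0"
    "x *s u + y *s v + s *s w + r *s z = 0"
  have "x *s u + y *s v + r *s z + s *s w = x *s u + y *s v + s *s w + r *s z" by (simp only: ac_simps)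
  with *(1)[rule_format, of x y r s] *(2) show "x = 0 \<and> y = 0 \<and> s = 0 \<and> r = 0" by simp
qed

lemma indep3_indep2: "indep3 u v z \<Longrightarrow> indep2 u v"
  unfolding indep3_def indep2_def
proof (intro allI impI)
  fix x y assume *: "\<forall>x y s. x *s u + y *s v + s *s z = 0 \<longrightarrow> x = 0 \<and> y = 0 \<and> s = 0" "x *s u + y *s v = 0"
  then show "x = 0 \<and> y = 0" using *(1)[rule_format, of x y 0] by simp
qed

lemma dim_indep3: assumes "indep3 u v z" shows "vec.dim (vec.span {u, v, z}) = 3"
proof -
  have vz: "indep2 v z" using indep3_indep2[OF indep3_rotate[OF assms]] .
  have u: "u \<notin> vec.span {v, z}"
  proof
    assume "u \<in> vec.span {v, z}"
    then obtain k l where "u = k *s v + l *s z" by (auto simp: span2)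
    then have "1 *s u + (- k) *s v + (- l) *s z = 0" by (simp add: algebra_simps)
    then show False using assms unfolding indep3_def by (metis zero_neq_one)
  qed
  then show ?thesis
    using dim_indep2[OF vz] by (simp add: vec.dim_insert)
qed

lemma exists_not_in_span:
  fixes S :: "('k::field ^ 4) set"
  assumes "finite S" "card S < 4"
  shows "\<exists>w. w \<notin> vec.span S"
proof (rule ccontr)
  assume "\<not> ?thesis"
  then have "vec.dim (UNIV :: ('k ^ 4) set) \<le> card S"
    by (intro vec.dim_le_card) (use assms in auto)
  then show False using assms(2) unfolding vec_dim_card by simp
qed

lemma card_pair_le: "card {u, v} \<le> 2" "card {u, v, w} \<le> 3"
  using card_length[of "[u, v]"] card_length[of "[u, v, w]"] by simp_all

lemma indep3_extend:
  fixes u v z :: "'k::field ^ 4"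
  assumes "indep3 u v z"
  obtains w where "indep4 u v z w"
proof -
  obtain w where w: "w \<notin> vec.span {u, v, z}"
    using exists_not_in_span[of "{u, v, z}"] card_pair_le(2)[of u v z] by auto
  have "indep4 u v z w"
    unfolding indep4_def
  proof (intro allI impI)
    fix x y s r assume *: "x *s u + y *s v + s *s z + r *s w = 0"
    then have "r = 0"
      by (rule indep_extend[OF _ w]) (auto simp: span3)
    with * assms show "x = 0 \<and> y = 0 \<and> s = 0 \<and> r = 0"
      unfolding indep3_def by simp
  qed
  then show thesis using that by blast
qed

lemma indep2_extend:
  fixes u v :: "'k::field ^ 4"
  assumes "indep2 u v"
  obtains z w where "indep4 u v z w"
proof -
  obtain z where z: "z \<notin> vec.span {u, v}"
    using exists_not_in_span[of "{u, v}"] card_pair_le(1)[of u v] by auto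
  have "indep3 u v z"
    unfolding indep3_def
  proof (intro allI impI)
    fix x y s assume *: "x *s u + y *s v + s *s z = 0"
    then have "s = 0"
      by (rule indep_extend[OF _ z]) (auto simp: span2)
    with * assms show "x = 0 \<and> y = 0 \<and> s = 0"
      unfolding indep2_def by simp
  qed
  with indep3_extend that show thesis by metis
qed

lemma indep4_spans:
  fixes u v z w p :: "'k::field ^ 4"
  assumes "indep4 u v z w"
  obtains x y s r where "p = x *s u + y *s v + s *s z + r *s w"
proof -
  define P :: "'k ^ 4 ^ 4" where "P = (\<chi> i j. (if j = 1 then u else if j = 2 then v else if j = 3 then z else w) $ i)"
  have P: "P *v c = c $ 1 *s u + c $ 2 *s v + c $ 3 *s z + c $ 4 *s w" for c
    by (simp add: P_def matrix_vector_mult_def vec_eq_iff sum_4 mult.commute)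
  have "inj ((*v) P)"
  proof (rule injI)
    fix c d assume "P *v c = P *v d"
    then have "P *v (c - d) = 0" by (simp add: matrix_vector_mult_diff_distrib)
    then have "(c - d) $ 1 = 0 \<and> (c - d) $ 2 = 0 \<and> (c - d) $ 3 = 0 \<and> (c - d) $ 4 = 0"
      using assms unfolding P indep4_def by blast
    then show "c = d" by (simp add: vec_eq_iff forall_4)
  qed
  then have "surj ((*v) P)"
    by (intro vec.linear_injective_imp_surjective matrix_vector_mul_linear_gen refl)
  then obtain c where "p = P *v c" by (metis surjD)
  with P that show thesis by metis
qed

subsection \<open>Lines and triangles\<close>

lemma char2_sqrt: obtains y where "y\<^sup>2 = (x::'k::alg_closed_field)"
  using nth_root_exists[of 2 x] by auto

locale smooth_cubic_form =
  fixes a :: "'k::alg_closed_field ^ 4 ^ 4" and q :: "'k ^ 4"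
  assumes two: "(2::'k) = 0"
    and nondegenerate: "v \<noteq> 0 \<Longrightarrow> \<exists>w. pol a q v w \<noteq> 0"
begin

lemma cancel: "(x::'k) + x = 0" "x + (x + y) = (y::'k)"
  using two_add_self[OF two] by (simp_all flip: add.assoc)

lemma char2_power2_eq_iff: "x\<^sup>2 = y\<^sup>2 \<longleftrightarrow> x = (y::'k)"
proof
  assume "x\<^sup>2 = y\<^sup>2"
  then have "(x + y)\<^sup>2 = 0" by (simp add: two_power2_add[OF two] cancel)
  then have "x + y = 0" by simp
  then have "x + (x + y) = x" by simp
  then show "x = y" by (simp only: cancel)
qed simp

lemma char2_add_eq_0_iff: "x + y = 0 \<longleftrightarrow> x = (y::'k)"
  by (metis add.right_neutral cancel)

lemmas linear_rules = pol_add_right pol_scale_right pol_add_left[OF two] pol_scale_left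
  tri_add tri_scale tri_add2 tri_scale2 tri_add3 tri_scale3 tri_self[OF two] tri_self2[OF two]

lemmas expand = cub_add[OF two] cub_scale linear_rules

abbreviation "b \<equiv> pol a q"
abbreviation "f \<equiv> cub a q"
abbreviation "t \<equiv> tri q"

definition line :: "'k ^ 4 \<Rightarrow> 'k ^ 4 \<Rightarrow> bool" where
  "line u v \<longleftrightarrow> f u = 0 \<and> f v = 0 \<and> b u v = 0 \<and> b v u = 0"

lemma lineD: assumes "line u v" shows "f u = 0" "f v = 0" "b u v = 0" "b v u = 0" "b u u = 0" "b v v = 0"
  using assms by (auto simp: line_def pol_self[OF two])

lemma line_vanish: "line u v \<Longrightarrow> f (x *s u + y *s v) = 0"
  by (simp add: expand line_def)

lemma exists_other: "\<exists>y::'k. y \<noteq> 0 \<and> y \<noteq> 1"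
proof -
  have "degree [:1, 1, 1::'k:] > 0" by simp
  then obtain y :: 'k where y: "poly [:1, 1, 1:] y = 0"
    using alg_closed_imp_poly_has_root by blast
  have "y \<noteq> 0" using y by auto
  moreover have "y \<noteq> 1" using y by (auto simp: cancel)
  ultimately show ?thesis by blast
qed

text \<open>On the line the form is x*y*(x*b u v + y*b v u). As a function on the field with two
  elements this can vanish without being zero, hence the use of a third scalar.\<close>

lemma lineI:
  assumes "\<And>x y. f (x *s u + y *s v) = 0"
  shows "line u v"
proof -
  have u: "f u = 0" using assms[of 1 0] by simp
  have v: "f v = 0" using assms[of 0 1] by simp
  have *: "x\<^sup>2 * y * b u v + y\<^sup>2 * x * b v u = 0" for x y
    using assms[of x y] by (simp add: expand u v ac_simps)
  obtain y :: 'k where y: "y \<noteq> 0" "y \<noteq> 1" using exists_other by blast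
  have eq: "b u v = b v u" using *[of 1 1] by (simp add: char2_add_eq_0_iff)
  have "y * (b v u * (1 + y)) = 0"
    using *[of 1 y] by (simp add: eq algebra_simps power2_eq_square)
  then have "b v u = 0"
    using y by (auto simp: char2_add_eq_0_iff)
  with eq u v show ?thesis by (simp add: line_def)
qed

text \<open>The left side is the square of a linear form in x and y, since square roots exist and
  squaring is additive.\<close>

lemma binary_square_root:
  obtains x y where "x\<^sup>2 * A + y\<^sup>2 * C = (0::'k)" "x \<noteq> 0 \<or> y \<noteq> 0"
proof -
  obtain r s :: 'k where rs: "r\<^sup>2 = C" "s\<^sup>2 = A" using char2_sqrt by metis
  show thesis
  proof (cases "r = 0 \<and> s = 0")
    case True
    then show thesis using that[of 1 0] rs by auto
  next
    case False
    then show thesis using that[of r s] rs by (auto simp: mult.commute cancel)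
  qed
qed

lemma singular_contradiction:
  assumes "indep4 u v z w" "p \<noteq> 0" "b p u = 0" "b p v = 0" "b p z = 0" "b p w = 0"
  shows False
proof -
  obtain h where "b p h \<noteq> 0" using nondegenerate assms(2) by blast
  moreover obtain x y s r where "h = x *s u + y *s v + s *s z + r *s w"
    using indep4_spans[OF assms(1)] by metis
  ultimately show False using assms by (simp add: pol_add_right pol_scale_right)
qed

definition triangle :: "'k ^ 4 \<Rightarrow> 'k ^ 4 \<Rightarrow> 'k ^ 4 \<Rightarrow> bool" where
  "triangle p r s \<longleftrightarrow> indep3 p r s \<and> line p r \<and> line r s \<and> line s p"

text \<open>
  The residual conic of the plane spanned by the line \<open>u v\<close> and the point \<open>h\<close> is singular at the
  point \<open>p\<close> below: in characteristic two the vertex is read off from the linear coefficients.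
\<close>

lemma triangle_from_conic:
  assumes uv: "line u v" and t1: "t u v h = 1" and A: "b u h \<noteq> 0"
    and disc: "b u h * (b h v)\<^sup>2 + b v h * (b h u)\<^sup>2 + f h + b h u * b h v = 0"
  shows "\<exists>p r s. triangle p r s"
proof -
  let ?A = "b u h" and ?C = "b v h" and ?D = "b h u" and ?E = "b h v"
  have t: "t u h v = 1" "t v h u = 1" "t v u h = 1" "t h u v = 1" "t h v u = 1"
    using t1 tri_swap by metis+
  note uv' = lineD[OF uv]
  \<comment> \<open>On the plane the form at X*u + Y*v + Z*h is Z times the conic A*X^2 + C*Y^2 +
    X*Y + D*X*Z + E*Y*Z + f(h)*Z^2. Its partial derivatives vanish together only at multiples of (E,
    D, 1), and \<open>disc\<close> says that the conic vanishes there too.\<close>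
  define p where "p = ?E *s u + ?D *s v + h"
  \<comment> \<open>The conic meets the given line Z = 0 at the roots of A*X^2 + X + C with Y = 1;
    the two other sides of the triangle join them to \<open>p\<close>.\<close>
  have "degree [:?C, 1, ?A:] > 0" by (simp add: A)
  then obtain \<rho> where \<rho>: "poly [:?C, 1, ?A:] \<rho> = 0"
    using alg_closed_imp_poly_has_root by blast
  have fp: "f p = 0"
  proof -
    have "f p = (?A * ?E\<^sup>2 + ?C * ?D\<^sup>2 + f h + ?D * ?E)"
      by (simp add: p_def expand uv' t t1 algebra_simps cancel)
    then show ?thesis using disc by simp
  qed
  have side: "line p (x *s u + v)" if x: "?A * x\<^sup>2 + x + ?C = 0" for x
  proof -
    have "b p (x *s u + v) = 0"
      by (simp add: p_def expand uv' t t1 algebra_simps cancel)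
    moreover have "b (x *s u + v) p = ?A * x\<^sup>2 + x + ?C"
      by (simp add: p_def expand uv' t t1 algebra_simps cancel)
    moreover have "f (x *s u + v) = 0"
      using line_vanish[OF uv, of x 1] by simp
    ultimately show ?thesis using fp x by (simp add: line_def)
  qed
  have \<rho>1: "?A * \<rho>\<^sup>2 + \<rho> + ?C = 0"
    using \<rho> by (simp add: algebra_simps power2_eq_square)
  \<comment> \<open>The two roots have sum 1/A, so they are distinct.\<close>
  define \<sigma> where "\<sigma> = \<rho> + 1 / ?A"
  have "?A * \<sigma>\<^sup>2 + \<sigma> + ?C = ?A * \<rho>\<^sup>2 + \<rho> + ?C + (1 / ?A + ?A * (1 / ?A)\<^sup>2)"
    by (simp add: \<sigma>_def two_power2_add[OF two] algebra_simps)
  also have "?A * (1 / ?A)\<^sup>2 = 1 / ?A"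
    using A by (simp add: power2_eq_square)
  finally have \<sigma>1: "?A * \<sigma>\<^sup>2 + \<sigma> + ?C = 0"
    using \<rho>1 by (simp add: cancel)
  let ?r = "\<rho> *s u + v" and ?s = "\<sigma> *s u + v"
  have "line ?r ?s"
    by (simp add: line_def expand uv')
  moreover have "indep3 p ?r ?s"
    unfolding indep3_def
  proof (intro allI impI)
    fix x y z assume *: "x *s p + y *s ?r + z *s ?s = 0"
    \<comment> \<open>The form \<open>t\<close> serves to read off coordinates: \<open>t u v\<close>
      annihilates the line and takes the value 1 at \<open>p\<close>.\<close>
    have "t u v (x *s p + y *s ?r + z *s ?s) = x"
      by (simp add: p_def expand t1)
    moreover have "t u v 0 = 0" using tri_scale3[of q u v 0 0] by simp
    ultimately have x: "x = 0" using * by simp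
    have t0: "t u 0 h = 0" "t v 0 h = 0" using tri_scale2[of q _ 0 0 h] by simp_all
    have "t u (y *s ?r + z *s ?s) h = y + z" "t v (y *s ?r + z *s ?s) h = \<rho> * y + \<sigma> * z"
      by (simp_all add: expand t1 t algebra_simps)
    with * x t0 have "y + z = 0" "\<rho> * y + \<sigma> * z = 0" by simp_all
    then have "y = z" "(1 / ?A) * z = 0"
      by (simp_all add: char2_add_eq_0_iff \<sigma>_def algebra_simps cancel)
    with A x show "x = 0 \<and> y = 0 \<and> z = 0" by simp
  qed
  ultimately have "triangle p ?r ?s"
    using side[OF \<rho>1] side[OF \<sigma>1] by (auto simp: triangle_def line_def)
  then show ?thesis by blast
qed

lemma poly_root:
  fixes p :: "'k poly"
  assumes "coeff p (Suc n) \<noteq> 0"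
  obtains x where "poly p x = 0"
proof -
  have "degree p > 0" using le_degree[OF assms] by simp
  with alg_closed_imp_poly_has_root that show thesis by blast
qed

lemma tri_q: "t q x y = 0" "t x q y = 0" "t x y q = 0"
  using tri_coefficients[OF two, of q] tri_swap by metis+

text \<open>
  The vector \<open>q\<close> of squarefree coefficients is a point of projective space canonically attached to
  the surface: a plane avoids \<open>q\<close> iff the cubic has a squarefree term on it.
\<close>

lemma triangle_off_line_normalised:
  assumes uv: "line u v" and t1: "t u v w = 1" and uq: "b u q = 0" and q0: "q \<noteq> 0"
  shows "\<exists>p r s. triangle p r s"
proof -
  note uv' = lineD[OF uv]
  have t: "t u w v = 1" "t v w u = 1" "t v u w = 1" "t w u v = 1" "t w v u = 1"
    using t1 tri_swap by metis+
  have basis: "indep4 u v q w"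
    unfolding indep4_def
  proof (intro allI impI)
    fix x y s r assume *: "x *s u + y *s v + s *s q + r *s w = 0"
    let ?h = "x *s u + y *s v + s *s q + r *s w"
    have "t u v ?h = r" "t u w ?h = y" "t v w ?h = x"
      by (simp_all add: expand t1 t tri_q)
    moreover have "t z z' 0 = 0" for z z' using tri_scale3[of q z z' 0 0] by simp
    ultimately have "r = 0" "y = 0" "x = 0" using * by simp_all
    with * q0 show "x = 0 \<and> y = 0 \<and> s = 0 \<and> r = 0" by simp
  qed
  define a1 where "a1 = b u w"
  have u0: "u \<noteq> 0"
  proof
    assume "u = 0"
    then show False using t1 tri_scale[of q 0 0 v w] by simp
  qed
  have a1: "a1 \<noteq> 0"
    using singular_contradiction[OF basis u0] uv' uq by (auto simp: a1_def)
  define c c1 where "c = b v q" and "c1 = b v w"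
  define d d2 e e2 where "d = b q u" and "d2 = b w u" and "e = b q v" and "e2 = b w v"
  define g g1 g2 g3 where "g = f q" and "g1 = b q w" and "g2 = b w q" and "g3 = f w"
  note defs = a1_def c_def c1_def d_def d2_def e_def e2_def g_def g1_def g2_def g3_def
  have c0: "c \<noteq> 0"
  proof
    \<comment> \<open>With b v q = 0 the gradient at x*u + v can pair nontrivially only with
      \<open>w\<close>, and the value is a1*x^2 + x + c1; a root would give a singular
      point.\<close>
    assume c0: "c = 0"
    have "degree [:c1, 1, a1:] > 0" using a1 by simp
    then obtain x where x: "poly [:c1, 1, a1:] x = 0" using alg_closed_imp_poly_has_root by blast
    let ?p = "x *s u + v"
    have "t u w ?p = 1" by (simp add: expand t)
    then have "?p \<noteq> 0" using tri_scale3[of q u w 0 0] by auto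
    moreover have "b ?p u = 0" "b ?p v = 0" "b ?p q = 0"
      using c0 by (simp_all add: expand uv' uq tri_q c_def)
    moreover have "b ?p w = 0"
      using x by (simp add: expand t t1 a1_def c1_def algebra_simps power2_eq_square)
    ultimately show False using singular_contradiction[OF basis] by blast
  qed
  \<comment> \<open>The discriminant of \<open>triangle_from_conic\<close> for h = \<zeta>*q + w.
    These vectors give all planes through the line that avoid \<open>q\<close>, and they stay
    normalised because \<open>t\<close> annihilates \<open>q\<close>. The condition b u q = 0 makes
    b u h the constant a1.\<close>
  define \<Delta> where "\<Delta> = [:a1 * e2\<^sup>2 + c1 * d2\<^sup>2 + g3 + d2 * e2, c * d2\<^sup>2 + g2, g1 + d * e2 + d2 * e, g,
     a1 * e\<^sup>2 + c1 * d\<^sup>2 + d * e, c * d\<^sup>2:]"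
  \<comment> \<open>If the polynomial is constant, its top three coefficients force d = e = g = 0.
    The gradient at x*u + s*q then pairs only with \<open>w\<close>, with value x^2*a1 + s^2*g1, and
    a nontrivial zero of this is a singular point.\<close>
  have "\<exists>n. coeff \<Delta> (Suc n) \<noteq> 0"
  proof (rule ccontr)
    assume none: "\<not> ?thesis"
    then have zero: "coeff \<Delta> (Suc n) = 0" for n by blast
    have "c * d\<^sup>2 = 0" "a1 * e\<^sup>2 + c1 * d\<^sup>2 + d * e = 0" "g = 0"
      using zero[of 4] zero[of 3] zero[of 2] by (simp_all add: \<Delta>_def eval_nat_numeral)
    with c0 a1 have de: "d = 0" "e = 0" "g = 0" by simp_all
    obtain x s where xs: "x\<^sup>2 * a1 + s\<^sup>2 * g1 = 0" "x \<noteq> 0 \<or> s \<noteq> 0" using binary_square_root by metis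
    let ?p = "x *s u + s *s q"
    have "?p \<noteq> 0"
      using xs(2) basis[unfolded indep4_def, rule_format, of x 0 s 0] by auto
    moreover have "b ?p u = 0" "b ?p v = 0" "b ?p q = 0" "b ?p w = 0"
      using xs(1) de by (simp_all add: expand uv' uq tri_q pol_self[OF two] a1_def d_def e_def g_def g1_def)
    ultimately show False using singular_contradiction[OF basis] by blast
  qed
  then obtain \<zeta> where \<zeta>: "poly \<Delta> \<zeta> = 0" using poly_root by metis
  define h where "h = \<zeta> *s q + w"
  have bu: "b u h = a1" "b v h = c * \<zeta> + c1"
    by (simp_all add: h_def expand uq defs)
  have bh: "b h u = d * \<zeta>\<^sup>2 + d2" "b h v = e * \<zeta>\<^sup>2 + e2"
    by (simp_all add: h_def expand tri_q defs)
  have fh: "f h = g * \<zeta> ^ 3 + g1 * \<zeta>\<^sup>2 + g2 * \<zeta> + g3"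
    by (simp add: h_def expand tri_q defs)
  have "b u h * (b h v)\<^sup>2 + b v h * (b h u)\<^sup>2 + f h + b h u * b h v = poly \<Delta> \<zeta>"
    unfolding bu bh fh
    by (simp add: \<Delta>_def two_power2_add[OF two] power_mult_distrib algebra_simps power2_eq_square power3_eq_cube two)
  moreover have "t u v h = 1"
    by (simp add: h_def expand tri_q t1)
  ultimately show ?thesis
    using triangle_from_conic[OF uv] \<zeta> bu(1) a1 by metis
qed

text \<open>The pairing of the gradient with \<open>q\<close> along the line is x^2*b u q + y^2*b v
  q, since the cross term contains \<open>q\<close> twice; so it vanishes at some point
  \<open>u'\<close> of the line. A unimodular change of basis and a rescaling of \<open>w\<close>
  give the normalised situation.\<close>

lemma triangle_off_line:
  assumes uv: "line u v" and t: "t u v w \<noteq> 0"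
  shows "\<exists>p r s. triangle p r s"
proof -
  have q0: "q \<noteq> 0"
  proof
    assume "q = 0"
    then show False using t by (simp add: tri_def)
  qed
  obtain x y where xy: "x\<^sup>2 * b u q + y\<^sup>2 * b v q = 0" "x \<noteq> 0 \<or> y \<noteq> 0" using binary_square_root by metis
  define u' where "u' = x *s u + y *s v"
  obtain i j where ij: "x * j + y * i = 1"
    using xy(2) by (cases "x = 0") (metis add.commute add_0 mult_zero_left nonzero_eq_divide_eq mult.commute)+
  define v' where "v' = i *s u + j *s v"
  have vu: "t v u w = t u v w" using tri_swap by metis
  have "line u' v'"
    using lineD[OF uv] by (simp add: line_def u'_def v'_def expand)
  moreover have "t u' v' ((1 / t u v w) *s w) = 1"
  proof -
    have "t u' v' w = (x * j + y * i) * t u v w"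
      by (simp add: u'_def v'_def expand vu algebra_simps)
    then show ?thesis using ij t by (simp add: tri_scale3)
  qed
  moreover have "b u' q = 0"
    using xy(1) by (simp add: u'_def expand tri_q)
  ultimately show ?thesis
    using triangle_off_line_normalised q0 by blast
qed

text \<open>The hypothesis \<open>t0\<close> says that the line passes through \<open>q\<close>. In
  a plane through it the residual conic has no X*Y term; where it degenerates, its components pass
  through a common point of the given line. They avoid \<open>q\<close> if the plane is not tangent
  to the surface at \<open>q\<close>.\<close>

lemma line_moved_off:
  assumes uv: "line u v" and ind: "indep2 u v" and t0: "\<And>w. t u v w = 0" and q0: "q \<noteq> 0"
  shows "\<exists>u' v' w. line u' v' \<and> t u' v' w \<noteq> 0"
proof -
  note uv' = lineD[OF uv]
  obtain z0 w0 where basis0: "indep4 u v z0 w0" using indep2_extend[OF ind] by metis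
  have perm: "t u v x = 0" "t u x v = 0" "t v x u = 0" "t v u x = 0" "t x u v = 0" "t x v u = 0" for x
    using t0 tri_swap by metis+
  define e d where "e = t z0 w0 v" and "d = t z0 w0 u"
  \<comment> \<open>This is \<open>q\<close> up to a scalar: t p z0 w0 = e*d + d*e = 0, so
    \<open>p\<close> lies in the radical of \<open>t\<close>.\<close>
  define p where "p = e *s u + d *s v"
  have ed: "e \<noteq> 0 \<or> d \<noteq> 0"
  proof (rule ccontr)
    assume "\<not> ?thesis"
    then have zw: "t z0 w0 u = 0" "t z0 w0 v = 0" by (simp_all add: e_def d_def)
    have zw': "t z0 u w0 = 0" "t u z0 w0 = 0" "t u w0 z0 = 0" "t w0 u z0 = 0" "t w0 z0 u = 0"
      "t z0 v w0 = 0" "t v z0 w0 = 0" "t v w0 z0 = 0" "t w0 v z0 = 0" "t w0 z0 v = 0"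
      using zw tri_swap by metis+
    have "t x y z = 0" for x y z
    proof -
      obtain x1 x2 x3 x4 where x: "x = x1 *s u + x2 *s v + x3 *s z0 + x4 *s w0" using indep4_spans[OF basis0] by metis
      obtain y1 y2 y3 y4 where y: "y = y1 *s u + y2 *s v + y3 *s z0 + y4 *s w0" using indep4_spans[OF basis0] by metis
      obtain z1 z2 z3 z4 where z: "z = z1 *s u + z2 *s v + z3 *s z0 + z4 *s w0" using indep4_spans[OF basis0] by metis
      show ?thesis unfolding x y z by (simp add: expand perm zw zw')
    qed
    then show False using tri_eq_0D q0 by blast
  qed
  have p0: "p \<noteq> 0"
    using ed ind by (auto simp: p_def indep2_def)
  have bp: "b p u = 0" "b p v = 0" "b p h = e\<^sup>2 * b u h + d\<^sup>2 * b v h" for h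
    by (simp_all add: p_def expand uv' perm)
  have swapped: "\<exists>z w. indep4 u v z w \<and> t z w v = e \<and> t z w u = d \<and> b p w \<noteq> 0"
  proof (cases "b p w0 = 0")
    case False
    then show ?thesis using basis0 e_def d_def by blast
  next
    case True
    then have "b p z0 \<noteq> 0" using singular_contradiction[OF basis0 p0] bp by blast
    moreover have "indep4 u v w0 z0"
      using basis0 by (rule indep4_swap)
    moreover have "t w0 z0 v = e" "t w0 z0 u = d" using tri_swap unfolding e_def d_def by metis+
    ultimately show ?thesis by blast
  qed
  then obtain z1 w where basis1: "indep4 u v z1 w" and ed1: "t z1 w v = e" "t z1 w u = d" and w: "b p w \<noteq> 0"
    by blast
  define k where "k = b p z1 / b p w"
  \<comment> \<open>\<open>z\<close> is moved into the tangent plane at \<open>p\<close>, so that b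
    p (\<zeta>*z + w) is the same nonzero scalar for every \<zeta>.\<close>
  define z where "z = z1 + k *s w"
  have pz: "b p z = 0"
    using w by (simp add: z_def pol_add_right pol_scale_right k_def cancel)
  have edz: "t z w v = e" "t z w u = d"
    using ed1 by (simp_all add: z_def expand)
  have edz': "t w u z = d" "t u w z = d" "t w v z = e" "t v w z = e" "t z u w = d" "t z v w = e" "t w z u = d" "t w z v = e"
    using edz tri_swap by metis+
  define az aw cz cw where "az = b u z" and "aw = b u w" and "cz = b v z" and "cw = b v w"
  define dz dw ez ew where "dz = b z u" and "dw = b w u" and "ez = b z v" and "ew = b w v"
  \<comment> \<open>For h = \<zeta>*z + w, the partial derivatives of the conic A*X^2 + C*Y^2 +
    D*X*Z + E*Y*Z + f(h)*Z^2 vanish at (E, D, 0), where its value is A*E^2 + C*D^2. As a polynomial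
    in \<zeta> this value has b p w as coefficient of \<zeta>^2, so it is not constant.\<close>
  define \<Delta> where "\<Delta> = [:aw * ew\<^sup>2 + cw * dw\<^sup>2, az * ew\<^sup>2 + cz * dw\<^sup>2, aw * e\<^sup>2 + cw * d\<^sup>2, az * e\<^sup>2 + cz * d\<^sup>2,
    aw * ez\<^sup>2 + cw * dz\<^sup>2, az * ez\<^sup>2 + cz * dz\<^sup>2:]"
  have "coeff \<Delta> (Suc 1) = b p w"
    by (simp add: \<Delta>_def bp aw_def cw_def mult.commute)
  then obtain \<zeta> where \<zeta>: "poly \<Delta> \<zeta> = 0" using poly_root w by metis
  define h where "h = \<zeta> *s z + w"
  define A C D E where "A = b u h" and "C = b v h" and "D = b h u" and "E = b h v"
  have AC: "A = az * \<zeta> + aw" "C = cz * \<zeta> + cw"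
    by (simp_all add: A_def C_def h_def expand az_def aw_def cz_def cw_def)
  have DE: "D = dz * \<zeta>\<^sup>2 + d * \<zeta> + dw" "E = ez * \<zeta>\<^sup>2 + e * \<zeta> + ew"
    by (simp_all add: D_def E_def h_def expand edz dz_def dw_def ez_def ew_def)
  have "A * E\<^sup>2 + C * D\<^sup>2 = poly \<Delta> \<zeta>"
    unfolding AC DE
    by (simp add: \<Delta>_def two_power2_add[OF two] power_mult_distrib algebra_simps power2_eq_square two)
  then have disc: "A * E\<^sup>2 + C * D\<^sup>2 = 0" using \<zeta> by simp
  have kappa: "e\<^sup>2 * A + d\<^sup>2 * C \<noteq> 0"
  proof -
    have "b p h = b p w" by (simp add: h_def pol_add_right pol_scale_right pz)
    then show ?thesis using w bp(3)[of h] by (simp add: A_def C_def)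
  qed
  \<comment> \<open>Once D and E are shown proportional to these square roots, the conic is a
    quadratic form in \<alpha>*X + \<gamma>*Y and Z, so it factors.\<close>
  obtain \<alpha> \<gamma> where ag: "\<alpha>\<^sup>2 = A" "\<gamma>\<^sup>2 = C" using char2_sqrt by metis
  have "(\<alpha> * E)\<^sup>2 = (\<gamma> * D)\<^sup>2"
    using disc by (simp add: power_mult_distrib ag char2_add_eq_0_iff)
  then have aE: "\<alpha> * E = \<gamma> * D" by (simp only: char2_power2_eq_iff)
  have ag0: "\<alpha> \<noteq> 0 \<or> \<gamma> \<noteq> 0" using kappa ag by auto
  obtain \<mu> where \<mu>: "D = \<mu> * \<alpha>" "E = \<mu> * \<gamma>"
  proof (cases "\<alpha> = 0")
    case True
    then have "D = 0" using aE ag0 by simp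
    with True ag0 that[of "E / \<gamma>"] show thesis by simp
  next
    case False
    then have "E = D / \<alpha> * \<gamma>" using aE by (simp add: field_simps)
    with False that[of "D / \<alpha>"] show thesis by simp
  qed
  have "degree [:f h, \<mu>, 1:] > 0" by simp
  then obtain \<tau> where \<tau>: "poly [:f h, \<mu>, 1:] \<tau> = 0"
    using alg_closed_imp_poly_has_root by blast
  obtain x y where xy: "\<alpha> * x + \<gamma> * y = \<tau>"
  proof (cases "\<alpha> = 0")
    case True
    with ag0 that[of 0 "\<tau> / \<gamma>"] show thesis by simp
  next
    case False
    with that[of "\<tau> / \<alpha>" 0] show thesis by simp
  qed
  \<comment> \<open>The vertex, where \<alpha>*X + \<gamma>*Y and Z both vanish, and a point of the
    component \<alpha>*X + \<gamma>*Y = \<tau>*Z.\<close>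
  define p1 p2 where "p1 = \<gamma> *s u + \<alpha> *s v" and "p2 = x *s u + y *s v + h"
  have "f p1 = 0" unfolding p1_def by (rule line_vanish[OF uv])
  moreover have "f p2 = 0"
  proof -
    have "f p2 = A * x\<^sup>2 + C * y\<^sup>2 + D * x + E * y + f h"
      by (simp add: p2_def expand uv' perm A_def C_def D_def E_def algebra_simps)
    also have "\<dots> = (\<alpha> * x + \<gamma> * y)\<^sup>2 + \<mu> * (\<alpha> * x + \<gamma> * y) + f h"
      by (simp add: ag \<mu> two_power2_add[OF two] power_mult_distrib algebra_simps)
    also have "\<dots> = poly [:f h, \<mu>, 1:] \<tau>"
      by (simp add: xy algebra_simps power2_eq_square)
    finally show ?thesis using \<tau> by simp
  qed
  moreover have "b p1 p2 = 0"
  proof -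
    have "b p1 p2 = \<gamma>\<^sup>2 * A + \<alpha>\<^sup>2 * C"
      by (simp add: p1_def p2_def expand uv' perm A_def C_def)
    then show ?thesis by (simp add: ag mult.commute cancel)
  qed
  moreover have "b p2 p1 = 0"
  proof -
    have "b p2 p1 = \<gamma> * D + \<alpha> * E"
      by (simp add: p1_def p2_def expand uv' perm D_def E_def)
    then show ?thesis by (simp add: aE cancel)
  qed
  moreover have "t p1 p2 z \<noteq> 0"
  proof -
    have "t p1 p2 z = \<gamma> * d + \<alpha> * e"
      by (simp add: p1_def p2_def h_def expand perm edz')
    then have "(t p1 p2 z)\<^sup>2 = e\<^sup>2 * A + d\<^sup>2 * C"
      by (simp add: two_power2_add[OF two] power_mult_distrib ag algebra_simps)
    then show ?thesis using kappa by auto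
  qed
  ultimately show ?thesis unfolding line_def by blast
qed

lemma triangle_exists:
  assumes "line u v" "indep2 u v" "q \<noteq> 0"
  shows "\<exists>p r s. triangle p r s"
  using line_moved_off[OF assms(1,2) _ assms(3)] triangle_off_line assms(1) by metis

text \<open>The form vanishes on the whole plane, so the gradient at its points pairs only with a
  vector \<open>w\<close> outside. Along the side through \<open>p\<close> and \<open>r\<close> this
  pairing is a quadratic form without cross term and has a zero, a singular point.\<close>

lemma no_triangle:
  assumes "q = 0"
  shows "\<not> triangle p r s"
proof
  assume tr: "triangle p r s"
  then have ind: "indep3 p r s" and l: "line p r" "line r s" "line s p" by (auto simp: triangle_def)
  note l' = l[THEN lineD(1)] l[THEN lineD(3)] l[THEN lineD(4)]
  obtain w where basis: "indep4 p r s w" using indep3_extend[OF ind] by metis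
  have t: "t x y z = 0" for x y z using assms by (simp add: tri_def)
  obtain x y where xy: "x\<^sup>2 * b p w + y\<^sup>2 * b r w = 0" "x \<noteq> 0 \<or> y \<noteq> 0" using binary_square_root by metis
  let ?p = "x *s p + y *s r"
  have "?p \<noteq> 0" using basis[unfolded indep4_def, rule_format, of x y 0 0] xy(2) by auto
  moreover have "b ?p p = 0" "b ?p r = 0" "b ?p s = 0" "b ?p w = 0"
    using xy(1) l' by (simp_all add: expand t pol_self[OF two])
  ultimately show False using singular_contradiction[OF basis] by blast
qed

end

section \<open>Specialising solutions over Laurent series\<close>

lemma coefficient_hom_cub:
  fixes h :: "'a::comm_ring_1 \<Rightarrow> 'b::comm_ring_1"
  assumes "coefficient_hom h"
  shows "h (cub a q x) = cub (\<chi> i j. h (a $ i $ j)) (\<chi> i. h (q $ i)) (\<chi> i. h (x $ i))"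
    "h (pol a q x y) = pol (\<chi> i j. h (a $ i $ j)) (\<chi> i. h (q $ i)) (\<chi> i. h (x $ i)) (\<chi> i. h (y $ i))"
proof -
  interpret coefficient_hom h by fact
  show "h (cub a q x) = cub (\<chi> i j. h (a $ i $ j)) (\<chi> i. h (q $ i)) (\<chi> i. h (x $ i))"
    by (simp add: cub_def sum_4 power2_eq_square h_add h_mult)
  show "h (pol a q x y) = pol (\<chi> i j. h (a $ i $ j)) (\<chi> i. h (q $ i)) (\<chi> i. h (x $ i)) (\<chi> i. h (y $ i))"
    by (simp add: pol_def sum_4 power2_eq_square h_add h_mult)
qed

lemma (in place) place_cub:
  assumes "\<And>i j. a $ i $ j \<in> B" "\<And>i. q $ i \<in> B" "\<And>i. x $ i \<in> B"
  shows "g (cub a q x) = cub (\<chi> i j. g (a $ i $ j)) (\<chi> i. g (q $ i)) (\<chi> i. g (x $ i))"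
  by (simp add: cub_def sum add mult power assms)

lemma coefficient_hom_fps_to_fls: "coefficient_hom (fps_to_fls :: 'k::field fps \<Rightarrow> 'k fls)"
  by standard (simp_all add: fls_times_fps_to_fls)

lemma fls_two: assumes "(2::'k::field) = 0" shows "(2::'k fls) = 0"
proof -
  have "(2::'k fls) = fls_const 2" by (simp only: fls_const_numeral)
  then show ?thesis using assms by simp
qed

lemma dvd_diff_cub:
  fixes c :: "'a::comm_ring_1"
  assumes "\<And>i. c dvd x $ i - x' $ i"
  shows "c dvd cub a q x - cub a q x'"
  unfolding cub_def by (intro dvd_diff_intros assms)

lemma dvd_diff_pol:
  fixes c :: "'a::comm_ring_1"
  assumes "\<And>i. c dvd x $ i - x' $ i" "\<And>i. c dvd y $ i - y' $ i"
  shows "c dvd pol a q x y - pol a q x' y'"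
  unfolding pol_def by (intro dvd_diff_intros assms)

text \<open>The factor \<open>fps_X\<close> gains the order of congruence that makes the iterations
  below contract.\<close>

lemma fps_X_Suc_dvd_mult:
  "fps_X ^ n dvd A - A' \<Longrightarrow> fps_X ^ Suc n dvd c * (fps_X * A) - c * (fps_X * (A' :: 'a::comm_ring_1 fps))"
  by (metis (no_types) dvd_mult mult_dvd_mono dvd_refl power_Suc right_diff_distrib)

text \<open>
  The surface \<open>x\<^sub>1\<^sup>2 x\<^sub>3 + x\<^sub>2\<^sup>2 x\<^sub>4 = 0\<close> contains the line \<open>x\<^sub>3 = x\<^sub>4 = 0\<close>, and the four equations for a
  deformation of this line have the identity as linear part. So the line deforms along the pencil
  from this surface to the given one, and the deformed line is specialised to the given surface.
\<close>

lemma exists_line: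
  fixes a :: "'k::alg_closed_field ^ 4 ^ 4"
  assumes two: "(2::'k) = 0"
  shows "\<exists>u v. indep2 u v \<and> (\<forall>x y. cub a q (x *s u + y *s v) = 0)"
proof -
  define a0 :: "'k ^ 4 ^ 4" where "a0 = (\<chi> i j. if i = 1 \<and> j = 3 \<or> i = 2 \<and> j = 4 then 1 else 0)"
  define c0 :: "'k fps ^ 4 ^ 4" where "c0 = (\<chi> i j. fps_const (a0 $ i $ j))"
  define c :: "'k fps ^ 4 ^ 4" where "c = (\<chi> i j. fps_const (a $ i $ j - a0 $ i $ j))"
  define r :: "'k fps ^ 4" where "r = (\<chi> i. fps_const (q $ i))"
  define A :: "'k fps ^ 4 ^ 4" where "A = (\<chi> i j. c0 $ i $ j + fps_X * c $ i $ j)"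
  define Q :: "'k fps ^ 4" where "Q = (\<chi> i. fps_X * r $ i)"
  \<comment> \<open>A chart of the Grassmannian around the initial line: the deformed line is
    spanned by (1, 0, X 1, X 2) and (0, 1, X 3, X 4).\<close>
  define U :: "(4 \<Rightarrow> 'k fps) \<Rightarrow> 'k fps ^ 4"
    where "U X = (\<chi> i. if i = 1 then 1 else if i = 2 then 0 else if i = 3 then X 1 else X 2)" for X
  define V :: "(4 \<Rightarrow> 'k fps) \<Rightarrow> 'k fps ^ 4"
    where "V X = (\<chi> i. if i = 1 then 0 else if i = 2 then 1 else if i = 3 then X 3 else X 4)" for X
  have cub_A: "cub A Q x = (x $ 1)\<^sup>2 * x $ 3 + (x $ 2)\<^sup>2 * x $ 4 + fps_X * cub c r x" for x
    by (simp add: A_def Q_def c0_def a0_def cub_def sum_4 algebra_simps)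
  have pol_A: "pol A Q x y = (x $ 1)\<^sup>2 * y $ 3 + (x $ 2)\<^sup>2 * y $ 4 + fps_X * pol c r x y" for x y
    by (simp add: A_def Q_def c0_def a0_def pol_def sum_4 algebra_simps)
  \<comment> \<open>In this chart the initial surface contributes exactly X i to the i-th equation,
    in the order chosen here, so that the equations read X i + t*\<Psi> X i = 0.\<close>
  define \<Psi> where "\<Psi> X i = (if i = (1::4) then cub c r (U X) else if i = 2 then pol c r (V X) (U X)
     else if i = 3 then pol c r (U X) (V X) else cub c r (V X))" for X i
  define \<Phi> where "\<Phi> X i = (- 1) * (fps_X * \<Psi> X i)" for X i
  have "fps_X ^ Suc n dvd \<Phi> X i - \<Phi> Y i" if "\<And>j. fps_X ^ n dvd X j - Y j" for n X Y i
  proof -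
    have "fps_X ^ n dvd U X $ j - U Y $ j" "fps_X ^ n dvd V X $ j - V Y $ j" for j
      using that by (auto simp: U_def V_def)
    then have "fps_X ^ n dvd \<Psi> X i - \<Psi> Y i"
      unfolding \<Psi>_def by (auto intro!: dvd_diff_cub dvd_diff_pol)
    then show ?thesis unfolding \<Phi>_def by (rule fps_X_Suc_dvd_mult)
  qed
  then obtain X where "\<Phi> X = X" using fps_contraction_fixpoint by blast
  then have X: "X i + fps_X * \<Psi> X i = 0" for i
  proof -
    have "X i = - (fps_X * \<Psi> X i)"
      using fun_cong[OF \<open>\<Phi> X = X\<close>, of i] by (simp add: \<Phi>_def)
    then show ?thesis by simp
  qed
  have zero: "cub A Q (U X) = 0" "cub A Q (V X) = 0" "pol A Q (U X) (V X) = 0" "pol A Q (V X) (U X) = 0"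
    using X[of 1] X[of 2] X[of 3] X[of 4] by (simp_all add: cub_A pol_A U_def V_def \<Psi>_def)
  define aK qK where "aK = (\<chi> i j. fps_to_fls (A $ i $ j))" and "qK = (\<chi> i. fps_to_fls (Q $ i))"
  define u v where "u = (\<chi> i. fps_to_fls (U X $ i))" and "v = (\<chi> i. fps_to_fls (V X $ i))"
  note hom = coefficient_hom_cub[OF coefficient_hom_fps_to_fls, symmetric]
  have "cub aK qK u = 0" "cub aK qK v = 0" "pol aK qK u v = 0" "pol aK qK v u = 0"
    unfolding aK_def qK_def u_def v_def hom zero by simp_all
  then have van: "cub aK qK (x *s u + y *s v) = 0" for x y
    by (simp add: cub_add[OF fls_two[OF two]] cub_scale pol_scale_left pol_scale_right)
  obtain B :: "'k fls set" and g where "place B g"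
    and const: "\<And>c. fls_const c \<in> B" "\<And>c. g (fls_const c) = c" and t: "fls_X \<in> B" "g fls_X = 1"
    using fls_place_exists by blast
  interpret place B g by fact
  have u1: "u $ 1 = 1" "u $ 2 = 0" "v $ 1 = 0" "v $ 2 = 1"
    by (simp_all add: u_def v_def U_def V_def)
  then have "u \<noteq> 0" by auto
  then obtain i where i: "u $ i \<noteq> 0" "\<And>j. u $ j / u $ i \<in> B" using dominant_component by metis
  define u' where "u' = (1 / u $ i) *s u"
  \<comment> \<open>The i-th component is cleared before scaling to an integral vector; otherwise
    the two reductions could become proportional.\<close>
  define w where "w = v - v $ i *s u'"
  have "w \<noteq> 0"
  proof
    assume w: "w = 0"
    then have "w $ 1 = 0" "w $ 2 = 0" by simp_all
    then show False using u1 i by (simp add: w_def u'_def)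
  qed
  then obtain j where j: "w $ j \<noteq> 0" "\<And>l. w $ l / w $ j \<in> B" using dominant_component by metis
  define v' where "v' = (1 / w $ j) *s w"
  have u'B: "u' $ l \<in> B" and v'B: "v' $ l \<in> B" for l
    using i(2)[of l] j(2)[of l] by (simp_all add: u'_def v'_def)
  define u0 v0 where "u0 = (\<chi> l. g (u' $ l))" and "v0 = (\<chi> l. g (v' $ l))"
  have comp: "u0 $ i = 1" "v0 $ i = 0" "v0 $ j = 1"
  proof -
    have "u' $ i = 1" "v' $ j = 1" using i(1) j(1) by (simp_all add: u'_def v'_def)
    moreover from this have "v' $ i = 0" by (simp add: v'_def w_def)
    ultimately show "u0 $ i = 1" "v0 $ i = 0" "v0 $ j = 1"
      by (simp_all add: u0_def v0_def one place.zero[OF \<open>place B g\<close>])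
  qed
  have "indep2 u0 v0"
    unfolding indep2_def
  proof (intro allI impI)
    fix x y assume *: "x *s u0 + y *s v0 = 0"
    then have "(x *s u0 + y *s v0) $ i = 0" by simp
    then have x: "x = 0" by (simp add: comp)
    from * have "(x *s u0 + y *s v0) $ j = 0" by simp
    with x show "x = 0 \<and> y = 0" by (simp add: comp)
  qed
  moreover have "cub a q (x *s u0 + y *s v0) = 0" for x y
  proof -
    let ?p = "fls_const x *s u' + fls_const y *s v'"
    have "\<exists>x' y'. ?p = x' *s u + y' *s v"
    proof (intro exI)
      show "?p = ((fls_const x - fls_const y * (1 / w $ j) * v $ i) * (1 / u $ i)) *s u + (fls_const y * (1 / w $ j)) *s v"
        by (simp add: u'_def v'_def w_def vec_eq_iff algebra_simps)
    qed
    then have "cub aK qK ?p = 0" using van by metis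
    then have "g (cub aK qK ?p) = 0" by (simp add: zero(2))
    moreover have A: "aK $ l $ m = fls_const (a0 $ l $ m) + fls_X * fls_const (a $ l $ m - a0 $ l $ m)" for l m
      by (simp add: aK_def A_def c0_def c_def fls_times_fps_to_fls fps_to_fls_plus)
    moreover have Q: "qK $ l = fls_X * fls_const (q $ l)" for l
      by (simp add: qK_def Q_def r_def fls_times_fps_to_fls)
    moreover have "?p $ l \<in> B" for l
      by (simp add: add mult const u'B v'B)
    ultimately have "cub (\<chi> i j. g (aK $ i $ j)) (\<chi> i. g (qK $ i)) (\<chi> i. g (?p $ i)) = 0"
      using place_cub[of aK qK ?p] by (simp add: add mult const t)
    moreover have "(\<chi> i j. g (aK $ i $ j)) = a"
      by (simp add: vec_eq_iff A add mult const t)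
    moreover have "(\<chi> i. g (qK $ i)) = q"
      by (simp add: vec_eq_iff Q mult const t)
    moreover have "(\<chi> i. g (?p $ i)) = x *s u0 + y *s v0"
      by (simp add: vec_eq_iff add mult const u'B v'B u0_def v0_def)
    ultimately show ?thesis by simp
  qed
  ultimately show ?thesis by blast
qed

lemma if_one_zero_mult: "(if P then 1 else 0) * x = (if P then x else (0::'a::semiring_1))"
  "x * (if P then 1 else 0) = (if P then x else (0::'a::semiring_1))"
  "(if P then y else 0) * x = (if P then y * x else (0::'a::semiring_1))"
  by simp_all

text \<open>
  The congruence \<open>A\<^sup>(\<^sup>2\<^sup>)\<^sup>T a A = 1\<close>, an instance of Lang's theorem, is solved over power series along the
  pencil from the identity matrix to \<open>a\<close>. The solution can be specialised: its columns \<open>v\<close> satisfy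
  an equation \<open>v\<^sup>(\<^sup>4\<^sup>) = C v\<close> with \<open>C\<close> integral, so they are integral.
\<close>

lemma (in smooth_cubic_form) diagonalise:
  assumes q: "q = 0"
  shows "\<exists>P :: 'k ^ 4 ^ 4. invertible P \<and>
    (\<forall>i j. (\<Sum>k\<in>UNIV. \<Sum>l\<in>UNIV. (P $ k $ i)\<^sup>2 * a $ k $ l * P $ l $ j) = (if i = j then 1 else 0))"
proof -
  define c where "c k l = fps_const (a $ k $ l - (if k = l then 1 else 0))" for k l
  define A where "A k l = (if k = l then 1 else 0) + fps_X * c k l" for k l
  define G :: "(4 \<times> 4 \<Rightarrow> 'k fps) \<Rightarrow> 4 \<Rightarrow> 4 \<Rightarrow> 'k fps"
    where "G Y k l = (if k = l then 1 else 0) + fps_X * Y (k, l)" for Y k l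
  \<comment> \<open>Substituting 1 + t*Y for the unknown matrix and dividing by t gives Y + c +
    t*E(Y) = 0: the twisted factor contributes only t^2 times squares, so to first order
    \<open>Y\<close> enters through the untwisted factor alone.\<close>
  define E where "E Y i j = (\<Sum>l\<in>UNIV. c i l * Y (l, j)) + (\<Sum>k\<in>UNIV. \<Sum>l\<in>UNIV. (Y (k, i))\<^sup>2 * (A k l * G Y l j))"
    for Y i j
  define \<Phi> where "\<Phi> Y p = - c (fst p) (snd p) + (- 1) * (fps_X * E Y (fst p) (snd p))" for Y p
  have two_fps: "(2::'k fps) = 0"
  proof -
    have "(2::'k fps) = fps_const 2" by (simp only: numeral_fps_const)
    then show ?thesis using two by simp
  qed
  have "fps_X ^ Suc n dvd \<Phi> X p - \<Phi> Y p" if *: "\<And>j. fps_X ^ n dvd X j - Y j" for n X Y p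
  proof -
    have "fps_X ^ n dvd E X i j - E Y i j" for i j
      unfolding E_def G_def by (intro dvd_diff_intros *)
    from fps_X_Suc_dvd_mult[OF this] show ?thesis
      unfolding \<Phi>_def by (metis add_diff_cancel_left)
  qed
  then obtain Y where "\<Phi> Y = Y" using fps_contraction_fixpoint by blast
  then have Y: "Y (i, j) + c i j + fps_X * E Y i j = 0" for i j
  proof -
    have "Y (i, j) = - c i j - fps_X * E Y i j"
      using fun_cong[OF \<open>\<Phi> Y = Y\<close>, of "(i, j)"] by (simp add: \<Phi>_def)
    then show ?thesis by simp
  qed
  have G2: "(G Y k i)\<^sup>2 = (if k = i then 1 else 0) + fps_X\<^sup>2 * (Y (k, i))\<^sup>2" for k i
    by (simp add: G_def two_power2_add[OF two_fps] power_mult_distrib)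
  have delta: "(\<Sum>k\<in>UNIV. \<Sum>l\<in>UNIV. if k = i then F k l else 0) = (\<Sum>l\<in>UNIV. F i l)"
    for i :: 4 and F :: "4 \<Rightarrow> 4 \<Rightarrow> 'k fps"
    by (subst sum.swap) simp
  have eq: "(\<Sum>k\<in>UNIV. \<Sum>l\<in>UNIV. (G Y k i)\<^sup>2 * A k l * G Y l j) = (if i = j then 1 else 0)" for i j
  proof -
    have "(\<Sum>k\<in>UNIV. \<Sum>l\<in>UNIV. (G Y k i)\<^sup>2 * A k l * G Y l j)
      = (\<Sum>l\<in>UNIV. A i l * G Y l j) + fps_X\<^sup>2 * (\<Sum>k\<in>UNIV. \<Sum>l\<in>UNIV. (Y (k, i))\<^sup>2 * (A k l * G Y l j))"
      unfolding G2 distrib_right sum.distrib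
      by (simp add: mult.assoc if_one_zero_mult delta flip: sum_distrib_left)
    also have "(\<Sum>l\<in>UNIV. A i l * G Y l j) = G Y i j + fps_X * (\<Sum>l\<in>UNIV. c i l * G Y l j)"
      unfolding A_def distrib_right sum.distrib
      by (simp add: mult.assoc if_one_zero_mult flip: sum_distrib_left)
    also have "(\<Sum>l\<in>UNIV. c i l * G Y l j) = c i j + fps_X * (\<Sum>l\<in>UNIV. c i l * Y (l, j))"
      unfolding G_def distrib_left sum.distrib
      by (simp add: mult.left_commute if_one_zero_mult flip: sum_distrib_left)
    also have "G Y i j + fps_X * (c i j + fps_X * (\<Sum>l\<in>UNIV. c i l * Y (l, j)))
        + fps_X\<^sup>2 * (\<Sum>k\<in>UNIV. \<Sum>l\<in>UNIV. (Y (k, i))\<^sup>2 * (A k l * G Y l j))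
      = (if i = j then 1 else 0) + fps_X * (Y (i, j) + c i j + fps_X * E Y i j)"
      by (simp add: G_def[of Y i j] E_def power2_eq_square algebra_simps)
    finally show ?thesis by (simp add: Y)
  qed
  define aK where "aK k l = fps_to_fls (A k l)" for k l
  define H where "H k l = fps_to_fls (G Y k l)" for k l
  interpret h: coefficient_hom "fps_to_fls :: 'k fps \<Rightarrow> 'k fls" by (rule coefficient_hom_fps_to_fls)
  have eqK: "(\<Sum>k\<in>UNIV. \<Sum>l\<in>UNIV. (H k i)\<^sup>2 * aK k l * H l j) = (if i = j then 1 else 0)" for i j
  proof -
    have "(\<Sum>k\<in>UNIV. \<Sum>l\<in>UNIV. (H k i)\<^sup>2 * aK k l * H l j)
      = fps_to_fls (\<Sum>k\<in>UNIV. \<Sum>l\<in>UNIV. (G Y k i)\<^sup>2 * A k l * G Y l j)"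
      by (simp add: sum_4 H_def aK_def power2_eq_square h.h_add h.h_mult)
    then show ?thesis by (simp add: eq)
  qed
  note twoK = fls_two[OF two]
  have square_sum: "(\<Sum>i\<in>S. F i)\<^sup>2 = (\<Sum>i\<in>S. (F i)\<^sup>2)" for S :: "4 set" and F :: "4 \<Rightarrow> 'k fls"
    by (induction S rule: infinite_finite_induct) (simp_all add: two_power2_add[OF twoK])
  have square_sum': "(\<Sum>i\<in>S. F i)\<^sup>2 = (\<Sum>i\<in>S. (F i)\<^sup>2)" for S :: "4 set" and F :: "4 \<Rightarrow> 'k"
    by (induction S rule: infinite_finite_induct) (simp_all add: two_power2_add[OF two])
  \<comment> \<open>The equation says M ** W = 1. Squaring the entries of its transpose gives M ** Z
    = 1, hence Z = W, which is the equation of the columns.\<close>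
  define M W Z where "M = (\<chi> i k. (H k i)\<^sup>2)" and "W = (\<chi> k j. \<Sum>l\<in>UNIV. aK k l * H l j)"
    and "Z = (\<chi> l j. \<Sum>k\<in>UNIV. (aK k l)\<^sup>2 * (H k j) ^ 4)"
  have MW: "M ** W = mat 1"
    using eqK by (simp add: M_def W_def matrix_matrix_mult_def mat_def vec_eq_iff sum_distrib_left mult.assoc)
  have MZ: "M ** Z = mat 1"
  proof -
    have "(M ** Z) $ i $ j = (if i = j then 1 else 0)" for i j
    proof -
      have "(M ** Z) $ i $ j = (\<Sum>l\<in>UNIV. \<Sum>k\<in>UNIV. ((H k j)\<^sup>2 * aK k l * H l i)\<^sup>2)"
        by (simp add: M_def Z_def matrix_matrix_mult_def sum_distrib_left power_mult_distrib mult_ac flip: power_mult)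
      also have "\<dots> = (\<Sum>k\<in>UNIV. \<Sum>l\<in>UNIV. (H k j)\<^sup>2 * aK k l * H l i)\<^sup>2"
        unfolding square_sum by (rule sum.swap)
      finally show ?thesis by (simp add: eqK)
    qed
    then show ?thesis by (simp add: vec_eq_iff mat_def)
  qed
  have "W ** M = mat 1" using MW matrix_left_right_inverse by blast
  then have "Z = W"
    using MW MZ by (metis matrix_mul_assoc matrix_mul_lid matrix_mul_rid)
  then have col: "(\<Sum>k\<in>UNIV. (aK k l)\<^sup>2 * (H k j) ^ 4) = (\<Sum>k\<in>UNIV. aK l k * H k j)" for l j
    by (simp add: Z_def W_def vec_eq_iff)
  obtain B :: "'k fls set" and g where "place B g"
    and const: "\<And>c. fls_const c \<in> B" "\<And>c. g (fls_const c) = c" and t: "fls_X \<in> B" "g fls_X = 1"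
    using fls_place_exists by blast
  interpret place B g by fact
  have aK': "aK k l = fls_const (if k = l then 1 else 0) + fls_X * fls_const (a $ k $ l - (if k = l then 1 else 0))" for k l
    by (simp add: aK_def A_def c_def fls_times_fps_to_fls fps_to_fls_plus)
  have aKB: "aK k l \<in> B" "g (aK k l) = a $ k $ l" for k l
    unfolding aK' by (simp_all add: add mult const t)
  have HB: "H k j \<in> B" for k j
  proof -
    let ?v = "\<chi> k. H k j"
    have "?v \<noteq> 0"
    proof
      assume "?v = 0"
      then have "H l j = 0" for l by (simp add: vec_eq_iff)
      then show False using eqK[of j j] by simp
    qed
    then obtain i where i: "?v $ i \<noteq> 0" "\<And>k. ?v $ k / ?v $ i \<in> B" using dominant_component by metis
    have "H i j \<in> B"
    proof (rule ccontr)
      assume n: "H i j \<notin> B"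
      define r where "r = 1 / H i j"
      have r: "r \<in> B" "g r = 0" using total[OF n] by (simp_all add: r_def)
      have yB: "H k j * r \<in> B" for k using i(2)[of k] by (simp add: r_def)
      define y where "y = (\<chi> k. g (H k j * r))"
      have "H i j * r = 1" using i(1) by (simp add: r_def)
      then have "y $ i = 1" using one by (simp add: y_def)
      then have "y \<noteq> 0" by auto
      then obtain w where w: "pol a q y w \<noteq> 0" using nondegenerate by blast
      \<comment> \<open>The column equation has degree four on the left and one on the right, so
        scaling by \<open>r\<close> leaves a factor r^3 on the right, which reduces to zero. The
        left side reduces to the square of this sum, a component of the gradient at
        \<open>y\<close>.\<close>
      have "(\<Sum>k\<in>UNIV. a $ k $ l * (y $ k)\<^sup>2) = 0" for l
      proof -
        have "(\<Sum>k\<in>UNIV. (aK k l)\<^sup>2 * (H k j * r) ^ 4) = r ^ 4 * (\<Sum>k\<in>UNIV. (aK k l)\<^sup>2 * (H k j) ^ 4)"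
          by (simp add: sum_distrib_left power_mult_distrib mult_ac)
        also have "\<dots> = r ^ 3 * (\<Sum>k\<in>UNIV. aK l k * (H k j * r))"
          unfolding col by (simp add: sum_distrib_left eval_nat_numeral mult_ac)
        finally have "g (\<Sum>k\<in>UNIV. (aK k l)\<^sup>2 * (H k j * r) ^ 4) = g (r ^ 3 * (\<Sum>k\<in>UNIV. aK l k * (H k j * r)))"
          by simp
        then have "(\<Sum>k\<in>UNIV. (a $ k $ l)\<^sup>2 * (y $ k) ^ 4) = 0"
          by (simp add: sum mult power aKB yB r y_def del: power_mult_distrib)
        also have "(\<Sum>k\<in>UNIV. (a $ k $ l)\<^sup>2 * (y $ k) ^ 4) = (\<Sum>k\<in>UNIV. a $ k $ l * (y $ k)\<^sup>2)\<^sup>2"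
          unfolding square_sum' by (simp add: power_mult_distrib flip: power_mult)
        finally show ?thesis by simp
      qed
      then have "(\<Sum>l\<in>UNIV. (\<Sum>k\<in>UNIV. a $ k $ l * (y $ k)\<^sup>2) * w $ l) = 0" by simp
      then have "(\<Sum>l\<in>UNIV. \<Sum>k\<in>UNIV. a $ k $ l * (y $ k)\<^sup>2 * w $ l) = 0"
        by (simp add: sum_distrib_right)
      then have "(\<Sum>k\<in>UNIV. \<Sum>l\<in>UNIV. a $ k $ l * (y $ k)\<^sup>2 * w $ l) = 0"
        by (subst sum.swap)
      with w q show False by (simp add: pol_def)
    qed
    then have "H k j / H i j * H i j \<in> B" using i(2)[of k] by (intro mult) simp_all
    then show ?thesis using i(1) by simp
  qed
  define P where "P = (\<chi> k l. g (H k l))"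
  have eqP: "(\<Sum>k\<in>UNIV. \<Sum>l\<in>UNIV. (P $ k $ i)\<^sup>2 * a $ k $ l * P $ l $ j) = (if i = j then 1 else 0)" for i j
  proof -
    have "g (\<Sum>k\<in>UNIV. \<Sum>l\<in>UNIV. (H k i)\<^sup>2 * aK k l * H l j) = (\<Sum>k\<in>UNIV. \<Sum>l\<in>UNIV. (P $ k $ i)\<^sup>2 * a $ k $ l * P $ l $ j)"
      by (simp add: sum mult power aKB HB P_def)
    then show ?thesis by (cases "i = j") (simp_all add: eqK one zero)
  qed
  have "(\<chi> i l. \<Sum>k\<in>UNIV. (P $ k $ i)\<^sup>2 * a $ k $ l) ** P = mat 1"
  proof -
    have "(\<Sum>l\<in>UNIV. \<Sum>k\<in>UNIV. (P $ k $ i)\<^sup>2 * a $ k $ l * P $ l $ j) = (if i = j then 1 else 0)" for i j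
      by (subst sum.swap) (rule eqP)
    then show ?thesis
      by (simp add: matrix_matrix_mult_def vec_eq_iff mat_def sum_distrib_right)
  qed
  then have "invertible P" using invertible_left_inverse by blast
  with eqP show ?thesis by blast
qed

section \<open>Triangles and projective equivalence\<close>

lemma smooth_cubic_surface_form:
  fixes F :: "'k::alg_closed_field poly4"
  assumes "(2::'k) = 0" "smooth_cubic_surface F"
  shows "smooth_cubic_form (square_coeffs F) (squarefree_coeffs F)"
  by standard (use assms smooth_cubic_pol_nonzero in blast)+

lemma span_in_lines_on:
  assumes "indep2 u v" "\<And>x y. eval4 F (x *s u + y *s v) = 0"
  shows "vec.span {u, v} \<in> lines_on F"
  using assms dim_indep2[OF assms(1)] by (auto simp: lines_on_def span2)

lemma not_triangle_free:
  fixes F :: "'k::alg_closed_field poly4"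
  assumes two: "(2::'k) = 0" and F: "smooth_cubic_surface F" and q: "squarefree_coeffs F \<noteq> 0"
  shows "\<not> triangle_free F"
proof
  assume tf: "triangle_free F"
  interpret smooth_cubic_form "square_coeffs F" "squarefree_coeffs F"
    using smooth_cubic_surface_form[OF two F] .
  have ev: "eval4 F v = f v" for v
    using F by (simp add: eval4_cubic smooth_cubic_surface_def)
  obtain u v where uv: "indep2 u v" "\<And>x y. f (x *s u + y *s v) = 0"
    using exists_line[OF two] by metis
  from lineI[OF uv(2)] uv(1) q obtain p r s where tr: "triangle p r s"
    using triangle_exists by blast
  then have ind: "indep3 p r s" "indep3 r s p" "indep3 s p r"
    using indep3_rotate unfolding triangle_def by blast+
  let ?L = "{vec.span {p, r}, vec.span {r, s}, vec.span {s, p}}"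
  have "vec.span {p, r} \<in> lines_on F" "vec.span {r, s} \<in> lines_on F" "vec.span {s, p} \<in> lines_on F"
    using tr ind by (auto simp: triangle_def ev intro!: span_in_lines_on line_vanish indep3_indep2)
  moreover have "L \<subseteq> vec.span {p, r, s}" if "L \<in> ?L" for L
    using that vec.span_mono[of "{p, r}" "{p, r, s}"] vec.span_mono[of "{r, s}" "{p, r, s}"]
      vec.span_mono[of "{s, p}" "{p, r, s}"] by auto
  moreover have "vec.subspace (vec.span {p, r, s})" "vec.dim (vec.span {p, r, s}) = 3"
    using dim_indep3[OF ind(1)] by auto
  ultimately have "\<exists>v. v \<noteq> 0 \<and> (\<forall>L\<in>?L. v \<in> L)"
    using tf[unfolded triangle_free_def, rule_format, of "vec.span {p, r, s}" ?L] by auto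
  then obtain v where v: "v \<noteq> 0" "v \<in> vec.span {p, r}" "v \<in> vec.span {r, s}" "v \<in> vec.span {s, p}"
    by auto
  obtain x y where 1: "v = x *s p + y *s r" using v by (auto simp: span2)
  obtain x' y' where 2: "v = x' *s r + y' *s s" using v by (auto simp: span2)
  obtain x'' y'' where 3: "v = x'' *s s + y'' *s p" using v by (auto simp: span2)
  have "x *s p + (y - x') *s r + (- y') *s s = 0"
    using 1 2 by (simp add: algebra_simps)
  then have "x = 0" using ind(1) unfolding indep3_def by blast
  moreover have "(x - y'') *s p + y *s r + (- x'') *s s = 0"
    using 1 3 by (simp add: algebra_simps)
  then have "y = 0" using ind(1) unfolding indep3_def by blast
  ultimately show False using 1 v(1) by simp
qed

lemma dim_2_nonzero: "vec.dim L = 2 \<Longrightarrow> \<exists>v\<in>L. v \<noteq> (0::'k::field^4)"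
  by (metis One_nat_def Suc_1 vec.dim_eq_0 nat.distinct(1) insertCI subsetI)

lemma lines_in_plane_meet:
  fixes H :: "('k::field ^ 4) set"
  assumes "vec.subspace H" "vec.dim H = 3" "vec.subspace L" "vec.dim L = 2" "L \<subseteq> H"
    "vec.subspace M" "vec.dim M = 2" "M \<subseteq> H"
  shows "\<exists>v. v \<noteq> 0 \<and> v \<in> L \<and> v \<in> M"
proof -
  have "vec.dim {x + y |x y. x \<in> L \<and> y \<in> M} + vec.dim (L \<inter> M) = vec.dim L + vec.dim M"
    by (rule vec.dim_sums_Int) (use assms in auto)
  moreover have "vec.dim {x + y |x y. x \<in> L \<and> y \<in> M} \<le> vec.dim H"
    by (rule vec.dim_subset) (use assms in \<open>auto intro: vec.subspace_add\<close>)
  ultimately have "vec.dim (L \<inter> M) \<noteq> 0" using assms by linarith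
  then show ?thesis by (auto simp: vec.dim_eq_0)
qed

lemma line_eq_span:
  fixes L :: "('k::field ^ 4) set"
  assumes "vec.subspace L" "vec.dim L = 2" "indep2 u v" "u \<in> L" "v \<in> L"
  shows "L = vec.span {u, v}"
  using assms dim_indep2[OF assms(3)]
  by (metis insert_subset empty_subsetI order_refl vec.span_minimal vec.subspace_dim_equal vec.subspace_span)

lemma not_indep2:
  fixes u v :: "'k::field ^ 4"
  assumes "\<not> indep2 u v" "v \<noteq> 0"
  shows "\<exists>c. u = c *s v"
proof -
  obtain x y where xy: "x *s u + y *s v = 0" "x \<noteq> 0 \<or> y \<noteq> 0" using assms(1) by (auto simp: indep2_def)
  have "x \<noteq> 0"
  proof
    assume "x = 0"
    with xy assms(2) show False by simp
  qed
  then have "u = (- (1 / x)) *s (y *s v)"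
    using vec_eq_scale_sum[of "y *s v" x u] xy(1) by (simp add: add.commute)
  then show ?thesis by (intro exI[of _ "- (1 / x) * y"]) simp
qed

text \<open>Coplanar lines meet pairwise, so a family without a common point contains two distinct
  lines, meeting at \<open>p\<close> say, and a third that misses \<open>p\<close>. These three form
  a triangle.\<close>

lemma triangle_free_squarefree_0:
  fixes F :: "'k::alg_closed_field poly4"
  assumes two: "(2::'k) = 0" and F: "smooth_cubic_surface F" and q: "squarefree_coeffs F = 0"
  shows "triangle_free F"
proof (rule ccontr)
  interpret smooth_cubic_form "square_coeffs F" "squarefree_coeffs F"
    using smooth_cubic_surface_form[OF two F] .
  have ev: "eval4 F v = f v" for v
    using F by (simp add: eval4_cubic smooth_cubic_surface_def)
  assume "\<not> triangle_free F"
  then obtain H \<L> where HL: "vec.subspace H \<and> vec.dim H = 3 \<and> \<L> \<subseteq> lines_on F \<and> (\<forall>L\<in>\<L>. L \<subseteq> H)"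
    and none: "\<not> (\<exists>v. v \<noteq> 0 \<and> (\<forall>L\<in>\<L>. v \<in> L))"
    unfolding triangle_free_def not_all not_imp by (elim exE conjE[of _ "\<not> _"])
  from HL have H: "vec.subspace H" "vec.dim H = 3" and L: "\<L> \<subseteq> lines_on F" "\<And>L. L \<in> \<L> \<Longrightarrow> L \<subseteq> H"
    by auto
  from none have no: "\<exists>L\<in>\<L>. v \<notin> L" if "v \<noteq> 0" for v
    using that by auto
  have sub: "vec.subspace L" "vec.dim L = 2" "\<And>v. v \<in> L \<Longrightarrow> f v = 0" if "L \<in> \<L>" for L
    using that L(1) ev by (auto simp: lines_on_def)
  have meet: "\<exists>v. v \<noteq> 0 \<and> v \<in> L \<and> v \<in> M" if "L \<in> \<L>" "M \<in> \<L>" for L M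
    using lines_in_plane_meet[OF H] sub[OF that(1)] sub[OF that(2)] L(2)[OF that(1)] L(2)[OF that(2)] by blast
  \<comment> \<open>Any nonzero vector will do; this only shows that the family is nonempty.\<close>
  obtain L1 where L1: "L1 \<in> \<L>" using no[of "axis 1 1"] by auto
  obtain v1 where v1: "v1 \<in> L1" "v1 \<noteq> 0" using dim_2_nonzero sub(2)[OF L1] by blast
  obtain L2 where L2: "L2 \<in> \<L>" "v1 \<notin> L2" using no v1 by blast
  obtain p where p: "p \<noteq> 0" "p \<in> L1" "p \<in> L2" using meet[OF L1 L2(1)] by blast
  obtain L3 where L3: "L3 \<in> \<L>" "p \<notin> L3" using no p by blast
  obtain r where r: "r \<noteq> 0" "r \<in> L3" "r \<in> L1" using meet[OF L3(1) L1] by blast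
  obtain s where s: "s \<noteq> 0" "s \<in> L3" "s \<in> L2" using meet[OF L3(1) L2(1)] by blast
  have scale: "c *s x \<in> L" if "x \<in> L" "L \<in> \<L>" for c x L
    using vec.subspace_scale[OF sub(1)[OF that(2)] that(1)] .
  have comb: "c *s x + d *s y \<in> L" if "x \<in> L" "y \<in> L" "L \<in> \<L>" for c d x y L
    using vec.subspace_add[OF sub(1)[OF that(3)] scale scale] that by blast
  have pr: "indep2 p r" using not_indep2[of p r] scale L3 r by metis
  have "r \<notin> L2"
  proof
    assume "r \<in> L2"
    then have "L1 = L2"
      using line_eq_span[OF sub(1,2)[OF L1] pr] line_eq_span[OF sub(1,2)[OF L2(1)] pr] p r by simp
    with v1 L2 show False by simp
  qed
  then have rs: "indep2 r s" using not_indep2[of r s] scale L2 s by metis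
  have "indep3 p r s"
    unfolding indep3_def
  proof (intro allI impI)
    fix x y z assume *: "x *s p + y *s r + z *s s = 0"
    have "x = 0"
    proof (rule ccontr)
      assume "x \<noteq> 0"
      have "(y *s r + z *s s) + x *s p = 0" using * by (simp add: ac_simps)
      then have "p = (- (1 / x)) *s (y *s r + z *s s)"
        using \<open>x \<noteq> 0\<close> by (rule vec_eq_scale_sum)
      then show False using L3 scale[OF comb[OF r(2) s(2) L3(1)] L3(1)] by metis
    qed
    with * rs show "x = 0 \<and> y = 0 \<and> z = 0" by (simp add: indep2_def)
  qed
  moreover have "line p r" "line r s" "line s p"
    using comb p r s L1 L2 L3 sub(3) by (auto intro!: lineI)
  ultimately have "triangle p r s" by (simp add: triangle_def)
  then show False using no_triangle[OF q] by blast
qed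

section \<open>Projective equivalence with the Fermat cubic\<close>

lemma eval4_subst4:
  fixes F :: "'k::field poly4"
  shows "eval4 (subst4 Const x F) v = subst4 (\<lambda>c. c) (\<lambda>i. eval4 (x i) v) F"
proof -
  interpret C: coefficient_hom "Const :: 'k \<Rightarrow> 'k poly4" by (rule coefficient_hom_Const)
  interpret I: coefficient_hom "\<lambda>c::'k. c" by (rule coefficient_hom_id)
  show ?thesis
  proof (induction F rule: poly_mapping_single_induct)
    case (single m c)
    have prod: "eval4 (\<Prod>i\<in>A. g i) v = (\<Prod>i\<in>A. eval4 (g i) v)" for g :: "4 \<Rightarrow> 'k poly4" and A
      by (induction A rule: infinite_finite_induct) (simp_all add: eval4_def I.subst4_mult)
    show ?case
      by (simp add: C.subst4_single I.subst4_single prod)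
        (simp add: eval4_def I.subst4_mult I.subst4_power prod[unfolded eval4_def])
  qed (simp_all add: eval4_def C.subst4_add I.subst4_add)
qed

lemma sum_rotate: "(\<Sum>k\<in>A. \<Sum>l\<in>B. \<Sum>i\<in>C. T k l i) = (\<Sum>i\<in>C. \<Sum>k\<in>A. \<Sum>l\<in>B. T k l i)"
proof -
  have "(\<Sum>k\<in>A. \<Sum>l\<in>B. \<Sum>i\<in>C. T k l i) = (\<Sum>k\<in>A. \<Sum>i\<in>C. \<Sum>l\<in>B. T k l i)"
    by (intro sum.cong refl sum.swap)
  also have "\<dots> = (\<Sum>i\<in>C. \<Sum>k\<in>A. \<Sum>l\<in>B. T k l i)"
    by (rule sum.swap)
  finally show ?thesis .
qed

lemma sum_swap_pairs:
  "(\<Sum>k\<in>A. \<Sum>l\<in>B. \<Sum>i\<in>C. \<Sum>j\<in>D. T k l i j) = (\<Sum>i\<in>C. \<Sum>j\<in>D. \<Sum>k\<in>A. \<Sum>l\<in>B. T k l i j)"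
proof -
  have "(\<Sum>k\<in>A. \<Sum>l\<in>B. \<Sum>i\<in>C. \<Sum>j\<in>D. T k l i j) = (\<Sum>i\<in>C. \<Sum>k\<in>A. \<Sum>l\<in>B. \<Sum>j\<in>D. T k l i j)"
    by (rule sum_rotate)
  also have "\<dots> = (\<Sum>i\<in>C. \<Sum>j\<in>D. \<Sum>k\<in>A. \<Sum>l\<in>B. T k l i j)"
  proof (rule sum.cong[OF refl])
    fix i
    show "(\<Sum>k\<in>A. \<Sum>l\<in>B. \<Sum>j\<in>D. T k l i j) = (\<Sum>j\<in>D. \<Sum>k\<in>A. \<Sum>l\<in>B. T k l i j)"
      by (rule sum_rotate)
  qed
  finally show ?thesis .
qed

lemma projectively_equivalent_fermat_cubic:
  fixes F :: "'k::alg_closed_field poly4"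
  assumes two: "(2::'k) = 0" and F: "smooth_cubic_surface F" and q: "squarefree_coeffs F = 0"
  shows "projectively_equivalent F fermat_cubic"
proof -
  interpret smooth_cubic_form "square_coeffs F" "squarefree_coeffs F"
    using smooth_cubic_surface_form[OF two F] .
  let ?a = "square_coeffs F"
  obtain P :: "'k ^ 4 ^ 4" where P: "invertible P"
    "\<forall>i j. (\<Sum>k\<in>UNIV. \<Sum>l\<in>UNIV. (P $ k $ i)\<^sup>2 * ?a $ k $ l * P $ l $ j) = (if i = j then 1 else 0)"
    using diagonalise[OF q] by (elim exE conjE)
  interpret C: coefficient_hom "Const :: 'k \<Rightarrow> 'k poly4" by (rule coefficient_hom_Const)
  have two': "(2 :: 'k poly4) = 0"
    using C.h_add[of 1 1] two by (simp add: C.h_0 C.h_1)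
  have square_sum: "(\<Sum>i\<in>S. g i)\<^sup>2 = (\<Sum>i\<in>S. (g i)\<^sup>2)" for S :: "4 set" and g :: "4 \<Rightarrow> 'k poly4"
    by (induction S rule: infinite_finite_induct) (simp_all add: two_power2_add[OF two'])
  have Csum: "Const (\<Sum>i\<in>S. g i) = (\<Sum>i\<in>S. Const (g i))" for S :: "4 set" and g :: "4 \<Rightarrow> 'k"
    by (induction S rule: infinite_finite_induct) (simp_all add: C.h_0 C.h_add)
  have Csq: "(Const c)\<^sup>2 = Const (c\<^sup>2)" for c :: 'k
    by (simp add: power2_eq_square C.h_mult)
  let ?x = "\<lambda>i. \<Sum>j\<in>UNIV. Const (P $ i $ j) * Var j :: 'k poly4"
  have "subst4 Const ?x F = (\<Sum>k\<in>UNIV. \<Sum>l\<in>UNIV. Const (?a $ k $ l) * (?x k)\<^sup>2 * ?x l)"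
    using C.subst4_cubic[of F ?x] F by (simp add: smooth_cubic_surface_def q C.h_0)
  also have "\<dots> = (\<Sum>k\<in>UNIV. \<Sum>l\<in>UNIV. \<Sum>i\<in>UNIV. \<Sum>j\<in>UNIV.
      Const ((P $ k $ i)\<^sup>2 * ?a $ k $ l * P $ l $ j) * ((Var i)\<^sup>2 * Var j))"
    unfolding square_sum
    by (simp add: sum_product sum_distrib_left power_mult_distrib Csq C.h_mult mult_ac)
  also have "\<dots> = (\<Sum>i\<in>UNIV. \<Sum>j\<in>UNIV. \<Sum>k\<in>UNIV. \<Sum>l\<in>UNIV.
      Const ((P $ k $ i)\<^sup>2 * ?a $ k $ l * P $ l $ j) * ((Var i)\<^sup>2 * Var j))"
    by (rule sum_swap_pairs)
  also have "\<dots> = (\<Sum>i\<in>UNIV. \<Sum>j\<in>UNIV. Const (if i = j then 1 else 0) * ((Var i)\<^sup>2 * Var j))"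
    by (simp only: P(2)[rule_format, symmetric] Csum sum_distrib_right)
  also have "\<dots> = fermat_cubic"
  proof -
    have "Const (if i = j then 1 else 0) * X = (if i = j then X else 0)" for i j :: 4 and X :: "'k poly4"
      by (simp add: C.h_0 C.h_1)
    then show ?thesis
      by (simp add: fermat_cubic_def power2_eq_square power3_eq_cube mult.assoc)
  qed
  finally show ?thesis
    unfolding projectively_equivalent_def using P(1) by (intro exI[of _ P] exI[of _ 1]) (simp add: C.h_1)
qed

text \<open>Full polarisation is compatible with linear substitution. For \<open>F\<close> it yields
  the trilinear form of the squarefree coefficients, while for a sum of cubes every term has a
  factor 6 and vanishes.\<close>

lemma squarefree_coeffs_fermat_equivalent:
  fixes F :: "'k::alg_closed_field poly4"
  assumes two: "(2::'k) = 0" and F: "homogeneous 3 F" and eq: "projectively_equivalent F fermat_cubic"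
  shows "squarefree_coeffs F = 0"
proof -
  interpret I: coefficient_hom "\<lambda>c::'k. c" by (rule coefficient_hom_id)
  obtain P :: "'k ^ 4 ^ 4" and c where P: "invertible P"
    and sub: "subst4 Const (\<lambda>i. \<Sum>j\<in>UNIV. Const (P $ i $ j) * Var j) F = Const c * fermat_cubic"
    using eq unfolding projectively_equivalent_def by blast
  let ?f = "cub (square_coeffs F) (squarefree_coeffs F)"
  have eval: "?f (P *v v) = c * (\<Sum>i\<in>UNIV. (v $ i) ^ 3)" for v
  proof -
    have "eval4 (subst4 Const (\<lambda>i. \<Sum>j\<in>UNIV. Const (P $ i $ j) * Var j) F) v = eval4 F (P *v v)"
      unfolding eval4_subst4
      by (simp add: eval4_def I.subst4_sum I.subst4_mult matrix_vector_mult_def)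
    moreover have "eval4 (Const c * fermat_cubic) v = c * (\<Sum>i\<in>UNIV. (v $ i) ^ 3)"
      by (simp add: eval4_def fermat_cubic_def I.subst4_mult I.subst4_sum I.subst4_power)
    ultimately show ?thesis using sub eval4_cubic[OF F] by simp
  qed
  have cancel: "(x::'k) + x = 0" "x + (x + y) = y" for x y
    using two_add_self[OF two] by (simp_all flip: add.assoc)
  have polar: "?f (x + y + z) + ?f (x + y) + ?f (x + z) + ?f (y + z) + ?f x + ?f y + ?f z
      = tri (squarefree_coeffs F) x y z" for x y z
  proof -
    have "tri q x z y = tri q x y z" "tri q y z x = tri q x y z" "tri q y x z = tri q x y z"
      "tri q z x y = tri q x y z" "tri q z y x = tri q x y z" for q
      using tri_swap by metis+
    then show ?thesis
      by (simp add: cub_add[OF two] pol_add_left[OF two] pol_add_right cancel ac_simps)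
  qed
  have cube: "(x + y + z) ^ 3 + (x + y) ^ 3 + (x + z) ^ 3 + (y + z) ^ 3 + x ^ 3 + y ^ 3 + z ^ 3 = 0" for x y z :: 'k
  proof -
    have "(x + y + z) ^ 3 + (x + y) ^ 3 + (x + z) ^ 3 + (y + z) ^ 3 + x ^ 3 + y ^ 3 + z ^ 3
      = 2 * (2 * (x ^ 3 + y ^ 3 + z ^ 3) + 3 * (x\<^sup>2 * y + x\<^sup>2 * z + y\<^sup>2 * x + y\<^sup>2 * z + z\<^sup>2 * x + z\<^sup>2 * y) + 3 * x * y * z)"
      by (simp add: power3_eq_cube power2_eq_square algebra_simps)
    then show ?thesis by (simp add: two)
  qed
  have "tri (squarefree_coeffs F) (P *v x) (P *v y) (P *v z) = 0" for x y z
  proof -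
    have "tri (squarefree_coeffs F) (P *v x) (P *v y) (P *v z)
      = c * (\<Sum>i\<in>UNIV. (x $ i + y $ i + z $ i) ^ 3 + (x $ i + y $ i) ^ 3 + (x $ i + z $ i) ^ 3 + (y $ i + z $ i) ^ 3
          + (x $ i) ^ 3 + (y $ i) ^ 3 + (z $ i) ^ 3)"
      unfolding polar[symmetric] matrix_vector_right_distrib[symmetric] eval
      by (simp add: sum.distrib distrib_left)
    then show ?thesis by (simp only: cube sum.neutral_const mult_zero_right)
  qed
  moreover have "\<exists>v. P *v v = w" for w
  proof -
    obtain P' where "P ** P' = mat 1" using P by (auto simp: invertible_def)
    then show ?thesis by (metis matrix_vector_mul_assoc matrix_vector_mul_lid)
  qed
  ultimately have "tri (squarefree_coeffs F) x y z = 0" for x y z by metis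
  then show ?thesis by (rule tri_eq_0D)
qed

section \<open>Local rings and sections\<close>

context
  fixes P :: "'k::field poly4 set"
  assumes P: "homogeneous_prime P"
begin

lemma prime_0: "0 \<in> P" and prime_1: "1 \<notin> P"
  and prime_mult: "g \<in> P \<Longrightarrow> f * g \<in> P"
  and prime_multD: "f * g \<in> P \<Longrightarrow> f \<in> P \<or> g \<in> P"
  using P unfolding homogeneous_prime_def by blast+

lemma prime_mult_iff: "f * g \<in> P \<longleftrightarrow> f \<in> P \<or> g \<in> P"
  using prime_mult prime_multD by (metis mult.commute)

lemma prime_power_not_in: "f \<notin> P \<Longrightarrow> f ^ n \<notin> P"
  by (induction n) (auto simp: prime_mult_iff prime_1)

definition frac_eq :: "'k poly4 \<Rightarrow> 'k poly4 \<Rightarrow> 'k poly4 \<Rightarrow> 'k poly4 \<Rightarrow> 'k poly4 \<Rightarrow> bool" where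
  "frac_eq F a b a' b' \<longleftrightarrow> (\<exists>s d. homogeneous d s \<and> s \<notin> P \<and> F dvd s * (a * b' - a' * b))"

lemma frac_eqI: "F dvd a * b' - a' * b \<Longrightarrow> frac_eq F a b a' b'"
  unfolding frac_eq_def using homogeneous_1 prime_1 by (metis mult_1)

lemma frac_eq_sym: "frac_eq F a b a' b' \<Longrightarrow> frac_eq F a' b' a b"
  unfolding frac_eq_def by (metis dvd_minus_iff minus_diff_eq mult_minus_right)

lemma frac_eq_trans:
  assumes "frac_eq F a b a' b'" "frac_eq F a' b' a'' b''" "is_fraction P a' b'"
  shows "frac_eq F a b a'' b''"
proof -
  obtain s d where s: "homogeneous d s" "s \<notin> P" "F dvd s * (a * b' - a' * b)"
    using assms(1) by (auto simp: frac_eq_def)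
  obtain t e where t: "homogeneous e t" "t \<notin> P" "F dvd t * (a' * b'' - a'' * b')"
    using assms(2) by (auto simp: frac_eq_def)
  obtain n where b': "homogeneous n b'" "b' \<notin> P"
    using assms(3) by (auto simp: is_fraction_def)
  have "F dvd t * b'' * (s * (a * b' - a' * b)) + s * b * (t * (a' * b'' - a'' * b'))"
    by (intro dvd_add dvd_mult[OF s(3)] dvd_mult[OF t(3)])
  also have "\<dots> = s * t * b' * (a * b'' - a'' * b)"
    by (simp add: algebra_simps)
  finally show ?thesis
    unfolding frac_eq_def using s t b'
    by (intro exI[of _ "s * t * b'"] exI[of _ "d + e + n"]) (auto simp: prime_mult_iff intro: homogeneous_mult)
qed

lemma fraction_alt: "fraction F P a b = {(a', b'). is_fraction P a' b' \<and> frac_eq F a b a' b'}"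
  by (simp add: fraction_def frac_eq_def)

lemma fraction_self: "is_fraction P a b \<Longrightarrow> (a, b) \<in> fraction F P a b"
  by (simp add: fraction_alt frac_eqI)

lemma fraction_eq_iff:
  assumes "is_fraction P a b" "is_fraction P a' b'"
  shows "fraction F P a b = fraction F P a' b' \<longleftrightarrow> frac_eq F a b a' b'"
proof
  assume "fraction F P a b = fraction F P a' b'"
  then have "(a', b') \<in> fraction F P a b" using fraction_self[OF assms(2)] by simp
  then show "frac_eq F a b a' b'" by (simp add: fraction_alt)
next
  assume eq: "frac_eq F a b a' b'"
  show "fraction F P a b = fraction F P a' b'"
    unfolding fraction_alt
    using frac_eq_trans[OF eq _ assms(2)] frac_eq_trans[OF frac_eq_sym[OF eq] _ assms(1)] by blast
qed

lemma is_fraction_mult: "is_fraction P a b \<Longrightarrow> is_fraction P c d \<Longrightarrow> is_fraction P (a * c) (b * d)"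
  unfolding is_fraction_def using homogeneous_mult prime_multD by blast

lemma is_fraction_add: "is_fraction P a b \<Longrightarrow> is_fraction P c d \<Longrightarrow> is_fraction P (a * d + c * b) (b * d)"
proof -
  assume "is_fraction P a b" "is_fraction P c d"
  then obtain m n where "homogeneous m a" "homogeneous m b" "b \<notin> P" "homogeneous n c" "homogeneous n d" "d \<notin> P"
    by (auto simp: is_fraction_def)
  then have "homogeneous (m + n) (a * d + b * c)" "homogeneous (m + n) (b * d)" "b * d \<notin> P"
    by (auto simp: prime_mult_iff intro!: homogeneous_add homogeneous_mult)
  then show ?thesis
    unfolding is_fraction_def by (metis mult.commute)
qed

text \<open>The operations on germs are unions over all representatives; once the result is
  independent of the representatives, such a union is its common value because a class is
  nonempty.\<close>

lemma UN_fraction2: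
  assumes ab: "is_fraction P a b" and cd: "is_fraction P c d"
    and eq: "\<And>a' b' c' d'. is_fraction P a' b' \<Longrightarrow> is_fraction P c' d' \<Longrightarrow> frac_eq F a b a' b' \<Longrightarrow> frac_eq F c d c' d' \<Longrightarrow>
      T a' b' c' d' = Z"
  shows "(\<Union>(a', b')\<in>fraction F P a b. \<Union>(c', d')\<in>fraction F P c d. T a' b' c' d') = Z"
proof -
  have "(\<Union>(c', d')\<in>fraction F P c d. T a' b' c' d') = Z" if "(a', b') \<in> fraction F P a b" for a' b'
    using fraction_self[OF cd, of F] eq that by (force simp: fraction_alt)
  then show ?thesis
    using fraction_self[OF ab, of F] by force
qed

lemma germ_mult_fraction:
  assumes ab: "is_fraction P a b" and cd: "is_fraction P c d"
  shows "germ_mult F P (fraction F P a b) (fraction F P c d) = fraction F P (a * c) (b * d)"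
  unfolding germ_mult_def
proof (rule UN_fraction2[OF ab cd])
  fix a' b' c' d'
  assume f: "is_fraction P a' b'" "is_fraction P c' d'" and e: "frac_eq F a b a' b'" "frac_eq F c d c' d'"
  obtain s m where s: "homogeneous m s" "s \<notin> P" "F dvd s * (a * b' - a' * b)"
    using e(1) by (auto simp: frac_eq_def)
  obtain t n where t: "homogeneous n t" "t \<notin> P" "F dvd t * (c * d' - c' * d)"
    using e(2) by (auto simp: frac_eq_def)
  have "F dvd t * c * d' * (s * (a * b' - a' * b)) + s * a' * b * (t * (c * d' - c' * d))"
    by (intro dvd_add dvd_mult[OF s(3)] dvd_mult[OF t(3)])
  also have "\<dots> = s * t * (a * c * (b' * d') - a' * c' * (b * d))"
    by (simp add: algebra_simps)
  finally have "frac_eq F (a * c) (b * d) (a' * c') (b' * d')"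
    unfolding frac_eq_def using s t
    by (intro exI[of _ "s * t"] exI[of _ "m + n"]) (auto simp: prime_mult_iff intro: homogeneous_mult)
  then show "fraction F P (a' * c') (b' * d') = fraction F P (a * c) (b * d)"
    using fraction_eq_iff[OF is_fraction_mult[OF ab cd] is_fraction_mult[OF f], where F = F] by simp
qed

lemma germ_add_fraction:
  assumes ab: "is_fraction P a b" and cd: "is_fraction P c d"
  shows "germ_add F P (fraction F P a b) (fraction F P c d) = fraction F P (a * d + c * b) (b * d)"
  unfolding germ_add_def
proof (rule UN_fraction2[OF ab cd])
  fix a' b' c' d'
  assume f: "is_fraction P a' b'" "is_fraction P c' d'" and e: "frac_eq F a b a' b'" "frac_eq F c d c' d'"
  obtain s m where s: "homogeneous m s" "s \<notin> P" "F dvd s * (a * b' - a' * b)"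
    using e(1) by (auto simp: frac_eq_def)
  obtain t n where t: "homogeneous n t" "t \<notin> P" "F dvd t * (c * d' - c' * d)"
    using e(2) by (auto simp: frac_eq_def)
  have "F dvd t * d * d' * (s * (a * b' - a' * b)) + s * b * b' * (t * (c * d' - c' * d))"
    by (intro dvd_add dvd_mult[OF s(3)] dvd_mult[OF t(3)])
  also have "\<dots> = s * t * ((a * d + c * b) * (b' * d') - (a' * d' + c' * b') * (b * d))"
    by (simp add: algebra_simps)
  finally have "frac_eq F (a * d + c * b) (b * d) (a' * d' + c' * b') (b' * d')"
    unfolding frac_eq_def using s t
    by (intro exI[of _ "s * t"] exI[of _ "m + n"]) (auto simp: prime_mult_iff intro: homogeneous_mult)
  then show "fraction F P (a' * d' + c' * b') (b' * d') = fraction F P (a * d + c * b) (b * d)"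
    using fraction_eq_iff[OF is_fraction_add[OF ab cd] is_fraction_add[OF f], where F = F] by simp
qed

lemma is_fraction_1: "is_fraction P 1 1"
  using homogeneous_1 prime_1 by (auto simp: is_fraction_def)

text \<open>The square of a germ in the shape to which \<open>[^]\<close> unfolds, whose recursion
  starts at one.\<close>

lemma germ_square_fraction:
  assumes "is_fraction P a b"
  shows "germ_mult F P (germ_mult F P (fraction F P 1 1) (fraction F P a b)) (fraction F P a b)
    = fraction F P (a * a) (b * b)"
  using germ_mult_fraction[OF is_fraction_1 assms] germ_mult_fraction[OF assms assms] by simp

end

section \<open>Sections and the ring operations of the structure sheaf\<close>

lemma openin_proj_points: "openin (proj_topology F) U \<Longrightarrow> P \<in> U \<Longrightarrow> homogeneous_prime P \<and> P \<in> proj_points F"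
  by (auto simp: openin_proj_topology proj_open_def proj_points_def)

lemma section_germ:
  assumes "s \<in> sections F U" "P \<in> U"
  obtains a b where "is_fraction P a b" "s P = fraction F P a b"
proof -
  obtain V a b where "P \<in> V" "\<forall>Q\<in>V. is_fraction Q a b \<and> s Q = fraction F Q a b"
    using assms unfolding sections_def by blast
  with that show thesis by blast
qed

lemma sections_extensionalD: "s \<in> sections F U \<Longrightarrow> s \<in> extensional U"
  by (simp add: sections_def)

lemma structure_sheaf_simps:
  "carrier (structure_sheaf F U) = sections F U"
  "s \<otimes>\<^bsub>structure_sheaf F U\<^esub> t = (\<lambda>P\<in>U. germ_mult F P (s P) (t P))"
  "s \<oplus>\<^bsub>structure_sheaf F U\<^esub> t = (\<lambda>P\<in>U. germ_add F P (s P) (t P))"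
  "\<one>\<^bsub>structure_sheaf F U\<^esub> = (\<lambda>P\<in>U. fraction F P 1 1)"
  by (simp_all add: structure_sheaf_def)

lemma structure_sheaf_square:
  "s [^]\<^bsub>structure_sheaf F U\<^esub> (2::nat)
    = (\<lambda>P\<in>U. germ_mult F P (germ_mult F P (fraction F P 1 1) (s P)) (s P))"
  by (rule ext) (simp add: nat_pow_def numeral_2_eq_2 structure_sheaf_simps restrict_def)

section \<open>Splitting from a trace operator\<close>

text \<open>A splitting of the polynomial ring that preserves the ideal of \<open>F\<close> and
  halves degrees, so that it descends to fractions of degree zero on the surface.\<close>

locale splitting_operator =
  fixes F :: "'k::field poly4" and \<theta> :: "'k poly4 \<Rightarrow> 'k poly4"
  assumes add: "\<theta> (f + g) = \<theta> f + \<theta> g"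
    and semilinear: "\<theta> (s\<^sup>2 * g) = s * \<theta> g"
    and one: "\<theta> 1 = 1"
    and dvd: "F dvd g \<Longrightarrow> F dvd \<theta> g"
    and degree: "homogeneous (d + d) g \<Longrightarrow> homogeneous d (\<theta> g)"
begin

lemma diff: "\<theta> (f - g) = \<theta> f - \<theta> g"
  using add[of "f - g" g] by simp

text \<open>The fraction a / b equals a*b / b^2, and a splitting takes the square b^2 out as
  b.\<close>

definition germ_map :: "'k poly4 set \<Rightarrow> 'k germ \<Rightarrow> 'k germ" where
  "germ_map P z = (\<Union>(a, b)\<in>z. fraction F P (\<theta> (a * b)) b)"

lemma is_fraction_theta: "is_fraction P a b \<Longrightarrow> is_fraction P (\<theta> (a * b)) b"
  unfolding is_fraction_def using homogeneous_mult degree by blast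

lemma germ_map_fraction:
  assumes P: "homogeneous_prime P" and ab: "is_fraction P a b"
  shows "germ_map P (fraction F P a b) = fraction F P (\<theta> (a * b)) b"
proof -
  have "fraction F P (\<theta> (a' * b')) b' = fraction F P (\<theta> (a * b)) b"
    if "(a', b') \<in> fraction F P a b" for a' b'
  proof -
    have f: "is_fraction P a' b'" and e: "frac_eq P F a b a' b'"
      using that by (auto simp: fraction_alt[OF P])
    obtain s m where s: "homogeneous m s" "s \<notin> P" "F dvd s * (a * b' - a' * b)"
      using e by (auto simp: frac_eq_def[OF P])
    \<comment> \<open>This multiplier turns both terms into squares times a*b and a'*b', so that
      \<open>semilinear\<close> applies to each.\<close>
    have "F dvd s * b * b' * (s * (a * b' - a' * b))"
      using s(3) by (rule dvd_mult)
    also have "\<dots> = (s * b')\<^sup>2 * (a * b) - (s * b)\<^sup>2 * (a' * b')"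
      by (simp add: algebra_simps power2_eq_square)
    finally have "F dvd \<theta> ((s * b')\<^sup>2 * (a * b) - (s * b)\<^sup>2 * (a' * b'))"
      by (rule dvd)
    also have "\<dots> = s * (\<theta> (a * b) * b' - \<theta> (a' * b') * b)"
      unfolding diff semilinear by (simp add: algebra_simps)
    finally have "frac_eq P F (\<theta> (a * b)) b (\<theta> (a' * b')) b'"
      unfolding frac_eq_def[OF P] using s by blast
    then show ?thesis
      using fraction_eq_iff[OF P is_fraction_theta[OF ab] is_fraction_theta[OF f], where F = F] by simp
  qed
  then show ?thesis
    unfolding germ_map_def by (intro UN_constant_eq[OF fraction_self[OF P ab]]) auto
qed

definition section_map :: "'k poly4 set set \<Rightarrow> 'k sect \<Rightarrow> 'k sect" where
  "section_map U s = (\<lambda>P\<in>U. germ_map P (s P))"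

lemma section_map_sections:
  assumes U: "openin (proj_topology F) U" and s: "s \<in> sections F U"
  shows "section_map U s \<in> sections F U"
  unfolding sections_def
proof (intro CollectI conjI ballI)
  show "section_map U s \<in> extensional U" by (simp add: section_map_def)
  fix P assume "P \<in> U"
  then obtain V a b where V: "openin (proj_topology F) V" "P \<in> V" "V \<subseteq> U"
    "\<forall>Q\<in>V. is_fraction Q a b \<and> s Q = fraction F Q a b"
    using s unfolding sections_def by blast
  have "is_fraction Q (\<theta> (a * b)) b \<and> section_map U s Q = fraction F Q (\<theta> (a * b)) b" if "Q \<in> V" for Q
    using V that openin_proj_points[OF V(1) that] germ_map_fraction is_fraction_theta
    by (auto simp: section_map_def)
  then show "\<exists>V a b. openin (proj_topology F) V \<and> P \<in> V \<and> V \<subseteq> U \<and>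
      (\<forall>Q\<in>V. is_fraction Q a b \<and> section_map U s Q = fraction F Q a b)"
    using V by blast
qed

lemma germ_map_add:
  assumes P: "homogeneous_prime P" and ab: "is_fraction P a b" and cd: "is_fraction P c d"
  shows "germ_map P (germ_add F P (fraction F P a b) (fraction F P c d))
    = germ_add F P (germ_map P (fraction F P a b)) (germ_map P (fraction F P c d))"
proof -
  have "\<theta> ((a * d + c * b) * (b * d)) = \<theta> (d\<^sup>2 * (a * b) + b\<^sup>2 * (c * d))"
    by (simp add: algebra_simps power2_eq_square)
  also have "\<dots> = \<theta> (a * b) * d + \<theta> (c * d) * b"
    unfolding add semilinear by (simp add: mult.commute)
  finally show ?thesis
    by (simp add: germ_add_fraction[OF P] germ_map_fraction[OF P] is_fraction_theta ab cd is_fraction_add[OF P])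
qed

lemma germ_map_square_mult:
  assumes P: "homogeneous_prime P" and ab: "is_fraction P a b" and cd: "is_fraction P c d"
  shows "germ_map P (germ_mult F P (germ_mult F P (germ_mult F P (fraction F P 1 1) (fraction F P a b)) (fraction F P a b))
      (fraction F P c d))
    = germ_mult F P (fraction F P a b) (germ_map P (fraction F P c d))"
proof -
  note sq = is_fraction_mult[OF P ab ab]
  have "\<theta> (a * a * c * (b * b * d)) = \<theta> ((a * b)\<^sup>2 * (c * d))"
    by (simp add: algebra_simps power2_eq_square)
  also have "\<dots> = a * b * \<theta> (c * d)"
    by (simp add: semilinear)
  finally have *: "\<theta> (a * a * c * (b * b * d)) = a * b * \<theta> (c * d)" .
  have "fraction F P (a * b * \<theta> (c * d)) (b * b * d) = fraction F P (a * \<theta> (c * d)) (b * d)"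
    using is_fraction_theta[OF is_fraction_mult[OF P sq cd]]
    by (subst fraction_eq_iff[OF P _ is_fraction_mult[OF P ab is_fraction_theta[OF cd]]])
      (auto simp: * intro!: frac_eqI[OF P])
  then show ?thesis
    by (simp add: germ_square_fraction[OF P ab] germ_mult_fraction[OF P] germ_map_fraction[OF P]
        is_fraction_theta sq ab cd is_fraction_mult[OF P] *)
qed

lemma germ_map_square:
  assumes P: "homogeneous_prime P" and ab: "is_fraction P a b"
  shows "germ_map P (germ_mult F P (germ_mult F P (fraction F P 1 1) (fraction F P a b)) (fraction F P a b))
    = fraction F P a b"
proof -
  note sq = is_fraction_mult[OF P ab ab]
  have "\<theta> (a * a * (b * b)) = \<theta> ((a * b)\<^sup>2 * 1)"
    by (simp add: algebra_simps power2_eq_square)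
  then have *: "\<theta> (a * a * (b * b)) = a * b"
    by (simp only: semilinear one) simp
  have "fraction F P (a * b) (b * b) = fraction F P a b"
    using is_fraction_theta[OF sq]
    by (subst fraction_eq_iff[OF P _ ab]) (auto simp: * intro!: frac_eqI[OF P])
  then show ?thesis
    by (simp add: germ_square_fraction[OF P ab] germ_map_fraction[OF P] sq *)
qed

lemma frobenius_split_surface:
  assumes char: "CHAR('k) = 2"
  shows "frobenius_split_surface F"
  unfolding frobenius_split_surface_def frobenius_split_def char
proof (intro exI[of _ section_map] conjI allI impI ballI)
  fix U assume U: "openin (proj_topology F) U"
  have P: "homogeneous_prime P" if "P \<in> U" for P
    using openin_proj_points[OF U that] by simp
  show "section_map U \<in> carrier (structure_sheaf F U) \<rightarrow> carrier (structure_sheaf F U)"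
    using section_map_sections[OF U] by (simp add: structure_sheaf_simps)
  fix s assume s: "s \<in> carrier (structure_sheaf F U)"
  show "section_map U (s [^]\<^bsub>structure_sheaf F U\<^esub> (2::nat)) = s"
  proof (rule extensionalityI)
    show "s \<in> extensional U" using s by (auto simp: structure_sheaf_simps dest: sections_extensionalD)
    fix Q assume Q: "Q \<in> U"
    then obtain a b where "is_fraction Q a b" "s Q = fraction F Q a b"
      using s section_germ unfolding structure_sheaf_simps by metis
    then show "section_map U (s [^]\<^bsub>structure_sheaf F U\<^esub> (2::nat)) Q = s Q"
      using Q germ_map_square[OF P[OF Q]] by (simp add: structure_sheaf_square section_map_def)
  qed (simp add: section_map_def)
  fix t assume t: "t \<in> carrier (structure_sheaf F U)"
  have germs: "germ_map Q (germ_add F Q (s Q) (t Q)) = germ_add F Q (germ_map Q (s Q)) (germ_map Q (t Q))"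
      "germ_map Q (germ_mult F Q (germ_mult F Q (germ_mult F Q (fraction F Q 1 1) (s Q)) (s Q)) (t Q))
        = germ_mult F Q (s Q) (germ_map Q (t Q))" if Q: "Q \<in> U" for Q
  proof -
    obtain a b where ab: "is_fraction Q a b" "s Q = fraction F Q a b"
      using s Q section_germ unfolding structure_sheaf_simps by metis
    obtain c d where cd: "is_fraction Q c d" "t Q = fraction F Q c d"
      using t Q section_germ unfolding structure_sheaf_simps by metis
    show "germ_map Q (germ_add F Q (s Q) (t Q)) = germ_add F Q (germ_map Q (s Q)) (germ_map Q (t Q))"
      "germ_map Q (germ_mult F Q (germ_mult F Q (germ_mult F Q (fraction F Q 1 1) (s Q)) (s Q)) (t Q))
        = germ_mult F Q (s Q) (germ_map Q (t Q))"
      using germ_map_add[OF P[OF Q] ab(1) cd(1)] germ_map_square_mult[OF P[OF Q] ab(1) cd(1)] ab cd by simp_all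
  qed
  show "section_map U (s \<oplus>\<^bsub>structure_sheaf F U\<^esub> t) = section_map U s \<oplus>\<^bsub>structure_sheaf F U\<^esub> section_map U t"
    "section_map U (s [^]\<^bsub>structure_sheaf F U\<^esub> (2::nat) \<otimes>\<^bsub>structure_sheaf F U\<^esub> t) = s \<otimes>\<^bsub>structure_sheaf F U\<^esub> section_map U t"
    unfolding structure_sheaf_simps structure_sheaf_square
    by (auto simp: section_map_def germs fun_eq_iff)
next
  fix U V :: "'k poly4 set set" and s :: "'k sect" assume "V \<subseteq> U"
  then show "section_map V (restrict s V) = restrict (section_map U s) V"
    by (auto simp: section_map_def fun_eq_iff restrict_def)
qed

end

subsection \<open>The trace of the polynomial ring\<close>

definition sqrt2 :: "'k::alg_closed_field \<Rightarrow> 'k" where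
  "sqrt2 c = (SOME y. y\<^sup>2 = c)"

lemma sqrt2_power: "(sqrt2 c)\<^sup>2 = c"
  unfolding sqrt2_def by (rule someI_ex) (use nth_root_exists[of 2 c] in simp)

definition half :: "(4 \<Rightarrow>\<^sub>0 nat) \<Rightarrow> 4 \<Rightarrow>\<^sub>0 nat" where
  "half m = Poly_Mapping.map (\<lambda>n. n div 2) m"

lemma lookup_half: "Poly_Mapping.lookup (half m) i = Poly_Mapping.lookup m i div 2"
  by (simp add: half_def Poly_Mapping.map.rep_eq when_def)

text \<open>Sends \<open>c x\<^bsup>2m+(1,1,1,1)\<^esup>\<close> to \<open>c\<^bsup>1/2\<^esup> x\<^bsup>m\<^esup>\<close>; it generates \<open>Hom(F\<^sub>*S, S)\<close>.\<close>

definition trace :: "'k::alg_closed_field poly4 \<Rightarrow> 'k poly4" where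
  "trace f = additive_ext (\<lambda>m c. if \<forall>i. odd (Poly_Mapping.lookup m i) then Poly_Mapping.single (half m) (sqrt2 c) else 0) f"

context
  assumes two: "(2::'k::alg_closed_field) = 0"
begin

lemma sqrt2_unique: "y\<^sup>2 = c \<Longrightarrow> sqrt2 c = (y::'k)"
proof -
  assume "y\<^sup>2 = c"
  then have "(sqrt2 c + y)\<^sup>2 = 0"
    by (simp add: two_power2_add[OF two] sqrt2_power two_add_self[OF two])
  then have "sqrt2 c + y = 0" by simp
  then have "sqrt2 c + y = y + y" by (simp add: two_add_self[OF two])
  then show ?thesis by simp
qed

lemma sqrt2_simps: "sqrt2 0 = (0::'k)" "sqrt2 (a + b) = sqrt2 a + (sqrt2 b::'k)" "sqrt2 (c\<^sup>2 * a) = c * (sqrt2 a::'k)"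
  by (rule sqrt2_unique, simp add: two_power2_add[OF two] sqrt2_power power_mult_distrib)+

lemma trace_add: "trace (f + g) = trace f + trace (g :: 'k poly4)"
  unfolding trace_def by (rule additive_ext_add) (auto simp: sqrt2_simps single_add)

lemma trace_single:
  "trace (Poly_Mapping.single m (c::'k)) =
     (if \<forall>i. odd (Poly_Mapping.lookup m i) then Poly_Mapping.single (half m) (sqrt2 c) else 0)"
  unfolding trace_def by (rule additive_ext_single) (auto simp: sqrt2_simps)

lemma trace_0 [simp]: "trace (0 :: 'k poly4) = 0"
  by (simp add: trace_def)

lemma two_poly4: "(2 :: 'k poly4) = 0"
proof -
  interpret C: coefficient_hom "Const :: 'k \<Rightarrow> 'k poly4" by (rule coefficient_hom_Const)
  show ?thesis using C.h_add[of 1 1] two by (simp add: C.h_0 C.h_1)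
qed

lemma trace_semilinear: "trace (s\<^sup>2 * g) = s * trace (g :: 'k poly4)"
proof (induction s rule: poly_mapping_single_induct)
  case (single m c)
  show ?case
  proof (induction g rule: poly_mapping_single_induct)
    case (single n d)
    have "half (m + m + n) = m + half n"
      by (rule poly_mapping_eqI) (simp add: lookup_half lookup_add)
    then show ?case
      by (simp add: power2_eq_square mult_single trace_single lookup_add mult.assoc)
        (simp add: sqrt2_simps flip: power2_eq_square mult.assoc add.assoc)
  qed (simp_all add: trace_add distrib_left)
qed (simp_all add: two_power2_add[OF two_poly4] trace_add distrib_right)

text \<open>The number 4 is the degree of the product of the variables, which is removed before
  halving.\<close>

lemma homogeneous_trace:
  assumes "homogeneous (d + d + 4) (f :: 'k poly4)"
  shows "homogeneous d (trace f)"
  unfolding trace_def additive_ext_def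
proof (rule homogeneous_sum)
  fix m assume "m \<in> Poly_Mapping.keys f"
  then have m: "mdegree m = d + d + 4" using assms by (simp add: homogeneous_def)
  show "homogeneous d (if \<forall>i. odd (Poly_Mapping.lookup m i)
    then Poly_Mapping.single (half m) (sqrt2 (Poly_Mapping.lookup f m)) else 0)"
  proof (cases "\<forall>i. odd (Poly_Mapping.lookup m i)")
    case True
    then have "Poly_Mapping.lookup m i = 2 * Poly_Mapping.lookup (half m) i + 1" for i
      by (simp add: lookup_half)
    then have "mdegree m = (\<Sum>i\<in>UNIV. 2 * Poly_Mapping.lookup (half m) i + 1)"
      unfolding mdegree_def by (intro sum.cong refl)
    then have "mdegree m = 2 * mdegree (half m) + 4"
      unfolding mdegree_def by (simp only: sum.distrib sum_distrib_left[symmetric]) simp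
    with m True show ?thesis by (auto intro: homogeneous_single)
  next
    case False
    then show ?thesis by (subst if_not_P) auto
  qed
qed

text \<open>Only monomials with all exponents odd survive. In degree four this is just the product
  of the variables, which comes from the squarefree monomial that lacks
  \<open>Var i\<close>.\<close>

lemma trace_cubic_Var:
  assumes "homogeneous 3 (F :: 'k poly4)"
  shows "trace (F * Var i) = Const (sqrt2 (squarefree_coeffs F $ i))"
proof -
  have sum: "trace (\<Sum>j\<in>A. g j) = (\<Sum>j\<in>A. trace (g j))" for g :: "4 \<Rightarrow> 'k poly4" and A
    by (induction A rule: infinite_finite_induct) (simp_all add: trace_add)
  have sq: "trace (Poly_Mapping.single (square_monomial j l) c * Var i) = 0" for j l and c :: 'k
  proof -
    have "card {j, l, i} < card (UNIV :: 4 set)"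
      using card_length[of "[j, l, i]"] by simp
    then obtain k where "k \<notin> {j, l, i}" by (metis UNIV_eq_I order_less_irrefl)
    then have "Poly_Mapping.lookup (square_monomial j l + Poly_Mapping.single i 1) k = 0"
      by (auto simp: lookup_add lookup_square_monomial lookup_single when_def)
    then show ?thesis
      by (auto simp: Var_def mult_single trace_single dest: spec[of _ k])
  qed
  have sf: "trace (Poly_Mapping.single (squarefree_monomial j) c * Var i) = (if j = i then Const (sqrt2 c) else 0)"
    for j and c :: 'k
  proof (cases "j = i")
    case True
    have "half (squarefree_monomial i + Poly_Mapping.single i 1) = 0"
      by (rule poly_mapping_eqI) (auto simp: lookup_half lookup_add lookup_squarefree_monomial lookup_single when_def)
    then show ?thesis
      using True by (auto simp: Var_def Const_def mult_single trace_single lookup_add lookup_squarefree_monomial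
          lookup_single when_def)
  next
    case False
    then have "Poly_Mapping.lookup (squarefree_monomial j + Poly_Mapping.single i 1) j = 0"
      by (simp add: lookup_add lookup_squarefree_monomial lookup_single when_def)
    then show ?thesis
      using False by (auto simp: Var_def mult_single trace_single dest: spec[of _ j])
  qed
  show ?thesis
    by (subst homogeneous_3_sum_singles[OF assms])
      (simp add: distrib_right sum_distrib_right trace_add sum sq sf)
qed

lemma splitting_operator_exists:
  assumes F: "homogeneous 3 (F :: 'k poly4)" and q: "squarefree_coeffs F \<noteq> 0"
  shows "\<exists>\<theta>. splitting_operator F \<theta>"
proof -
  obtain i where i: "squarefree_coeffs F $ i \<noteq> 0" using q by (auto simp: vec_eq_iff)
  define c where "c = sqrt2 (squarefree_coeffs F $ i)"
  have c: "c \<noteq> 0" using i sqrt2_power[of "squarefree_coeffs F $ i"] by (auto simp: c_def)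
  interpret C: coefficient_hom "Const :: 'k \<Rightarrow> 'k poly4" by (rule coefficient_hom_Const)
  \<comment> \<open>By \<open>trace_cubic_Var\<close> the factor 1/c makes the value at 1 equal to
    1.\<close>
  define \<theta> where "\<theta> g = Const (1 / c) * trace (F * Var i * g)" for g
  have "splitting_operator F \<theta>"
  proof
    fix f g s :: "'k poly4" and d
    show "\<theta> (f + g) = \<theta> f + \<theta> g"
      by (simp add: \<theta>_def distrib_left trace_add)
    have *: "F * Var i * (s\<^sup>2 * g) = s\<^sup>2 * (F * Var i * g)" by (simp add: ac_simps)
    show "\<theta> (s\<^sup>2 * g) = s * \<theta> g"
      unfolding \<theta>_def * trace_semilinear by (simp only: mult.left_commute)
    show "\<theta> 1 = 1"
      using c by (simp add: \<theta>_def trace_cubic_Var[OF F] flip: c_def C.h_mult) (simp add: C.h_1)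
    show "F dvd \<theta> g" if dvd: "F dvd g"
    proof -
      obtain k where "g = F * k" using dvd by (rule dvdE)
      \<comment> \<open>The factor \<open>F\<close> built into \<theta> completes the one in
        \<open>g\<close> to a square, which the trace takes out as \<open>F\<close>.\<close>
      then have *: "F * Var i * g = F\<^sup>2 * (Var i * k)" by (simp add: power2_eq_square ac_simps)
      show ?thesis unfolding \<theta>_def * trace_semilinear by simp
    qed
    show "homogeneous d (\<theta> g)" if "homogeneous (d + d) g"
    proof -
      have "homogeneous (3 + 1 + (d + d)) (F * Var i * g)"
        by (intro homogeneous_mult F homogeneous_Var that)
      then have "homogeneous (d + d + 4) (F * Var i * g)" by (simp add: ac_simps)
      then show ?thesis unfolding \<theta>_def by (intro homogeneous_Const_mult homogeneous_trace)
    qed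
  qed
  then show ?thesis by blast
qed

end

section \<open>Homogeneous primes and sections over basic open sets\<close>

definition hom_ideal :: "'k::field poly4 set \<Rightarrow> bool" where
  "hom_ideal I \<longleftrightarrow> 0 \<in> I \<and> (\<forall>f\<in>I. \<forall>g\<in>I. f + g \<in> I) \<and> (\<forall>f. \<forall>g\<in>I. f * g \<in> I)
     \<and> (\<forall>f\<in>I. \<forall>d. hom_component d f \<in> I)"

lemma hom_idealD:
  assumes "hom_ideal I"
  shows "0 \<in> I" "f \<in> I \<Longrightarrow> g \<in> I \<Longrightarrow> f + g \<in> I" "g \<in> I \<Longrightarrow> f * g \<in> I" "f \<in> I \<Longrightarrow> hom_component d f \<in> I"
  using assms unfolding hom_ideal_def by blast+

lemma hom_ideal_sum: "hom_ideal I \<Longrightarrow> (\<And>i. i \<in> A \<Longrightarrow> f i \<in> I) \<Longrightarrow> (\<Sum>i\<in>A. f i) \<in> I"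
  by (induction A rule: infinite_finite_induct) (auto intro: hom_idealD)

lemma homogeneous_prime_hom_ideal: "homogeneous_prime P \<Longrightarrow> hom_ideal P"
  unfolding homogeneous_prime_def hom_ideal_def by blast

lemma hom_ideal_adjoin:
  fixes f :: "'k::field poly4"
  assumes I: "hom_ideal I" and f: "homogeneous e f"
  shows "hom_ideal {m + c * f | m c. m \<in> I}"
  unfolding hom_ideal_def
proof (intro conjI ballI allI)
  have "(0::'k poly4) = 0 + 0 * f" by simp
  then show "0 \<in> {m + c * f | m c. m \<in> I}" using hom_idealD(1)[OF I] by blast
  fix g assume "g \<in> {m + c * f | m c. m \<in> I}"
  then obtain m c where g: "g = m + c * f" "m \<in> I" by blast
  show "hom_component d g \<in> {m + c * f | m c. m \<in> I}" for d
  proof -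
    have "hom_component d g = hom_component d m + (if e \<le> d then hom_component (d - e) c else 0) * f"
      by (simp add: g hom_component_add hom_component_mult_homogeneous[OF f])
    then show ?thesis using hom_idealD(4)[OF I g(2)] by blast
  qed
  show "h * g \<in> {m + c * f | m c. m \<in> I}" for h
  proof -
    have "h * g = h * m + (h * c) * f" by (simp add: g algebra_simps)
    then show ?thesis using hom_idealD(3)[OF I g(2)] by blast
  qed
  fix h assume "h \<in> {m + c * f | m c. m \<in> I}"
  then obtain n d where h: "h = n + d * f" "n \<in> I" by blast
  have "g + h = (m + n) + (c + d) * f" by (simp add: g h algebra_simps)
  then show "g + h \<in> {m + c * f | m c. m \<in> I}" using hom_idealD(2)[OF I g(2) h(2)] by blast
qed

text \<open>A homogeneous ideal maximal among those missing all powers of \<open>x\<close> is prime.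
  Adjoining a homogeneous element keeps an ideal homogeneous, so primeness is first proved for such
  elements. For general f and g, the product of their highest components outside the ideal is,
  modulo the ideal, a component of f*g.\<close>

lemma exists_homogeneous_prime:
  fixes x :: "'k::field poly4"
  assumes I: "hom_ideal I" and pow: "\<And>n. x ^ n \<notin> I"
  shows "\<exists>P. homogeneous_prime P \<and> I \<subseteq> P \<and> x \<notin> P"
proof -
  let ?A = "{J. hom_ideal J \<and> I \<subseteq> J \<and> (\<forall>n. x ^ n \<notin> J)}"
  have "\<exists>M\<in>?A. \<forall>X\<in>?A. M \<subseteq> X \<longrightarrow> X = M"
  proof (rule subset_Zorn_nonempty)
    show "?A \<noteq> {}" using assms by auto
  next
    fix C assume C: "C \<noteq> {}" "subset.chain ?A C"
    have C': "hom_ideal J" "I \<subseteq> J" "x ^ n \<notin> J" if "J \<in> C" for J n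
      using that C(2) unfolding subset.chain_def by blast+
    have "hom_ideal (\<Union>C)"
      unfolding hom_ideal_def
    proof (intro conjI ballI allI)
      show "0 \<in> \<Union>C" using C(1) C'(1) hom_idealD(1) by blast
      fix f assume "f \<in> \<Union>C"
      then obtain J where J: "J \<in> C" "f \<in> J" by blast
      show "h * f \<in> \<Union>C" "hom_component d f \<in> \<Union>C" for h d
        using J hom_idealD(3,4)[OF C'(1)[OF J(1)] J(2)] by blast+
      fix g assume "g \<in> \<Union>C"
      then obtain K where K: "K \<in> C" "g \<in> K" by blast
      have "J \<subseteq> K \<or> K \<subseteq> J" using J K C(2) unfolding subset.chain_def by blast
      then obtain L where "L \<in> C" "f \<in> L" "g \<in> L" using J K by blast
      then show "f + g \<in> \<Union>C" using hom_idealD(2)[OF C'(1)] by blast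
    qed
    then show "\<Union>C \<in> ?A" using C(1) C' by blast
  qed
  then obtain M where M: "hom_ideal M" "I \<subseteq> M" "\<And>n. x ^ n \<notin> M"
    and max: "\<And>X. hom_ideal X \<Longrightarrow> I \<subseteq> X \<Longrightarrow> \<forall>n. x ^ n \<notin> X \<Longrightarrow> M \<subseteq> X \<Longrightarrow> X = M"
    by auto
  note MI = hom_idealD[OF M(1)]
  have power: "\<exists>n m c. x ^ n = m + c * f \<and> m \<in> M" if f: "homogeneous e f" "f \<notin> M" for e f
  proof (rule ccontr)
    let ?X = "{m + c * f | m c. m \<in> M}"
    assume "\<not> ?thesis"
    then have "\<forall>n. x ^ n \<notin> ?X" by blast
    moreover have sub: "M \<subseteq> ?X"
    proof
      fix m assume "m \<in> M"
      moreover have "m = m + 0 * f" by simp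
      ultimately show "m \<in> ?X" by blast
    qed
    ultimately have "?X = M"
      using max[OF hom_ideal_adjoin[OF M(1) f(1)]] M(2) by blast
    moreover have "f = 0 + 1 * f" by simp
    then have "f \<in> ?X" using MI(1) by blast
    ultimately show False using f(2) by simp
  qed
  have hom_prime: "f \<in> M \<or> g \<in> M" if fg: "homogeneous d f" "homogeneous e g" "f * g \<in> M" for f g d e
  proof (rule ccontr)
    assume "\<not> ?thesis"
    then have fM: "f \<notin> M" and gM: "g \<notin> M" by auto
    obtain n m c where 1: "x ^ n = m + c * f" "m \<in> M"
      using power[OF fg(1) fM] by (elim exE conjE)
    obtain n' m' c' where 2: "x ^ n' = m' + c' * g" "m' \<in> M"
      using power[OF fg(2) gM] by (elim exE conjE)
    have "x ^ (n + n') = (m' + c' * g) * m + (c * f) * m' + (c * c') * (f * g)"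
      unfolding power_add 1(1) 2(1) by (simp add: algebra_simps)
    moreover have "(m' + c' * g) * m + (c * f) * m' + (c * c') * (f * g) \<in> M"
      by (intro MI(2,3) fg(3) 1(2) 2(2))
    ultimately show False using M(3) by metis
  qed
  have top: "\<exists>d. hom_component d f \<notin> M \<and> (\<forall>e>d. hom_component e f \<in> M)" if "f \<notin> M" for f
  proof -
    let ?D = "{d. hom_component d f \<notin> M}"
    have fin: "finite ?D"
      by (rule finite_subset[OF _ hom_component_finite[of f]]) (use MI(1) in auto)
    have "?D \<noteq> {}"
    proof
      assume "?D = {}"
      then have "(\<Sum>d\<in>{d. hom_component d f \<noteq> 0}. hom_component d f) \<in> M"
        by (intro hom_ideal_sum[OF M(1)]) auto
      then show False using sum_hom_component[OF hom_component_finite[of f] order_refl] that by simp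
    qed
    then have "Max ?D \<in> ?D" using fin Max_in by blast
    moreover have "hom_component e f \<in> M" if "e > Max ?D" for e
      using Max_ge[OF fin, of e] that by (meson leD mem_Collect_eq)
    ultimately show ?thesis by blast
  qed
  have "homogeneous_prime M"
    unfolding homogeneous_prime_def
  proof (intro conjI ballI allI impI)
    show "1 \<notin> M" using M(3)[of 0] by simp
    fix f g assume fg: "f * g \<in> M"
    show "f \<in> M \<or> g \<in> M"
    proof (rule ccontr)
      assume no: "\<not> ?thesis"
      obtain d where d: "hom_component d f \<notin> M" "\<forall>e>d. hom_component e f \<in> M" using top no by blast
      obtain e where e: "hom_component e g \<notin> M" "\<forall>d>e. hom_component d g \<in> M" using top no by blast
      let ?t = "\<lambda>a. hom_component a f * hom_component (d + e - a) g"
      have "(\<Sum>a\<le>d + e. ?t a) \<in> M"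
        using MI(4)[OF fg, of "d + e"] by (simp add: hom_component_mult)
      also have "(\<Sum>a\<le>d + e. ?t a) = ?t d + (\<Sum>a\<in>{..d + e} - {d}. ?t a)"
        by (rule sum.remove) auto
      finally have 1: "?t d + (\<Sum>a\<in>{..d + e} - {d}. ?t a) \<in> M" .
      have "?t a \<in> M" if "a \<in> {..d + e} - {d}" for a
      proof (cases "a > d")
        case True
        then have "hom_component (d + e - a) g * hom_component a f \<in> M" using d(2) MI(3) by blast
        then show ?thesis by (simp only: mult.commute)
      next
        case False
        then have "d + e - a > e" using that by auto
        then show ?thesis using e(2) MI(3) by blast
      qed
      then have "(\<Sum>a\<in>{..d + e} - {d}. ?t a) \<in> M" by (rule hom_ideal_sum[OF M(1)])
      then have "(- 1) * (\<Sum>a\<in>{..d + e} - {d}. ?t a) \<in> M" by (rule MI(3))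
      from MI(2)[OF 1 this] have "hom_component d f * hom_component e g \<in> M" by simp
      then show False
        using hom_prime[OF homogeneous_hom_component homogeneous_hom_component] d(1) e(1) by blast
    qed
  qed (use MI in auto)
  then show ?thesis using M(2) M(3)[of 1] by auto
qed

text \<open>The graded form of the fact that the primes over an ideal intersect in its radical. The
  finiteness of the sum is the source of all quasi-compactness below.\<close>

lemma power_in_ideal:
  fixes x :: "'k::field poly4"
  assumes H: "\<And>h. h \<in> H \<Longrightarrow> \<exists>d. homogeneous d h"
    and P: "\<And>P. homogeneous_prime P \<Longrightarrow> H \<subseteq> P \<Longrightarrow> x \<in> P"
  obtains n A c where "finite A" "A \<subseteq> H" "x ^ n = (\<Sum>h\<in>A. c h * h)"
proof -
  \<comment> \<open>The ring as a module over itself, so that \<open>span\<close> is the generated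
    ideal.\<close>
  interpret module "(*) :: 'k poly4 \<Rightarrow> 'k poly4 \<Rightarrow> 'k poly4"
    by standard (simp_all add: algebra_simps)
  have "hom_ideal (span H)"
    unfolding hom_ideal_def
  proof (intro conjI ballI allI)
    fix f d assume "f \<in> span H"
    then obtain A c where A: "finite A" "A \<subseteq> H" "f = (\<Sum>h\<in>A. c h * h)"
      unfolding span_explicit by blast
    have "hom_component d (c h * h) \<in> span H" if h: "h \<in> A" for h
    proof -
      obtain e where e: "homogeneous e h" using H A(2) h by blast
      show ?thesis
        unfolding hom_component_mult_homogeneous[OF e] using h A(2)
        by (auto intro: span_zero span_scale span_base)
    qed
    then show "hom_component d f \<in> span H"
      unfolding A(3) hom_component_sum by (rule span_sum)
  qed (auto intro: span_zero span_add span_scale)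
  moreover have "H \<subseteq> span H" by (rule span_superset)
  ultimately have "\<exists>n. x ^ n \<in> span H"
    using exists_homogeneous_prime[of "span H" x] P by blast
  then show thesis using that unfolding span_explicit by blast
qed

text \<open>The homogeneous elements that annihilate \<open>e\<close> modulo \<open>F\<close> have
  no common zero on the surface where \<open>y\<close> is nonzero, so their ideal contains a power
  of \<open>y\<close>.\<close>

lemma dvd_power_mult_of_local:
  fixes F e y :: "'k::field poly4"
  assumes F: "homogeneous m F"
    and loc: "\<And>P. homogeneous_prime P \<Longrightarrow> F \<in> P \<Longrightarrow> y \<notin> P \<Longrightarrow> \<exists>t d. homogeneous d t \<and> t \<notin> P \<and> F dvd t * e"
  obtains n where "F dvd y ^ n * e"
proof -
  let ?H = "{t. (\<exists>d. homogeneous d t) \<and> F dvd t * e}"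
  have "F \<in> ?H" using F by auto
  then have prime: "y \<in> P" if "homogeneous_prime P" "?H \<subseteq> P" for P
    using loc[OF that(1)] that(2) by blast
  have hom: "\<exists>d. homogeneous d h" if "h \<in> ?H" for h using that by blast
  obtain n A c where A: "finite A" "A \<subseteq> ?H" "y ^ n = (\<Sum>t\<in>A. c t * t)"
    using power_in_ideal[OF hom prime] .
  have "F dvd (\<Sum>t\<in>A. c t * (t * e))"
    by (rule dvd_sum) (use A(2) in auto)
  then have "F dvd y ^ n * e"
    by (simp add: A(3) sum_distrib_right mult.assoc)
  then show thesis by (rule that)
qed

definition basic_open :: "'k::field poly4 \<Rightarrow> 4 \<Rightarrow> 'k poly4 set set" where
  "basic_open F l = {P \<in> proj_points F. Var l \<notin> P}"

lemma openin_basic_open: "openin (proj_topology F) (basic_open F l)"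
  unfolding openin_proj_topology proj_open_def basic_open_def
  by (rule exI[of _ "{Var l}"]) (use homogeneous_Var in auto)

lemma basic_openD:
  assumes "P \<in> basic_open F l"
  shows "homogeneous_prime P" "F \<in> P" "Var l \<notin> P"
  using assms by (auto simp: basic_open_def proj_points_def)

lemma basic_openI: "homogeneous_prime P \<Longrightarrow> F \<in> P \<Longrightarrow> Var l \<notin> P \<Longrightarrow> P \<in> basic_open F l"
  by (auto simp: basic_open_def proj_points_def)

text \<open>
  The usual proof that sections over a basic open set are fractions with a power of the variable as
  denominator: a finite cover, compatible numerators, and a partition of unity.
\<close>

lemma section_basic_open:
  fixes F :: "'k::field poly4"
  assumes F: "homogeneous m F" and s: "s \<in> sections F (basic_open F l)"
  obtains N g where "homogeneous (Suc N) g" "\<And>Q. Q \<in> basic_open F l \<Longrightarrow> s Q = fraction F Q g (Var l ^ Suc N)"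
proof -
  let ?U = "basic_open F l" and ?x = "Var l :: 'k poly4"
  define W where "W a h \<longleftrightarrow> (\<exists>d. homogeneous d a \<and> homogeneous d h) \<and> (\<forall>Q\<in>?U. h \<notin> Q \<longrightarrow> s Q = fraction F Q a h)" for a h
  have local: "\<exists>a h. W a h \<and> h \<notin> P" if P: "P \<in> ?U" for P
  proof -
    obtain V a b where V: "openin (proj_topology F) V" "P \<in> V" "V \<subseteq> ?U"
      and ab: "\<forall>Q\<in>V. is_fraction Q a b \<and> s Q = fraction F Q a b"
      using s P unfolding sections_def by blast
    obtain G where G: "\<forall>g\<in>G. \<exists>d. homogeneous d g" "V = {P \<in> proj_points F. \<not> G \<subseteq> P}"
      using V(1) unfolding openin_proj_topology proj_open_def by blast
    obtain g where g: "g \<in> G" "g \<notin> P" using V(2) G(2) by blast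
    obtain e where e: "homogeneous e g" using G(1) g(1) by blast
    obtain d where d: "homogeneous d a" "homogeneous d b" "b \<notin> P"
      using ab V(2) unfolding is_fraction_def by blast
    have hp: "homogeneous_prime P" using basic_openD[OF P] by simp
    \<comment> \<open>Multiplying by \<open>g\<close> encodes the neighbourhood in the denominator:
      where g*b does not vanish, the point lies in \<open>V\<close>.\<close>
    have "W (g * a) (g * b)"
      unfolding W_def
    proof (intro conjI ballI impI)
      show "\<exists>d. homogeneous d (g * a) \<and> homogeneous d (g * b)"
        using homogeneous_mult[OF e d(1)] homogeneous_mult[OF e d(2)] by blast
      fix Q assume Q: "Q \<in> ?U" "g * b \<notin> Q"
      have Q': "homogeneous_prime Q" using basic_openD[OF Q(1)] by simp
      have gb: "g \<notin> Q" "b \<notin> Q" using Q(2) prime_mult_iff[OF Q'] by auto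
      then have "Q \<in> V" using G(2) g(1) Q(1) by (auto simp: basic_open_def)
      then have "is_fraction Q a b" "s Q = fraction F Q a b" using ab by auto
      moreover have "is_fraction Q (g * a) (g * b)"
        using homogeneous_mult[OF e d(1)] homogeneous_mult[OF e d(2)] Q(2) unfolding is_fraction_def by blast
      moreover have "frac_eq Q F a b (g * a) (g * b)"
        by (rule frac_eqI[OF Q']) (simp add: algebra_simps)
      ultimately show "s Q = fraction F Q (g * a) (g * b)"
        using fraction_eq_iff[OF Q'] by metis
    qed
    moreover have "g * b \<notin> P" using g(2) d(3) prime_mult_iff[OF hp] by simp
    ultimately show ?thesis by blast
  qed
  let ?H = "{h. \<exists>a. W a h}"
  \<comment> \<open>\<open>F\<close> vanishes at all points of the surface, so the condition on it
    is vacuous; its presence makes every prime over \<open>?H\<close> contain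
    \<open>F\<close>.\<close>
  have "F \<in> ?H"
    using F basic_openD(2) by (auto simp: W_def intro!: exI[of _ "0::'k poly4"])
  have prime: "?x \<in> P" if "homogeneous_prime P" "?H \<subseteq> P" for P
  proof (rule ccontr)
    assume "?x \<notin> P"
    then have "P \<in> ?U" using that \<open>F \<in> ?H\<close> by (intro basic_openI) auto
    then show False using local that(2) by blast
  qed
  have hom: "\<exists>d. homogeneous d h" if "h \<in> ?H" for h using that unfolding W_def by blast
  obtain n A c where A: "finite A" "A \<subseteq> ?H" "?x ^ n = (\<Sum>h\<in>A. c h * h)"
    using power_in_ideal[OF hom prime] .
  have "\<forall>h\<in>A. \<exists>a. W a h" using A(2) by blast
  then obtain a where a: "\<And>h. h \<in> A \<Longrightarrow> W (a h) h" by metis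
  have cover: "\<exists>h\<in>A. h \<notin> Q" if Q: "Q \<in> ?U" for Q
  proof (rule ccontr)
    assume "\<not> ?thesis"
    then have "(\<Sum>h\<in>A. c h * h) \<in> Q"
      by (intro hom_ideal_sum[OF homogeneous_prime_hom_ideal[OF basic_openD(1)[OF Q]]]
          prime_mult[OF basic_openD(1)[OF Q]]) auto
    then have "?x ^ n \<in> Q" by (simp add: A(3))
    then show False using prime_power_not_in[OF basic_openD(1,3)[OF Q]] by blast
  qed
  have degA: "\<exists>d. homogeneous d (a h) \<and> homogeneous d h" if "h \<in> A" for h
    using a[OF that] by (auto simp: W_def)
  have frac: "is_fraction Q (a h) h" "s Q = fraction F Q (a h) h" if "Q \<in> ?U" "h \<in> A" "h \<notin> Q" for Q h
    using a[OF that(2)] that(1,3) by (auto simp: W_def is_fraction_def)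
  have "\<exists>N. F dvd (?x * h * h') ^ N * (a h * h' - a h' * h)" if h: "h \<in> A" "h' \<in> A" for h h'
  proof -
    have "\<exists>t d. homogeneous d t \<and> t \<notin> P \<and> F dvd t * (a h * h' - a h' * h)"
      if P: "homogeneous_prime P" "F \<in> P" "?x * h * h' \<notin> P" for P
    proof -
      have n: "?x \<notin> P" "h \<notin> P" "h' \<notin> P" using P(3) prime_mult_iff[OF P(1)] by auto
      then have U: "P \<in> ?U" using P by (intro basic_openI)
      have "fraction F P (a h) h = fraction F P (a h') h'"
        using frac(2)[OF U] h n by metis
      then show ?thesis
        using fraction_eq_iff[OF P(1) frac(1)[OF U h(1) n(2)] frac(1)[OF U h(2) n(3)], where F = F]
        by (auto simp: frac_eq_def[OF P(1)])
    qed
    then show ?thesis using dvd_power_mult_of_local[OF F] by metis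
  qed
  then obtain k where k: "\<And>h h'. h \<in> A \<Longrightarrow> h' \<in> A \<Longrightarrow> F dvd (?x * h * h') ^ k h h' * (a h * h' - a h' * h)"
    by metis
  define N where "N = (\<Sum>p\<in>A \<times> A. k (fst p) (snd p))"
  have N: "F dvd (?x * h * h') ^ N * (a h * h' - a h' * h)" if h: "h \<in> A" "h' \<in> A" for h h'
  proof -
    have "k h h' \<le> N"
      unfolding N_def using member_le_sum[of "(h, h')" "A \<times> A" "\<lambda>p. k (fst p) (snd p)"] A(1) h by simp
    then have "(?x * h * h') ^ N = (?x * h * h') ^ (N - k h h') * (?x * h * h') ^ k h h'"
      by (simp flip: power_add)
    then show ?thesis using k[OF h] by (simp add: mult.assoc)
  qed
  \<comment> \<open>The N-th powers are absorbed into numerators and denominators; compatibility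
    then holds modulo \<open>F\<close> without a multiplier.\<close>
  define b where "b h = ?x ^ N * h ^ N * a h" for h
  define u where "u h = ?x ^ N * h ^ N * h" for h
  have compat: "F dvd b h * u h' - b h' * u h" if h: "h \<in> A" "h' \<in> A" for h h'
  proof -
    have "b h * u h' - b h' * u h = ?x ^ N * ((?x * h * h') ^ N * (a h * h' - a h' * h))"
      by (simp add: b_def u_def algebra_simps power_mult_distrib)
    then show ?thesis using N[OF h] by simp
  qed
  have bu_deg: "\<exists>d. homogeneous d (b h) \<and> homogeneous d (u h)" if h: "h \<in> A" for h
  proof -
    obtain d where d: "homogeneous d (a h)" "homogeneous d h" using degA[OF h] by blast
    have "homogeneous (N + N * d) (?x ^ N * h ^ N)"
      by (intro homogeneous_mult homogeneous_Var_power homogeneous_power d)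
    then show ?thesis unfolding b_def u_def using homogeneous_mult d by blast
  qed
  \<comment> \<open>Again \<open>F\<close> is included to restrict to primes of the surface; its
    numerator is 0.\<close>
  let ?H2 = "insert F (u ` A)"
  have H2: "\<exists>e d. homogeneous d e \<and> homogeneous d k \<and> (\<forall>h\<in>A. F dvd e * u h - b h * k)" if k: "k \<in> ?H2" for k
  proof (cases "k = F")
    case True
    then show ?thesis using F by (intro exI[of _ 0] exI[of _ m]) auto
  next
    case False
    then obtain h where "h \<in> A" "k = u h" using k by auto
    then show ?thesis using bu_deg[of h] compat[of h] by auto
  qed
  have prime2: "?x \<in> P" if P: "homogeneous_prime P" "?H2 \<subseteq> P" for P
  proof (rule ccontr)
    assume x: "?x \<notin> P"
    then have U: "P \<in> ?U" using P by (intro basic_openI) auto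
    then obtain h where h: "h \<in> A" "h \<notin> P" using cover by blast
    then have "u h \<notin> P"
      using x by (simp add: u_def prime_mult_iff[OF P(1)] prime_power_not_in[OF P(1)])
    then show False using P(2) h(1) by blast
  qed
  have hom2: "\<exists>d. homogeneous d h" if "h \<in> ?H2" for h using H2[OF that] by blast
  obtain M B c' where B: "finite B" "B \<subseteq> ?H2" "?x ^ M = (\<Sum>k\<in>B. c' k * k)"
    using power_in_ideal[OF hom2 prime2] .
  have "\<forall>k\<in>B. \<exists>e d. homogeneous d e \<and> homogeneous d k \<and> (\<forall>h\<in>A. F dvd e * u h - b h * k)"
    using H2 B(2) by blast
  then obtain e d where ed: "\<And>k. k \<in> B \<Longrightarrow> homogeneous (d k) (e k)" "\<And>k. k \<in> B \<Longrightarrow> homogeneous (d k) k"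
    "\<And>k h. k \<in> B \<Longrightarrow> h \<in> A \<Longrightarrow> F dvd e k * u h - b h * k"
    by metis
  \<comment> \<open>Only the components of the right degree are kept, so that the glued numerator is
    homogeneous.\<close>
  define c2 where "c2 k = (if d k \<le> M then hom_component (M - d k) (c' k) else 0)" for k
  have xM: "?x ^ M = (\<Sum>k\<in>B. c2 k * k)"
  proof -
    have "?x ^ M = hom_component M (?x ^ M)"
      using hom_component_homogeneous[OF homogeneous_Var_power] by metis
    also have "\<dots> = (\<Sum>k\<in>B. hom_component M (c' k * k))"
      unfolding B(3) hom_component_sum ..
    also have "\<dots> = (\<Sum>k\<in>B. c2 k * k)"
      by (rule sum.cong) (auto simp: hom_component_mult_homogeneous[OF ed(2)] c2_def)
    finally show ?thesis .
  qed
  define g where "g = (\<Sum>k\<in>B. c2 k * e k)"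
  have g: "homogeneous M g"
    unfolding g_def
  proof (rule homogeneous_sum)
    fix k assume k: "k \<in> B"
    show "homogeneous M (c2 k * e k)"
    proof (cases "d k \<le> M")
      case True
      then have "homogeneous (M - d k + d k) (c2 k * e k)"
        using homogeneous_hom_component ed(1)[OF k] by (intro homogeneous_mult) (auto simp: c2_def)
      with True show ?thesis by simp
    qed (simp add: c2_def)
  qed
  have sQ: "s Q = fraction F Q g (?x ^ M)" if Q: "Q \<in> ?U" for Q
  proof -
    note hp = basic_openD(1)[OF Q]
    obtain h where h: "h \<in> A" "h \<notin> Q" using cover[OF Q] by blast
    have xM': "?x ^ M \<notin> Q" "?x ^ N \<notin> Q" using prime_power_not_in[OF hp basic_openD(3)[OF Q]] by auto
    have uh: "u h \<notin> Q" using xM' h by (simp add: u_def prime_mult_iff[OF hp] prime_power_not_in[OF hp])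
    have f1: "is_fraction Q (b h) (u h)" using bu_deg[OF h(1)] uh by (auto simp: is_fraction_def)
    have f2: "is_fraction Q g (?x ^ M)" using g xM' homogeneous_Var_power by (auto simp: is_fraction_def)
    have "fraction F Q (a h) h = fraction F Q (b h) (u h)"
      using fraction_eq_iff[OF hp frac(1)[OF Q h] f1, where F = F]
      by (simp add: frac_eqI[OF hp] b_def u_def algebra_simps)
    moreover have "fraction F Q (b h) (u h) = fraction F Q g (?x ^ M)"
    proof -
      have "b h * ?x ^ M - g * u h = - (\<Sum>k\<in>B. c2 k * (e k * u h - b h * k))"
        by (simp add: xM g_def sum_distrib_left sum_distrib_right algebra_simps sum_subtractf)
      moreover have "F dvd (\<Sum>k\<in>B. c2 k * (e k * u h - b h * k))"
        by (rule dvd_sum) (use ed(3) h(1) in auto)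
      ultimately have "F dvd b h * ?x ^ M - g * u h" by simp
      then show ?thesis
        using fraction_eq_iff[OF hp f1 f2, where F = F] frac_eqI[OF hp] by blast
    qed
    ultimately show ?thesis using frac(2)[OF Q h] by simp
  qed
  \<comment> \<open>The extra factor makes the exponent positive, so that later a factor of each
    variable can be taken out when two sections are compared.\<close>
  have "homogeneous (Suc M) (?x * g)"
    using homogeneous_mult[OF homogeneous_Var g] by simp
  moreover have "s Q = fraction F Q (?x * g) (?x ^ Suc M)" if Q: "Q \<in> ?U" for Q
  proof -
    note hp = basic_openD(1)[OF Q]
    have x: "?x ^ n \<notin> Q" for n using prime_power_not_in[OF hp basic_openD(3)[OF Q]] .
    have "is_fraction Q g (?x ^ M)" "is_fraction Q (?x * g) (?x ^ Suc M)"
      using g \<open>homogeneous (Suc M) (?x * g)\<close> homogeneous_Var_power x unfolding is_fraction_def by blast+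
    then have "fraction F Q g (?x ^ M) = fraction F Q (?x * g) (?x ^ Suc M)"
      using fraction_eq_iff[OF hp, where F = F] frac_eqI[OF hp] by (simp add: algebra_simps)
    then show ?thesis using sQ[OF Q] by simp
  qed
  ultimately show thesis by (rule that)
qed

section \<open>Surfaces that do not split\<close>

lemma single_eq_subst4: "subst4 Const Var (Poly_Mapping.single m c) = Poly_Mapping.single m (c::'k::field)"
proof -
  interpret coefficient_hom "Const :: 'k \<Rightarrow> 'k poly4" by (rule coefficient_hom_Const)
  have pow: "(Var i :: 'k poly4) ^ n = Poly_Mapping.single (Poly_Mapping.single i n) 1" for i n
    by (induction n) (simp_all add: Var_def mult_single flip: single_add)
  have m: "m = Poly_Mapping.single 1 (Poly_Mapping.lookup m 1) + Poly_Mapping.single 2 (Poly_Mapping.lookup m 2)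
      + Poly_Mapping.single 3 (Poly_Mapping.lookup m 3) + Poly_Mapping.single 4 (Poly_Mapping.lookup m 4)"
    by (rule poly_mapping_eqI, rename_tac i, case_tac i rule: exhaust_4[THEN disjE])
      (auto simp: lookup_add lookup_single when_def dest!: spec)
  show ?thesis
    by (subst (2) m) (simp add: subst4_single prod_4 pow mult_single Const_def)
qed

lemma poly4_induct [case_names Const Var add mult]:
  fixes p :: "'k::field poly4"
  assumes "\<And>c. R (Const c)" "\<And>i. R (Var i)" "\<And>f g. R f \<Longrightarrow> R g \<Longrightarrow> R (f + g)" "\<And>f g. R f \<Longrightarrow> R g \<Longrightarrow> R (f * g)"
  shows "R p"
proof (induction p rule: poly_mapping_single_induct)
  case zero
  then show ?case using assms(1)[of 0] by (simp add: Const_def)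
next
  case (single m c)
  interpret coefficient_hom "Const :: 'k \<Rightarrow> 'k poly4" by (rule coefficient_hom_Const)
  have "R 1" using assms(1)[of 1] by (simp add: h_1)
  then have pow: "R (Var i ^ n)" for i n by (induction n) (auto intro: assms)
  have "R (subst4 Const Var (Poly_Mapping.single m c))"
    unfolding subst4_single prod_4 by (intro assms(1,4) pow)
  then show ?case by (simp only: single_eq_subst4)
qed (rule assms(3))

subsection \<open>Setting a variable to zero\<close>

text \<open>Reduction modulo a variable, with the quotient identified with the polynomials free of
  it, so that all computations stay in one ring.\<close>

definition kill :: "4 \<Rightarrow> 'k::field poly4 \<Rightarrow> 'k poly4" where
  "kill l = subst4 Const (\<lambda>i. if i = l then 0 else Var i)"

lemma kill_simps:
  fixes f g :: "'k::field poly4"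
  shows "kill l (f + g) = kill l f + kill l g" "kill l (f * g) = kill l f * kill l g" "kill l 0 = (0 :: 'k poly4)"
    "kill l (Const c) = (Const c :: 'k poly4)" "kill l (Var i) = (if i = l then 0 else Var i :: 'k poly4)"
    "kill l (f ^ n) = kill l f ^ n"
proof -
  interpret coefficient_hom "Const :: 'k \<Rightarrow> 'k poly4" by (rule coefficient_hom_Const)
  show "kill l (f + g) = kill l f + kill l g" "kill l (f * g) = kill l f * kill l g" "kill l 0 = (0 :: 'k poly4)"
    "kill l (Const c) = (Const c :: 'k poly4)" "kill l (Var i) = (if i = l then 0 else Var i :: 'k poly4)"
    "kill l (f ^ n) = kill l f ^ n"
    unfolding kill_def by (simp_all add: subst4_add subst4_mult subst4_power)
qed

lemma kill_diff_dvd: "Var l dvd p - kill l (p :: 'k::field poly4)"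
proof (induction p rule: poly4_induct)
  case (add f g)
  then show ?case unfolding kill_simps by (rule dvd_diff_add)
next
  case (mult f g)
  then show ?case unfolding kill_simps by (rule dvd_diff_mult)
qed (auto simp: kill_simps)

lemma kill_split: obtains p1 where "p = kill l p + Var l * (p1 :: 'k::field poly4)"
proof -
  obtain p1 where "p - kill l p = Var l * p1" using kill_diff_dvd[of l p] by (rule dvdE)
  then have "p = kill l p + Var l * p1" by (simp add: algebra_simps)
  then show thesis by (rule that)
qed

lemma kill_eq_0D: assumes "kill l p = (0 :: 'k::field poly4)" obtains p' where "p = Var l * p'"
  using kill_split[of p l] assms that by auto

lemma Var_neq_0 [simp]: "Var i \<noteq> (0 :: 'k::field poly4)"
proof
  assume "Var i = (0 :: 'k poly4)"
  then have "Poly_Mapping.lookup (Var i :: 'k poly4) (Poly_Mapping.single i 1) = 0" by simp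
  then show False by (simp add: Var_def)
qed

text \<open>The hypothesis says that the variable does not divide \<open>F\<close>. Reducing the
  equation modulo the variable shows that the cofactor of \<open>F\<close> is divisible by
  it.\<close>

lemma dvd_Var_cancel:
  fixes F h :: "'k::field poly4"
  assumes F: "kill l F \<noteq> 0" and dv: "F dvd Var l ^ n * h"
  shows "F dvd h"
  using dv
proof (induction n)
  case (Suc n)
  obtain b where b: "Var l * (Var l ^ n * h) = F * b"
    using Suc.prems by (auto simp: mult.assoc elim: dvdE)
  have "kill l F * kill l b = 0"
    using arg_cong[OF b, of "kill l"] by (simp add: kill_simps)
  then have "kill l b = 0" using F by simp
  then obtain b' where "b = Var l * b'" by (rule kill_eq_0D)
  with b have "Var l * (Var l ^ n * h) = Var l * (F * b')" by (simp add: ac_simps)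
  then have "Var l ^ n * h = F * b'" by simp
  then show ?case using Suc.IH by simp
qed simp

text \<open>As \<open>F\<close> is nonzero modulo both variables, \<open>F\<close>,
  \<open>Var l\<close>, \<open>Var k\<close> form a regular sequence, so \<open>Var k\<close> is a
  nonzerodivisor modulo \<open>F\<close> and any power of \<open>Var l\<close>. Reduction modulo
  \<open>Var l\<close> strips off one factor in the induction.\<close>

lemma regular_Var:
  fixes F h :: "'k::field poly4"
  assumes F: "kill k (kill l F) \<noteq> 0" and kl: "k \<noteq> l" and eq: "Var k * h = Var l ^ n * a + F * b"
  shows "\<exists>a' b'. h = Var l ^ n * a' + F * b'"
  using eq
proof (induction n arbitrary: h a b)
  case 0
  have "h = Var l ^ 0 * h + F * 0" by simp
  then show ?case by blast
next
  case (Suc n)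
  have 1: "Var k * kill l h = kill l F * kill l b"
    using arg_cong[OF Suc.prems, of "kill l"] kl by (simp add: kill_simps)
  then have "kill k (kill l F) * kill k (kill l b) = 0"
    using arg_cong[of _ _ "kill k"] by (metis kill_simps(2,5) mult_zero_left)
  then have "kill k (kill l b) = 0" using F by simp
  then obtain b' where b': "kill l b = Var k * b'" by (rule kill_eq_0D)
  then have "Var k * kill l h = Var k * (kill l F * b')" using 1 by (simp add: ac_simps)
  then have h': "kill l h = kill l F * b'" by simp
  obtain F1 where F1: "F = kill l F + Var l * F1" by (rule kill_split)
  obtain h1 where h1: "h = kill l h + Var l * h1" by (rule kill_split)
  obtain b1 where b1: "b = kill l b + Var l * b1" by (rule kill_split)
  have hF: "h = F * b' + Var l * (h1 - F1 * b')"
  proof -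
    have "h = kill l F * b' + Var l * h1" using h1 h' by simp
    also have "kill l F = F - Var l * F1" using F1 by (simp add: algebra_simps)
    finally show ?thesis by (simp add: algebra_simps)
  qed
  have "Var k * h = Var l ^ Suc n * a + F * (Var k * b' + Var l * b1)"
    using Suc.prems b1 b' by simp
  then have "Var l * (Var k * (h1 - F1 * b')) = Var l * (Var l ^ n * a + F * b1)"
    by (subst (asm) hF) (simp add: algebra_simps)
  then have "Var k * (h1 - F1 * b') = Var l ^ n * a + F * b1" by simp
  then obtain a' c where "h1 - F1 * b' = Var l ^ n * a' + F * c" using Suc.IH by blast
  with hF have "h = Var l ^ Suc n * a' + F * (b' + Var l * c)" by (simp add: algebra_simps)
  then show ?case by blast
qed

lemma regular_Var_power:
  fixes F h :: "'k::field poly4"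
  assumes F: "kill k (kill l F) \<noteq> 0" and kl: "k \<noteq> l" and eq: "Var k ^ m * h = Var l ^ n * a + F * b"
  shows "\<exists>a' b'. h = Var l ^ n * a' + F * b'"
  using eq
proof (induction m arbitrary: a b)
  case (Suc m)
  then have "Var k * (Var k ^ m * h) = Var l ^ n * a + F * b" by (simp add: mult.assoc)
  from regular_Var[OF F kl this] Suc.IH show ?case by blast
qed auto

lemma single_square_monomial:
  "Poly_Mapping.single (square_monomial i j) c = Const (c::'k::field) * (Var i)\<^sup>2 * Var j"
proof -
  have "Poly_Mapping.single i (2::nat) = Poly_Mapping.single i 1 + Poly_Mapping.single i 1"
    by (simp only: single_add[symmetric] one_add_one)
  then show ?thesis
    by (simp add: square_monomial_def Const_def Var_def mult_single power2_eq_square)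
qed

lemma squarefree_0_polynomial:
  fixes F :: "'k::field poly4"
  assumes "homogeneous 3 F" "squarefree_coeffs F = 0"
  shows "F = (\<Sum>i\<in>UNIV. \<Sum>j\<in>UNIV. Const (square_coeffs F $ i $ j) * (Var i)\<^sup>2 * Var j)"
  by (subst homogeneous_3_sum_singles[OF assms(1)]) (simp add: assms(2) single_square_monomial)

text \<open>Without squarefree terms each monomial of \<open>F\<close> involves at most two
  variables, so setting two others to zero keeps it.\<close>

lemma exists_regular_pair:
  fixes F :: "'k::field poly4"
  assumes F: "homogeneous 3 F" "squarefree_coeffs F = 0" "F \<noteq> 0"
  shows "\<exists>k l. k \<noteq> l \<and> kill k (kill l F) \<noteq> 0"
proof -
  obtain i j where ij: "square_coeffs F $ i $ j \<noteq> 0"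
  proof (rule ccontr)
    assume "\<not> thesis"
    then have "square_coeffs F $ i $ j = 0" for i j using that by blast
    then show False
      using squarefree_0_polynomial[OF F(1,2)] F(3) by (simp add: Const_def)
  qed
  have small: "\<exists>r. r \<notin> S" if "card S < 4" for S :: "4 set"
  proof (rule ccontr)
    assume "\<nexists>r. r \<notin> S"
    then have "S = UNIV" by blast
    with that show False by simp
  qed
  have "card {i, j} < 4" using card_length[of "[i, j]"] by simp
  then obtain l where l: "l \<notin> {i, j}" using small by blast
  have "card {i, j, l} < 4" using card_length[of "[i, j, l]"] by simp
  then obtain k where k: "k \<notin> {i, j, l}" using small by blast
  have ksum: "kill r (\<Sum>i\<in>A. f i) = (\<Sum>i\<in>A. kill r (f i))" for r A and f :: "4 \<Rightarrow> 'k poly4"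
    by (induction A rule: infinite_finite_induct) (simp_all add: kill_simps)
  have "kill k (kill l F) = (\<Sum>i\<in>UNIV. \<Sum>j\<in>UNIV.
      if i \<in> {k, l} \<or> j \<in> {k, l} then 0 else Poly_Mapping.single (square_monomial i j) (square_coeffs F $ i $ j))"
    by (subst squarefree_0_polynomial[OF F(1,2)])
      (auto simp: ksum kill_simps single_square_monomial intro!: sum.cong)
  then have "Poly_Mapping.lookup (kill k (kill l F)) (square_monomial i j)
    = (\<Sum>r\<in>UNIV. \<Sum>s\<in>UNIV. if r = i \<and> s = j then square_coeffs F $ i $ j else 0)"
    using k l by (auto simp: lookup_sum lookup_single when_def square_monomial_inject intro!: sum.cong)
  also have "\<dots> = (\<Sum>r\<in>UNIV. if r = i then square_coeffs F $ i $ j else 0)"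
    by (rule sum.cong) auto
  also have "\<dots> = square_coeffs F $ i $ j" by simp
  finally have "kill k (kill l F) \<noteq> 0" using ij by auto
  then show ?thesis using k by blast
qed

subsection \<open>A splitting acts on quadratic forms\<close>

definition fraction_section :: "'k::field poly4 \<Rightarrow> 'k poly4 set set \<Rightarrow> 'k poly4 \<Rightarrow> 'k poly4 \<Rightarrow> 'k sect" where
  "fraction_section F U a b = (\<lambda>P\<in>U. fraction F P a b)"

lemma fraction_section_sections:
  assumes "openin (proj_topology F) U" "\<And>P. P \<in> U \<Longrightarrow> is_fraction P a b"
  shows "fraction_section F U a b \<in> sections F U"
  unfolding sections_def
proof (intro CollectI conjI ballI)
  fix P assume "P \<in> U"
  with assms have "openin (proj_topology F) U \<and> P \<in> U \<and> U \<subseteq> U \<and>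
    (\<forall>Q\<in>U. is_fraction Q a b \<and> fraction_section F U a b Q = fraction F Q a b)"
    by (simp add: fraction_section_def)
  then show "\<exists>V c d. openin (proj_topology F) V \<and> P \<in> V \<and> V \<subseteq> U \<and>
    (\<forall>Q\<in>V. is_fraction Q c d \<and> fraction_section F U a b Q = fraction F Q c d)" by blast
qed (simp add: fraction_section_def)

lemma fraction_section_square_mult:
  assumes U: "openin (proj_topology F) U" and ab: "\<And>P. P \<in> U \<Longrightarrow> is_fraction P a b"
    and cd: "\<And>P. P \<in> U \<Longrightarrow> is_fraction P c d"
  shows "fraction_section F U a b [^]\<^bsub>structure_sheaf F U\<^esub> (2::nat) \<otimes>\<^bsub>structure_sheaf F U\<^esub> fraction_section F U c d
    = fraction_section F U (a * a * c) (b * b * d)"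
  unfolding structure_sheaf_simps structure_sheaf_square fraction_section_def
proof (rule restrict_ext)
  fix P assume P: "P \<in> U"
  have hp: "homogeneous_prime P" using openin_proj_points[OF U P] by simp
  show "germ_mult F P ((\<lambda>P\<in>U. germ_mult F P (germ_mult F P (fraction F P 1 1) ((\<lambda>P\<in>U. fraction F P a b) P))
      ((\<lambda>P\<in>U. fraction F P a b) P)) P) ((\<lambda>P\<in>U. fraction F P c d) P) = fraction F P (a * a * c) (b * b * d)"
    using P germ_square_fraction[OF hp ab[OF P]] germ_mult_fraction[OF hp is_fraction_mult[OF hp ab[OF P] ab[OF P]] cd[OF P]]
    by simp
qed

lemma fraction_section_eq:
  assumes U: "openin (proj_topology F) U" and ab: "\<And>P. P \<in> U \<Longrightarrow> is_fraction P a b"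
    and cd: "\<And>P. P \<in> U \<Longrightarrow> is_fraction P c d" and dv: "F dvd a * d - c * b"
  shows "fraction_section F U a b = fraction_section F U c d"
  unfolding fraction_section_def
proof (rule restrict_ext)
  fix P assume P: "P \<in> U"
  have hp: "homogeneous_prime P" using openin_proj_points[OF U P] by simp
  show "fraction F P a b = fraction F P c d"
    using fraction_eq_iff[OF hp ab[OF P] cd[OF P], where F = F] frac_eqI[OF hp dv] by simp
qed

lemma fraction_eq_dvd:
  fixes F :: "'k::field poly4"
  assumes F: "homogeneous m F"
    and ab: "\<And>P. homogeneous_prime P \<Longrightarrow> F \<in> P \<Longrightarrow> y \<notin> P \<Longrightarrow> is_fraction P a b"
    and cd: "\<And>P. homogeneous_prime P \<Longrightarrow> F \<in> P \<Longrightarrow> y \<notin> P \<Longrightarrow> is_fraction P c d"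
    and eq: "\<And>P. homogeneous_prime P \<Longrightarrow> F \<in> P \<Longrightarrow> y \<notin> P \<Longrightarrow> fraction F P a b = fraction F P c d"
  obtains n where "F dvd y ^ n * (a * d - c * b)"
proof (rule dvd_power_mult_of_local[OF F])
  fix P assume P: "homogeneous_prime P" "F \<in> P" "y \<notin> P"
  then have "frac_eq P F a b c d"
    using fraction_eq_iff[OF P(1) ab[OF P] cd[OF P], where F = F] eq[OF P] by simp
  then show "\<exists>t d'. homogeneous d' t \<and> t \<notin> P \<and> F dvd t * (a * d - c * b)"
    by (auto simp: frac_eq_def[OF P(1)])
qed (rule that)

lemma is_fraction_Var_power:
  "homogeneous_prime P \<Longrightarrow> Var l \<notin> P \<Longrightarrow> homogeneous n a \<Longrightarrow> is_fraction P a (Var l ^ n)"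
  using prime_power_not_in homogeneous_Var_power unfolding is_fraction_def by blast

text \<open>
  If \<open>F = \<Sum>\<^sub>i x\<^sub>i\<^sup>2 L\<^sub>i\<close>, a splitting \<open>\<phi>\<close> induces a map \<open>G\<close> from quadratic to linear forms, because the
  linear forms are all the global sections of \<open>O(1)\<close>. As \<open>L\<^sub>i F\<close> vanishes on the surface,
  \<open>0 = \<phi>(L\<^sub>i F) = \<Sum>\<^sub>j x\<^sub>j G(L\<^sub>i L\<^sub>j)\<close>, an identity of quadratic forms. Multiplying by \<open>x\<^sub>i\<close> and summing
  over \<open>i\<close>, the terms with \<open>i \<noteq> j\<close> cancel in pairs and \<open>G(L\<^sub>i\<^sup>2) = L\<^sub>i\<close> leaves \<open>F = 0\<close>.
\<close>

lemma not_frobenius_split: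
  fixes F :: "'k::field poly4"
  assumes char: "CHAR('k) = 2" and two: "(2 :: 'k poly4) = 0"
    and F: "homogeneous 3 F" "squarefree_coeffs F = 0" "F \<noteq> 0"
  shows "\<not> frobenius_split_surface F"
proof
  assume "frobenius_split_surface F"
  then obtain \<phi> where all: "\<forall>U. openin (proj_topology F) U \<longrightarrow>
      \<phi> U \<in> carrier (structure_sheaf F U) \<rightarrow> carrier (structure_sheaf F U) \<and>
      (\<forall>a\<in>carrier (structure_sheaf F U). \<forall>b\<in>carrier (structure_sheaf F U).
        \<phi> U (a \<oplus>\<^bsub>structure_sheaf F U\<^esub> b) = \<phi> U a \<oplus>\<^bsub>structure_sheaf F U\<^esub> \<phi> U b \<and>
        \<phi> U ((a [^]\<^bsub>structure_sheaf F U\<^esub> (2::nat)) \<otimes>\<^bsub>structure_sheaf F U\<^esub> b) = a \<otimes>\<^bsub>structure_sheaf F U\<^esub> \<phi> U b) \<and>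
      (\<forall>a\<in>carrier (structure_sheaf F U). \<phi> U (a [^]\<^bsub>structure_sheaf F U\<^esub> (2::nat)) = a)"
    and restrictions: "\<forall>U V. openin (proj_topology F) U \<longrightarrow> openin (proj_topology F) V \<longrightarrow> V \<subseteq> U \<longrightarrow>
      (\<forall>a\<in>carrier (structure_sheaf F U). \<phi> V (restrict a V) = restrict (\<phi> U a) V)"
    unfolding frobenius_split_surface_def frobenius_split_def char by (elim exE conjE)
  have \<phi>: "\<phi> U \<in> sections F U \<rightarrow> sections F U" if "openin (proj_topology F) U" for U
    using all that by (simp add: structure_sheaf_simps(1))
  have add: "\<phi> U (s \<oplus>\<^bsub>structure_sheaf F U\<^esub> t) = \<phi> U s \<oplus>\<^bsub>structure_sheaf F U\<^esub> \<phi> U t"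
    and semilinear: "\<phi> U (s [^]\<^bsub>structure_sheaf F U\<^esub> (2::nat) \<otimes>\<^bsub>structure_sheaf F U\<^esub> t) = s \<otimes>\<^bsub>structure_sheaf F U\<^esub> \<phi> U t"
    if "openin (proj_topology F) U" "s \<in> sections F U" "t \<in> sections F U" for U s t
    using all that by (simp_all add: structure_sheaf_simps(1))
  have square: "\<phi> U (s [^]\<^bsub>structure_sheaf F U\<^esub> (2::nat)) = s"
    if "openin (proj_topology F) U" "s \<in> sections F U" for U s
    using all that by (simp add: structure_sheaf_simps(1))
  have res: "\<phi> V (restrict s V) = restrict (\<phi> U s) V"
    if "openin (proj_topology F) U" "openin (proj_topology F) V" "V \<subseteq> U" "s \<in> sections F U" for U V s
    using restrictions that by (simp add: structure_sheaf_simps(1))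
  obtain k l where kl: "k \<noteq> l" "kill k (kill l F) \<noteq> 0" using exists_regular_pair[OF F] by blast
  have kill_l: "kill l F \<noteq> 0" using kl(2) by (auto simp: kill_simps)
  have kill_k: "kill k F \<noteq> 0"
  proof
    assume "kill k F = 0"
    then obtain F' where "F = Var k * F'" by (rule kill_eq_0D)
    then show False using kl by (simp add: kill_simps)
  qed
  let ?U = "basic_open F" and ?V = "basic_open F k \<inter> basic_open F l"
  let ?O = "structure_sheaf F"
  note U = openin_basic_open[of F]
  have V: "openin (proj_topology F) ?V" by (intro openin_Int U)
  \<comment> \<open>A quadratic form as a function on a basic open set. As degrees are halved, its
    image should be a linear form over \<open>Var i\<close>.\<close>
  define w where "w i q = fraction_section F (?U i) q (Var i ^ 2)" for i q
  have w: "w i q \<in> sections F (?U i)" if "homogeneous 2 q" for i q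
    unfolding w_def
    by (rule fraction_section_sections[OF U]) (use that basic_openD is_fraction_Var_power in blast)
  have "\<exists>G. homogeneous 1 G \<and> (\<forall>Q\<in>?U l. \<phi> (?U l) (w l q) Q = fraction F Q G (Var l))"
    if q: "homogeneous 2 q" for q
  proof -
    have num: "\<exists>n g. homogeneous (Suc n) g \<and> (\<forall>Q\<in>?U i. \<phi> (?U i) (w i q) Q = fraction F Q g (Var i ^ Suc n))" for i
    proof -
      obtain n g where "homogeneous (Suc n) g" "\<And>Q. Q \<in> ?U i \<Longrightarrow> \<phi> (?U i) (w i q) Q = fraction F Q g (Var i ^ Suc n)"
        by (rule section_basic_open[OF F(1) funcset_mem[OF \<phi>[OF U] w[OF q]]]) (rule that)
      then show ?thesis by (intro exI conjI ballI)
    qed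
    obtain n g where g: "homogeneous (Suc n) g" "\<And>Q. Q \<in> ?U l \<Longrightarrow> \<phi> (?U l) (w l q) Q = fraction F Q g (Var l ^ Suc n)"
      using num by blast
    obtain m g' where g': "homogeneous (Suc m) g'" "\<And>Q. Q \<in> ?U k \<Longrightarrow> \<phi> (?U k) (w k q) Q = fraction F Q g' (Var k ^ Suc m)"
      using num by blast
    have hpV: "homogeneous_prime P" "Var k \<notin> P" "Var l \<notin> P" if "P \<in> ?V" for P
      using that basic_openD by blast+
    have frac_l: "is_fraction P q (Var l ^ 2)" "is_fraction P g (Var l ^ Suc n)"
      and frac_k: "is_fraction P q (Var k ^ 2)" "is_fraction P g' (Var k ^ Suc m)"
      and frac_lk: "is_fraction P (Var l) (Var k)" if "P \<in> ?V" for P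
      using is_fraction_Var_power[OF hpV(1,3)[OF that] q] is_fraction_Var_power[OF hpV(1,3)[OF that] g(1)]
        is_fraction_Var_power[OF hpV(1,2)[OF that] q] is_fraction_Var_power[OF hpV(1,2)[OF that] g'(1)]
        is_fraction_Var_power[OF hpV(1,2)[OF that] homogeneous_Var, of l] by simp_all
    \<comment> \<open>On the overlap the two functions of \<open>q\<close> differ by the square of
      this one, so by semilinearity their images differ by its first power.\<close>
    let ?u = "fraction_section F ?V (Var l) (Var k)"
    have "restrict (w k q) ?V = fraction_section F ?V q (Var k ^ 2)"
      by (auto simp: w_def fraction_section_def fun_eq_iff)
    also have "\<dots> = fraction_section F ?V (Var l * Var l * q) (Var k * Var k * Var l ^ 2)"
    proof (rule fraction_section_eq[OF V frac_k(1)])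
      fix P assume P: "P \<in> ?V"
      show "is_fraction P (Var l * Var l * q) (Var k * Var k * Var l ^ 2)"
        by (intro is_fraction_mult[OF hpV(1)[OF P]] frac_lk[OF P] frac_l(1)[OF P])
    qed (simp_all add: power2_eq_square algebra_simps)
    also have "\<dots> = ?u [^]\<^bsub>?O ?V\<^esub> (2::nat) \<otimes>\<^bsub>?O ?V\<^esub> fraction_section F ?V q (Var l ^ 2)"
      by (rule fraction_section_square_mult[OF V, symmetric]) (use frac_l frac_lk in auto)
    also have "fraction_section F ?V q (Var l ^ 2) = restrict (w l q) ?V"
      by (auto simp: w_def fraction_section_def fun_eq_iff)
    finally have "restrict (w k q) ?V = ?u [^]\<^bsub>?O ?V\<^esub> (2::nat) \<otimes>\<^bsub>?O ?V\<^esub> restrict (w l q) ?V" .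
    then have "\<phi> ?V (restrict (w k q) ?V) = \<phi> ?V (?u [^]\<^bsub>?O ?V\<^esub> (2::nat) \<otimes>\<^bsub>?O ?V\<^esub> restrict (w l q) ?V)"
      by (rule arg_cong)
    also have "\<dots> = ?u \<otimes>\<^bsub>?O ?V\<^esub> \<phi> ?V (restrict (w l q) ?V)"
    proof (rule semilinear[OF V])
      show "?u \<in> sections F ?V" by (rule fraction_section_sections[OF V frac_lk])
      have "restrict (w l q) ?V = fraction_section F ?V q (Var l ^ 2)"
        by (auto simp: w_def fraction_section_def fun_eq_iff)
      then show "restrict (w l q) ?V \<in> sections F ?V"
        using fraction_section_sections[OF V frac_l(1)] by simp
    qed
    finally have eq: "restrict (\<phi> (?U k) (w k q)) ?V = ?u \<otimes>\<^bsub>?O ?V\<^esub> restrict (\<phi> (?U l) (w l q)) ?V"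
      using res[OF U V _ w[OF q], of k] res[OF U V _ w[OF q], of l] by simp
    have glue: "fraction F P g' (Var k ^ Suc m) = fraction F P (Var l * g) (Var k * Var l ^ Suc n)" if P: "P \<in> ?V" for P
    proof -
      have "fraction F P g' (Var k ^ Suc m) = germ_mult F P (fraction F P (Var l) (Var k)) (fraction F P g (Var l ^ Suc n))"
        using fun_cong[OF eq, of P] P g(2)[of P] g'(2)[of P]
        by (simp add: structure_sheaf_simps fraction_section_def)
      then show ?thesis
        using germ_mult_fraction[OF hpV(1)[OF P] frac_lk[OF P] frac_l(2)[OF P]] by simp
    qed
    have inV: "P \<in> ?V" if "homogeneous_prime P" "F \<in> P" "Var k * Var l \<notin> P" for P
      using that prime_mult_iff[OF that(1)] by (auto intro: basic_openI)
    obtain N where N: "F dvd (Var k * Var l) ^ N * (g' * (Var k * Var l ^ Suc n) - (Var l * g) * Var k ^ Suc m)"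
    proof (rule fraction_eq_dvd[OF F(1), of "Var k * Var l"])
      fix P assume P: "homogeneous_prime P" "F \<in> P" "Var k * Var l \<notin> P"
      note PV = inV[OF P]
      show "is_fraction P g' (Var k ^ Suc m)" "is_fraction P (Var l * g) (Var k * Var l ^ Suc n)"
        using frac_k(2)[OF PV] is_fraction_mult[OF P(1) frac_lk[OF PV] frac_l(2)[OF PV]] by simp_all
      show "fraction F P g' (Var k ^ Suc m) = fraction F P (Var l * g) (Var k * Var l ^ Suc n)"
        by (rule glue[OF PV])
    qed blast
    \<comment> \<open>Neither variable divides \<open>F\<close>, so the powers in front can be
      cancelled.\<close>
    have "(Var k * Var l) ^ N * (g' * (Var k * Var l ^ Suc n) - (Var l * g) * Var k ^ Suc m)
      = Var k ^ Suc N * (Var l ^ Suc N * (Var l ^ n * g' - Var k ^ m * g))"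
      by (simp add: power_mult_distrib algebra_simps)
    then have "F dvd Var l ^ n * g' - Var k ^ m * g"
      using N dvd_Var_cancel[OF kill_k] dvd_Var_cancel[OF kill_l] by metis
    then obtain b where "Var l ^ n * g' - Var k ^ m * g = F * b" by (rule dvdE)
    then have "Var k ^ m * g = Var l ^ n * g' + F * (- b)" by (simp add: algebra_simps)
    \<comment> \<open>By regularity the power of \<open>Var k\<close> drops out: \<open>g\<close>
      lies in the ideal of \<open>F\<close> and Var l ^ n, so the image needs only the first power
      of \<open>Var l\<close> as denominator.\<close>
    then obtain a c where ac: "g = Var l ^ n * a + F * c" using regular_Var_power[OF kl(2,1)] by blast
    define G where "G = hom_component 1 a"
    have "hom_component (Suc n) g = hom_component (Suc n) (a * Var l ^ n) + hom_component (Suc n) (c * F)"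
      by (simp add: ac hom_component_add ac_simps)
    also have "hom_component (Suc n) (a * Var l ^ n) = G * Var l ^ n"
      by (simp add: hom_component_mult_homogeneous[OF homogeneous_Var_power] G_def)
    also have "hom_component (Suc n) (c * F) = (if 3 \<le> Suc n then hom_component (Suc n - 3) c else 0) * F"
      by (simp add: hom_component_mult_homogeneous[OF F(1)])
    finally have gG: "g = G * Var l ^ n + (if 3 \<le> Suc n then hom_component (Suc n - 3) c else 0) * F"
      using hom_component_homogeneous[OF g(1), of "Suc n"] by simp
    have hG: "homogeneous 1 G" unfolding G_def by (rule homogeneous_hom_component)
    have "\<phi> (?U l) (w l q) Q = fraction F Q G (Var l)" if Q: "Q \<in> ?U l" for Q
    proof -
      note hp = basic_openD(1)[OF Q] and x = basic_openD(3)[OF Q]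
      have f1: "is_fraction Q g (Var l ^ Suc n)" using is_fraction_Var_power[OF hp x g(1)] .
      have f2: "is_fraction Q G (Var l)" using is_fraction_Var_power[OF hp x hG] by simp
      have "g * Var l - G * Var l ^ Suc n = (if 3 \<le> Suc n then hom_component (Suc n - 3) c else 0) * F * Var l"
        by (subst gG) (simp add: algebra_simps)
      then have "F dvd g * Var l - G * Var l ^ Suc n" by simp
      then have "fraction F Q g (Var l ^ Suc n) = fraction F Q G (Var l)"
        using fraction_eq_iff[OF hp f1 f2, where F = F] frac_eqI[OF hp] by blast
      then show ?thesis using g(2)[OF Q] by simp
    qed
    with hG show ?thesis by blast
  qed
  then obtain G where G: "\<And>q. homogeneous 2 q \<Longrightarrow> homogeneous 1 (G q)"
    "\<And>q Q. homogeneous 2 q \<Longrightarrow> Q \<in> ?U l \<Longrightarrow> \<phi> (?U l) (w l q) Q = fraction F Q (G q) (Var l)"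
    by metis
  let ?x = "Var l :: 'k poly4"
  have Ul: "homogeneous_prime P" "?x \<notin> P" if "P \<in> ?U l" for P using basic_openD that by blast+
  have in_Ul: "P \<in> ?U l" if "homogeneous_prime P" "F \<in> P" "?x \<notin> P" for P using basic_openI that by blast
  have frac: "is_fraction P a (?x ^ n)" if "P \<in> ?U l" "homogeneous n a" for P a n
    using is_fraction_Var_power Ul that by blast
  have frac1: "is_fraction P a ?x" if "P \<in> ?U l" "homogeneous 1 a" for P a
    using frac[OF that] by simp
  have sec: "fraction_section F (?U l) a ?x \<in> sections F (?U l)" if "homogeneous 1 a" for a
    by (rule fraction_section_sections[OF U frac1]) (use that in auto)
  define L where "L i = (\<Sum>j\<in>UNIV. Const (square_coeffs F $ i $ j) * Var j)" for i
  have L: "homogeneous 1 (L i)" for i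
    unfolding L_def by (intro homogeneous_sum homogeneous_Const_mult homogeneous_Var)
  have FL: "F = (\<Sum>i\<in>UNIV. (Var i)\<^sup>2 * L i)"
    by (subst squarefree_0_polynomial[OF F(1,2)]) (simp add: L_def sum_distrib_left ac_simps)
  have LL: "homogeneous 2 (L i * L j)" for i j
    using homogeneous_mult[OF L L, of i j] by (simp add: numeral_2_eq_2)
  have G_square: "G (L i * L i) = L i" for i
  proof -
    let ?s = "fraction_section F (?U l) (L i) ?x"
    have "?s [^]\<^bsub>?O (?U l)\<^esub> (2::nat) = w l (L i * L i)"
      unfolding structure_sheaf_square w_def fraction_section_def
    proof (rule restrict_ext)
      fix P assume P: "P \<in> ?U l"
      show "germ_mult F P (germ_mult F P (fraction F P 1 1) ((\<lambda>P\<in>?U l. fraction F P (L i) ?x) P))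
          ((\<lambda>P\<in>?U l. fraction F P (L i) ?x) P) = fraction F P (L i * L i) (?x ^ 2)"
        using germ_square_fraction[OF Ul(1)[OF P] frac1[OF P L]] P by (simp add: power2_eq_square)
    qed
    then have "\<phi> (?U l) (w l (L i * L i)) = ?s" using square[OF U sec[OF L]] by metis
    then have eq: "fraction F P (G (L i * L i)) ?x = fraction F P (L i) ?x" if "P \<in> ?U l" for P
      using G(2)[OF LL that, of i i] that by (simp add: fraction_section_def)
    obtain n where "F dvd ?x ^ n * (G (L i * L i) * ?x - L i * ?x)"
      by (rule fraction_eq_dvd[OF F(1), of ?x]) (use in_Ul frac1 G(1)[OF LL] L eq in blast)+
    then have "F dvd ?x ^ Suc n * (G (L i * L i) - L i)" by (simp add: algebra_simps)
    then have "F dvd G (L i * L i) - L i" by (rule dvd_Var_cancel[OF kill_l])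
    then have "G (L i * L i) - L i = 0"
      by (rule dvd_homogeneous_degree[OF F(1) homogeneous_diff[OF G(1)[OF LL] L]]) simp
    then show ?thesis by simp
  qed
  have relation: "(\<Sum>j\<in>UNIV. Var j * G (L i * L j)) = 0" for i
  proof -
    \<comment> \<open>The square of Var j / Var l times the function of L i * L j, with the
      denominator unsimplified to match \<open>fraction_section_square_mult\<close>. The four of
      them sum to L i * F over a power of \<open>Var l\<close>, which is zero on the
      surface.\<close>
    define t where "t j = fraction_section F (?U l) (Var j * Var j * (L i * L j)) (?x * ?x * ?x ^ 2)" for j
    have u: "fraction_section F (?U l) (Var j) ?x \<in> sections F (?U l)" for j
      by (rule sec[OF homogeneous_Var])
    have ft: "is_fraction P (Var j * Var j * (L i * L j)) (?x * ?x * ?x ^ 2)" if P: "P \<in> ?U l" for P j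
      by (intro is_fraction_mult[OF Ul(1)[OF P]] frac1[OF P homogeneous_Var] frac[OF P LL])
    have t_eq: "t j = fraction_section F (?U l) (Var j) ?x [^]\<^bsub>?O (?U l)\<^esub> (2::nat) \<otimes>\<^bsub>?O (?U l)\<^esub> w l (L i * L j)" for j
      unfolding t_def w_def
      by (rule fraction_section_square_mult[OF U, symmetric]) (use frac1[OF _ homogeneous_Var] frac[OF _ LL] in auto)
    have ts: "t j \<in> sections F (?U l)" for j
      unfolding t_def by (rule fraction_section_sections[OF U ft])
    have \<phi>t: "\<phi> (?U l) (t j) P = fraction F P (Var j * G (L i * L j)) (?x ^ 2)" if P: "P \<in> ?U l" for P j
    proof -
      have "\<phi> (?U l) (t j) = fraction_section F (?U l) (Var j) ?x \<otimes>\<^bsub>?O (?U l)\<^esub> \<phi> (?U l) (w l (L i * L j))"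
        unfolding t_eq by (rule semilinear[OF U u w[OF LL]])
      then have "\<phi> (?U l) (t j) P = germ_mult F P (fraction F P (Var j) ?x) (fraction F P (G (L i * L j)) ?x)"
        using P G(2)[OF LL P] by (simp add: structure_sheaf_simps fraction_section_def)
      then show ?thesis
        using germ_mult_fraction[OF Ul(1)[OF P] frac1[OF P homogeneous_Var] frac1[OF P G(1)[OF LL]]]
        by (simp add: power2_eq_square)
    qed
    let ?plus = "\<lambda>s s'. s \<oplus>\<^bsub>?O (?U l)\<^esub> s'"
    have add_same: "germ_add F P (fraction F P a b) (fraction F P c b) = fraction F P (a + c) b"
      if P: "P \<in> ?U l" and f: "is_fraction P a b" "is_fraction P c b" for P a b c
    proof -
      have sum: "is_fraction P (a + c) b"
      proof -
        obtain d where d: "homogeneous d a" "homogeneous d b" "b \<notin> P" using f(1) by (auto simp: is_fraction_def)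
        obtain e where e: "homogeneous e c" "homogeneous e b" using f(2) by (auto simp: is_fraction_def)
        \<comment> \<open>Zero is homogeneous of every degree, so the common degree of the
          numerators must come from a nonzero denominator.\<close>
        have "b \<noteq> 0" using d(3) prime_0[OF Ul(1)[OF P]] by auto
        then have "d = e" using hom_component_homogeneous[OF d(2), of d] hom_component_homogeneous[OF e(2), of d]
          by (auto split: if_splits)
        then show ?thesis using d e homogeneous_add unfolding is_fraction_def by blast
      qed
      have "frac_eq P F (a * b + c * b) (b * b) (a + c) b"
        by (rule frac_eqI[OF Ul(1)[OF P]]) (simp add: algebra_simps)
      then show ?thesis
        using germ_add_fraction[OF Ul(1)[OF P] f] fraction_eq_iff[OF Ul(1)[OF P] is_fraction_add[OF Ul(1)[OF P] f] sum]
        by simp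
    qed
    have plus_section: "fraction_section F (?U l) (a + c) b = ?plus (fraction_section F (?U l) a b) (fraction_section F (?U l) c b)"
      if "\<And>P. P \<in> ?U l \<Longrightarrow> is_fraction P a b" "\<And>P. P \<in> ?U l \<Longrightarrow> is_fraction P c b" for a b c
      using that by (auto simp: structure_sheaf_simps fraction_section_def fun_eq_iff add_same)
    define A where "A j = Var j * Var j * (L i * L j)" for j
    define b where "b = ?x * ?x * ?x ^ 2"
    have hA: "homogeneous 4 (A j)" for j
    proof -
      have "homogeneous (1 + 1 + 2) (A j)"
        unfolding A_def by (intro homogeneous_mult homogeneous_Var LL)
      then show ?thesis by (simp add: eval_nat_numeral)
    qed
    have b4: "b = ?x ^ 4" by (simp add: b_def eval_nat_numeral)
    have fA: "is_fraction P a b" if "P \<in> ?U l" "homogeneous 4 a" for P a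
      unfolding b4 using frac that by blast
    have tA: "t j = fraction_section F (?U l) (A j) b" for j by (simp add: t_def A_def b_def)
    have sA: "fraction_section F (?U l) a b \<in> sections F (?U l)" if "homogeneous 4 a" for a
      by (rule fraction_section_sections[OF U fA]) (use that in auto)
    have plus_A: "fraction_section F (?U l) (a + A j) b = ?plus (fraction_section F (?U l) a b) (t j)"
      if "homogeneous 4 a" for a j
      unfolding tA by (rule plus_section) (use fA that hA in auto)
    have t2: "?plus (t 1) (t 2) = fraction_section F (?U l) (A 1 + A 2) b"
      unfolding plus_A[OF hA] by (simp only: tA)
    have t3: "?plus (?plus (t 1) (t 2)) (t 3) = fraction_section F (?U l) (A 1 + A 2 + A 3) b"
      unfolding t2 by (rule plus_A[symmetric]) (intro homogeneous_add hA)
    have sum_t: "fraction_section F (?U l) (A 1 + A 2 + A 3 + A 4) b = ?plus (?plus (?plus (t 1) (t 2)) (t 3)) (t 4)"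
      unfolding t3 by (rule plus_A) (intro homogeneous_add hA)
    have partial: "?plus (t 1) (t 2) \<in> sections F (?U l)" "?plus (?plus (t 1) (t 2)) (t 3) \<in> sections F (?U l)"
      unfolding t3 unfolding t2 by (intro sA homogeneous_add hA)+
    have "A 1 + A 2 + A 3 + A 4 = L i * F"
      by (subst FL) (simp add: A_def sum_4 power2_eq_square algebra_simps)
    then have "fraction_section F (?U l) (A 1 + A 2 + A 3 + A 4) b = fraction_section F (?U l) 0 ?x"
      by (intro fraction_section_eq[OF U] fA frac1 homogeneous_add hA homogeneous_0) simp_all
    \<comment> \<open>That \<phi> maps zero to zero is drawn from 0 = 0^2 * 0 and
      semilinearity.\<close>
    also have "\<dots> = fraction_section F (?U l) 0 ?x [^]\<^bsub>?O (?U l)\<^esub> (2::nat) \<otimes>\<^bsub>?O (?U l)\<^esub> fraction_section F (?U l) 0 ?x"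
    proof -
      have "fraction_section F (?U l) 0 ?x = fraction_section F (?U l) (0 * 0 * 0) (?x * ?x * ?x)"
      proof (rule fraction_section_eq[OF U frac1])
        fix P assume P: "P \<in> ?U l"
        show "is_fraction P (0 * 0 * 0) (?x * ?x * ?x)"
          by (intro is_fraction_mult[OF Ul(1)[OF P]] frac1[OF P] homogeneous_0)
      qed simp_all
      then show ?thesis
        using fraction_section_square_mult[OF U frac1 frac1, of l 0 0] by simp
    qed
    finally have "\<phi> (?U l) (?plus (?plus (?plus (t 1) (t 2)) (t 3)) (t 4))
        = fraction_section F (?U l) 0 ?x \<otimes>\<^bsub>?O (?U l)\<^esub> \<phi> (?U l) (fraction_section F (?U l) 0 ?x)"
      unfolding sum_t using semilinear[OF U sec[OF homogeneous_0] sec[OF homogeneous_0]] by simp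
    also have "\<phi> (?U l) (?plus (?plus (?plus (t 1) (t 2)) (t 3)) (t 4))
        = ?plus (?plus (?plus (\<phi> (?U l) (t 1)) (\<phi> (?U l) (t 2))) (\<phi> (?U l) (t 3))) (\<phi> (?U l) (t 4))"
      by (simp add: add[OF U] partial ts)
    finally have eq: "?plus (?plus (?plus (\<phi> (?U l) (t 1)) (\<phi> (?U l) (t 2))) (\<phi> (?U l) (t 3))) (\<phi> (?U l) (t 4))
        = fraction_section F (?U l) 0 ?x \<otimes>\<^bsub>?O (?U l)\<^esub> \<phi> (?U l) (fraction_section F (?U l) 0 ?x)" .
    define C where "C j = Var j * G (L i * L j)" for j
    have hC: "homogeneous 2 (C j)" for j
      using homogeneous_mult[OF homogeneous_Var G(1)[OF LL], of j i j] by (simp add: C_def numeral_2_eq_2)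
    have main: "fraction F P (C 1 + C 2 + C 3 + C 4) (?x ^ 2) = fraction F P 0 ?x" if P: "P \<in> ?U l" for P
    proof -
      obtain a d where ad: "is_fraction P a d" "\<phi> (?U l) (fraction_section F (?U l) 0 ?x) P = fraction F P a d"
        by (rule section_germ[OF funcset_mem[OF \<phi>[OF U] sec[OF homogeneous_0]] P]) (rule that)
      have f0: "is_fraction P 0 ?x" using frac1[OF P homogeneous_0] .
      have fC: "is_fraction P (C j) (?x ^ 2)" "is_fraction P (C j + C j') (?x ^ 2)" "is_fraction P (C j + C j' + C j'') (?x ^ 2)" for j j' j''
        by (intro frac[OF P] homogeneous_add hC)+
      have "fraction F P (C 1 + C 2 + C 3 + C 4) (?x ^ 2) = germ_mult F P (fraction F P 0 ?x) (fraction F P a d)"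
        using fun_cong[OF eq, of P] P \<phi>t[OF P, folded C_def] ad(2)
        by (simp add: structure_sheaf_simps fraction_section_def add_same fC)
      also have "\<dots> = fraction F P (0 * a) (?x * d)"
        by (rule germ_mult_fraction[OF Ul(1)[OF P] f0 ad(1)])
      also have "\<dots> = fraction F P 0 ?x"
        using fraction_eq_iff[OF Ul(1)[OF P] is_fraction_mult[OF Ul(1)[OF P] f0 ad(1)] f0, where F = F]
          frac_eqI[OF Ul(1)[OF P]] by simp
      finally show ?thesis .
    qed
    obtain n where "F dvd ?x ^ n * ((C 1 + C 2 + C 3 + C 4) * ?x - 0 * ?x ^ 2)"
    proof (rule fraction_eq_dvd[OF F(1), of ?x])
      fix P assume "homogeneous_prime P" "F \<in> P" "?x \<notin> P"
      then have P: "P \<in> ?U l" by (rule in_Ul)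
      show "is_fraction P (C 1 + C 2 + C 3 + C 4) (?x ^ 2)" "is_fraction P 0 ?x"
        by (intro frac[OF P] frac1[OF P] homogeneous_add hC homogeneous_0)+
      show "fraction F P (C 1 + C 2 + C 3 + C 4) (?x ^ 2) = fraction F P 0 ?x" by (rule main[OF P])
    qed blast
    then have "F dvd ?x ^ Suc n * (C 1 + C 2 + C 3 + C 4)" by (simp add: algebra_simps)
    then have "F dvd C 1 + C 2 + C 3 + C 4" by (rule dvd_Var_cancel[OF kill_l])
    moreover have "homogeneous 2 (C 1 + C 2 + C 3 + C 4)" by (intro homogeneous_add hC)
    ultimately have "C 1 + C 2 + C 3 + C 4 = 0" using dvd_homogeneous_degree[OF F(1)] by simp
    then show ?thesis by (simp add: sum_4 C_def)
  qed
  have cancel: "(p :: 'k poly4) + p = 0" "p + (p + p') = p'" for p p'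
    using two_add_self[OF two] by (simp_all flip: add.assoc)
  have "0 = (\<Sum>i\<in>UNIV. Var i * (\<Sum>j\<in>UNIV. Var j * G (L i * L j)))"
    by (simp add: relation)
  also have "\<dots> = (\<Sum>i\<in>UNIV. (Var i)\<^sup>2 * G (L i * L i))"
    by (simp add: sum_4 power2_eq_square algebra_simps cancel)
  also have "\<dots> = F"
    by (subst FL) (simp add: G_square)
  finally show False using F(3) by simp
qed

theorem corollary5p2:
  fixes F :: "'k::alg_closed_field poly4"
  assumes "CHAR('k) = 2"
    and "smooth_cubic_surface F"
  shows "(frobenius_split_surface F \<longleftrightarrow> \<not> triangle_free F) \<and>
         (\<not> frobenius_split_surface F \<longleftrightarrow> projectively_equivalent F fermat_cubic)"
proof -
  have two: "(2::'k) = 0"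
    using of_nat_CHAR[where 'a = 'k] by (simp add: assms(1))
  have F: "homogeneous 3 F" "F \<noteq> 0"
    using assms(2) by (auto simp: smooth_cubic_surface_def)
  show ?thesis
  proof (cases "squarefree_coeffs F = 0")
    case True
    then show ?thesis
      using not_frobenius_split[OF assms(1) two_poly4[OF two] F(1) True F(2)]
        triangle_free_squarefree_0[OF two assms(2) True]
        projectively_equivalent_fermat_cubic[OF two assms(2) True] by blast
  next
    case False
    then show ?thesis
      using splitting_operator_exists[OF two F(1) False] splitting_operator.frobenius_split_surface[OF _ assms(1)]
        not_triangle_free[OF two assms(2) False]
        squarefree_coeffs_fermat_equivalent[OF two F(1)] by blast
  qed
qed

end
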